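(* Let $\Omega$ be a smooth manifold without boundary with a $C^1$ Riemannian metric. Let $M$ be a proper, $m$-dimensional submanifold of $\Omega$ with no boundary and with mean curvature everywhere $\le h$. Then $M$ is an $(m,h)$ subset of $\Omega$. More generally, let $M$ be an $m$-dimensional varifold (not necessarily rectifiable) in $\Omega$ of locally bounded first variation with mean curvature everywhere $\le h$ and with no generalized boundary. Then the support of $M$ is an $(m,h)$ subset of $\Omega$.
   Context: Mean curvature $\le h$ means $|H|\le h$, where $H$ is the mean curvature vector. For a varifold $M$ of locally bounded first variation with weight measure $|M|$, having no generalized boundary means that the first variation $\delta M$ is absolutely continuous with respect to $|M|$, so that $\delta M(X)=-\int H\cdot X\,d|M|$ for all compactly supported $C^1$ vectorfields $X$, where $H$ is the generalized mean curvature. Definition of $(m,h)$ subset: let $\Omega$ be a smooth manifold without boundary with a $C^1$ Riemannian metric $g$. A closed subset $Z\subset\Omega$ is an $(m,h)$ subset of $\Omega$ if, whenever $f:\Omega\to\mathbf{R}$ is a $C^2$ function such that $f|Z$ has a local maximum at $p\in Z$, we have $\operatorname{Trace}_m(\mathrm{D}^2f(p))\le h\,|\mathrm{D}f(p)|$. Here $\mathrm{D}^2f$ is the Hessian of $f$ with respect to $g$, $|\mathrm{D}f|$ is the norm of the derivative with respect to $g$, and $\operatorname{Trace}_m$ denotes the sum of the $m$ lowest eigenvalues (with respect to $g$, counted with multiplicity). *)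

theory Defs
  imports "HOL-Analysis.Analysis"
begin

section \<open>Functions of class $C^k$ on open subsets of a Euclidean space\<close>

text \<open>Only used for open sets \<open>S\<close>, where differentiability at a point and within \<open>S\<close> agree.\<close>

primrec Ck_on :: "nat \<Rightarrow> 'b::euclidean_space set \<Rightarrow> ('b \<Rightarrow> 'c::real_normed_vector) \<Rightarrow> bool" where
  "Ck_on 0 S f \<longleftrightarrow> continuous_on S f"
| "Ck_on (Suc k) S f \<longleftrightarrow> (\<forall>x\<in>S. f differentiable (at x)) \<and>
     (\<forall>v. Ck_on k S (\<lambda>x. frechet_derivative f (at x) v))"

definition smooth_on :: "'b::euclidean_space set \<Rightarrow> ('b \<Rightarrow> 'c::real_normed_vector) \<Rightarrow> bool" where
  "smooth_on S f \<longleftrightarrow> (\<forall>k. Ck_on k S f)"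


section \<open>Smooth manifolds\<close>

text \<open>
  A smooth manifold without boundary is a type \<open>'a\<close> (Hausdorff and second countable, by its type
  classes) with a smooth atlas modelled on a Euclidean space \<open>'b\<close>. A chart is a pair of its domain
  and its coordinate map; values of the coordinate map outside the domain are irrelevant.
\<close>

type_synonym ('a, 'b) chart = "'a set \<times> ('a \<Rightarrow> 'b)"

definition chart_image :: "('a, 'b) chart \<Rightarrow> 'b set" where
  "chart_image c = snd c ` fst c"

definition chart_inv :: "('a, 'b) chart \<Rightarrow> 'b \<Rightarrow> 'a" where
  "chart_inv c = inv_into (fst c) (snd c)"

definition topological_chart :: "('a::topological_space, 'b::euclidean_space) chart \<Rightarrow> bool" where
  "topological_chart c \<longleftrightarrow> open (fst c) \<and> open (chart_image c) \<and>
     homeomorphism (fst c) (chart_image c) (snd c) (chart_inv c)"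

definition smooth_atlas :: "('a::topological_space, 'b::euclidean_space) chart set \<Rightarrow> bool" where
  "smooth_atlas A \<longleftrightarrow> (\<Union>c\<in>A. fst c) = UNIV \<and> (\<forall>c\<in>A. topological_chart c) \<and>
     (\<forall>c\<in>A. \<forall>d\<in>A. smooth_on (snd c ` (fst c \<inter> fst d)) (snd d \<circ> chart_inv c))"

text \<open>
  The tangent space at \<open>p\<close> is the model space \<open>'b\<close>: a vector in \<open>'b\<close> stands for the tangent vector
  having it as components in a chart around \<open>p\<close> that is chosen once and for all. The function
  \<open>to_chart A c p\<close> gives the components of a tangent vector at \<open>p\<close> in another chart \<open>c\<close>, and
  \<open>from_chart A c p\<close> is its inverse.
\<close>

definition chart_at :: "('a, 'b) chart set \<Rightarrow> 'a \<Rightarrow> ('a, 'b) chart" where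
  "chart_at A p = (SOME c. c \<in> A \<and> p \<in> fst c)"

definition to_chart ::
  "('a, 'b::euclidean_space) chart set \<Rightarrow> ('a, 'b) chart \<Rightarrow> 'a \<Rightarrow> 'b \<Rightarrow> 'b" where
  "to_chart A c p =
     frechet_derivative (snd c \<circ> chart_inv (chart_at A p)) (at (snd (chart_at A p) p))"

definition from_chart ::
  "('a, 'b::euclidean_space) chart set \<Rightarrow> ('a, 'b) chart \<Rightarrow> 'a \<Rightarrow> 'b \<Rightarrow> 'b" where
  "from_chart A c p = frechet_derivative (snd (chart_at A p) \<circ> chart_inv c) (at (snd c p))"

definition C2_function :: "('a, 'b::euclidean_space) chart set \<Rightarrow> ('a \<Rightarrow> real) \<Rightarrow> bool" where
  "C2_function A f \<longleftrightarrow> (\<forall>c\<in>A. Ck_on 2 (chart_image c) (f \<circ> chart_inv c))"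

definition field_in_chart ::
  "('a, 'b::euclidean_space) chart set \<Rightarrow> ('a, 'b) chart \<Rightarrow> ('a \<Rightarrow> 'b) \<Rightarrow> 'b \<Rightarrow> 'b" where
  "field_in_chart A c X x = to_chart A c (chart_inv c x) (X (chart_inv c x))"

definition C1_vectorfield :: "('a, 'b::euclidean_space) chart set \<Rightarrow> ('a \<Rightarrow> 'b) \<Rightarrow> bool" where
  "C1_vectorfield A X \<longleftrightarrow> (\<forall>c\<in>A. Ck_on 1 (chart_image c) (field_in_chart A c X))"


section \<open>Riemannian metrics of class $C^1$ and the Levi-Civita connection\<close>

definition metric_in_chart ::
  "('a, 'b::euclidean_space) chart set \<Rightarrow> ('a \<Rightarrow> 'b \<Rightarrow> 'b \<Rightarrow> real) \<Rightarrow>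
    ('a, 'b) chart \<Rightarrow> 'b \<Rightarrow> 'b \<Rightarrow> 'b \<Rightarrow> real" where
  "metric_in_chart A g c x u v =
     (let p = chart_inv c x in g p (from_chart A c p u) (from_chart A c p v))"

definition C1_metric ::
  "('a, 'b::euclidean_space) chart set \<Rightarrow> ('a \<Rightarrow> 'b \<Rightarrow> 'b \<Rightarrow> real) \<Rightarrow> bool" where
  "C1_metric A g \<longleftrightarrow>
     (\<forall>p. bilinear (g p) \<and> (\<forall>u v. g p u v = g p v u) \<and> (\<forall>u. u \<noteq> 0 \<longrightarrow> g p u u > 0)) \<and>
     (\<forall>c\<in>A. \<forall>u v. Ck_on 1 (chart_image c) (\<lambda>x. metric_in_chart A g c x u v))"

definition gnorm :: "('a \<Rightarrow> 'b \<Rightarrow> 'b \<Rightarrow> real) \<Rightarrow> 'a \<Rightarrow> 'b \<Rightarrow> real" where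
  "gnorm g p v = sqrt (g p v v)"

text \<open>\<open>metric_deriv A g p u v w\<close> is $\partial_u g(v,w)$ in the chosen chart at \<open>p\<close>.\<close>

definition metric_deriv ::
  "('a, 'b::euclidean_space) chart set \<Rightarrow> ('a \<Rightarrow> 'b \<Rightarrow> 'b \<Rightarrow> real) \<Rightarrow>
    'a \<Rightarrow> 'b \<Rightarrow> 'b \<Rightarrow> 'b \<Rightarrow> real" where
  "metric_deriv A g p u v w =
     frechet_derivative (\<lambda>x. metric_in_chart A g (chart_at A p) x v w)
       (at (snd (chart_at A p) p)) u"

text \<open>Christoffel symbols of the second kind, $u^i v^j \Gamma_{ij}^k$, in the chosen chart at \<open>p\<close>.\<close>

definition christoffel ::
  "('a, 'b::euclidean_space) chart set \<Rightarrow> ('a \<Rightarrow> 'b \<Rightarrow> 'b \<Rightarrow> real) \<Rightarrow> 'a \<Rightarrow> 'b \<Rightarrow> 'b \<Rightarrow> 'b" where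
  "christoffel A g p u v = (THE z. \<forall>w. g p z w =
     (metric_deriv A g p u v w + metric_deriv A g p v u w - metric_deriv A g p w u v) / 2)"

text \<open>The covariant derivative $\nabla_u X$ at \<open>p\<close>.\<close>

definition cov_deriv ::
  "('a, 'b::euclidean_space) chart set \<Rightarrow> ('a \<Rightarrow> 'b \<Rightarrow> 'b \<Rightarrow> real) \<Rightarrow>
    ('a \<Rightarrow> 'b) \<Rightarrow> 'a \<Rightarrow> 'b \<Rightarrow> 'b" where
  "cov_deriv A g X p u =
     frechet_derivative (field_in_chart A (chart_at A p) X) (at (snd (chart_at A p) p)) u
       + christoffel A g p u (X p)"

definition fun_deriv ::
  "('a, 'b::euclidean_space) chart set \<Rightarrow> ('a \<Rightarrow> real) \<Rightarrow> 'a \<Rightarrow> 'b \<Rightarrow> real" where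
  "fun_deriv A f p =
     frechet_derivative (f \<circ> chart_inv (chart_at A p)) (at (snd (chart_at A p) p))"

definition fun_deriv_norm ::
  "('a, 'b::euclidean_space) chart set \<Rightarrow> ('a \<Rightarrow> 'b \<Rightarrow> 'b \<Rightarrow> real) \<Rightarrow> ('a \<Rightarrow> real) \<Rightarrow> 'a \<Rightarrow> real" where
  "fun_deriv_norm A g f p = (SUP u\<in>{u. gnorm g p u \<le> 1}. \<bar>fun_deriv A f p u\<bar>)"

definition hessian ::
  "('a, 'b::euclidean_space) chart set \<Rightarrow> ('a \<Rightarrow> 'b \<Rightarrow> 'b \<Rightarrow> real) \<Rightarrow> ('a \<Rightarrow> real) \<Rightarrow>
    'a \<Rightarrow> 'b \<Rightarrow> 'b \<Rightarrow> real" where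
  "hessian A g f p u v =
     frechet_derivative
       (\<lambda>x. frechet_derivative (f \<circ> chart_inv (chart_at A p)) (at x) u)
       (at (snd (chart_at A p) p)) v
     - fun_deriv A f p (christoffel A g p u v)"


section \<open>Eigenvalues and $(m,h)$ subsets\<close>

text \<open>
  Eigenvalues of a symmetric bilinear form \<open>Q\<close> with respect to an inner product \<open>G\<close>; there are
  finitely many, and \<open>eigenvalue_list\<close> enumerates them in increasing order with multiplicity.
\<close>

definition form_eigenspace ::
  "('b \<Rightarrow> 'b \<Rightarrow> real) \<Rightarrow> ('b \<Rightarrow> 'b \<Rightarrow> real) \<Rightarrow> real \<Rightarrow> 'b::euclidean_space set" where
  "form_eigenspace G Q l = {u. \<forall>v. Q u v = l * G u v}"

definition eigenvalue_list ::
  "('b::euclidean_space \<Rightarrow> 'b \<Rightarrow> real) \<Rightarrow> ('b \<Rightarrow> 'b \<Rightarrow> real) \<Rightarrow> real list" where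
  "eigenvalue_list G Q =
     concat (map (\<lambda>l. replicate (dim (form_eigenspace G Q l)) l)
       (sorted_list_of_set {l. \<exists>u. u \<noteq> 0 \<and> u \<in> form_eigenspace G Q l}))"

definition lowest_trace ::
  "nat \<Rightarrow> ('b::euclidean_space \<Rightarrow> 'b \<Rightarrow> real) \<Rightarrow> ('b \<Rightarrow> 'b \<Rightarrow> real) \<Rightarrow> real" where
  "lowest_trace m G Q = sum_list (take m (eigenvalue_list G Q))"

definition mh_subset ::
  "('a::topological_space, 'b::euclidean_space) chart set \<Rightarrow> ('a \<Rightarrow> 'b \<Rightarrow> 'b \<Rightarrow> real) \<Rightarrow>
    nat \<Rightarrow> real \<Rightarrow> 'a set \<Rightarrow> bool" where
  "mh_subset A g m h Z \<longleftrightarrow> closed Z \<and>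
     (\<forall>f p. C2_function A f \<and> p \<in> Z \<and> (\<exists>U. open U \<and> p \<in> U \<and> (\<forall>q\<in>U \<inter> Z. f q \<le> f p)) \<longrightarrow>
        lowest_trace m (g p) (hessian A g f p) \<le> h * fun_deriv_norm A g f p)"


section \<open>Submanifolds and their mean curvature\<close>

text \<open>
  Submanifolds are embedded and of class $C^2$, given locally by slice charts. Such a submanifold is
  proper if and only if it is a closed subset.
\<close>

definition C2_chart ::
  "('a::topological_space, 'b::euclidean_space) chart set \<Rightarrow> ('a, 'b) chart \<Rightarrow> bool" where
  "C2_chart A d \<longleftrightarrow> topological_chart d \<and>
     (\<forall>c\<in>A. Ck_on 2 (snd c ` (fst c \<inter> fst d)) (snd d \<circ> chart_inv c) \<and>
            Ck_on 2 (snd d ` (fst c \<inter> fst d)) (snd c \<circ> chart_inv d))"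

definition proper_submanifold ::
  "('a::topological_space, 'b::euclidean_space) chart set \<Rightarrow> nat \<Rightarrow> 'a set \<Rightarrow> bool" where
  "proper_submanifold A m M \<longleftrightarrow> closed M \<and>
     (\<forall>p\<in>M. \<exists>d L. C2_chart A d \<and> p \<in> fst d \<and> subspace L \<and> dim L = m \<and>
        snd d ` (fst d \<inter> M) = chart_image d \<inter> L)"

text \<open>Velocities at \<open>p\<close> of curves in \<open>M\<close>.\<close>

definition tangent_space_at ::
  "('a::topological_space, 'b::euclidean_space) chart set \<Rightarrow> 'a set \<Rightarrow> 'a \<Rightarrow> 'b set" where
  "tangent_space_at A M p = {v. \<exists>\<gamma>::real \<Rightarrow> 'a. \<gamma> 0 = p \<and> isCont \<gamma> 0 \<and>
     (\<forall>\<^sub>F t in nhds 0. \<gamma> t \<in> M) \<and> ((snd (chart_at A p) \<circ> \<gamma>) has_vector_derivative v) (at 0)}"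

definition orthonormal_basis_of ::
  "('b \<Rightarrow> 'b \<Rightarrow> real) \<Rightarrow> 'b::euclidean_space set \<Rightarrow> 'b set" where
  "orthonormal_basis_of G S = (SOME E. finite E \<and> E \<subseteq> S \<and> span E = S \<and>
     (\<forall>e\<in>E. \<forall>e'\<in>E. G e e' = (if e = e' then 1 else 0)))"

definition normal_part ::
  "('b \<Rightarrow> 'b \<Rightarrow> real) \<Rightarrow> 'b::euclidean_space set \<Rightarrow> 'b \<Rightarrow> 'b" where
  "normal_part G S v = v - (\<Sum>e\<in>orthonormal_basis_of G S. G v e *\<^sub>R e)"

text \<open>
  The second fundamental form $(\nabla_u Y)^\perp$, where \<open>Y\<close> is a vectorfield tangent to \<open>M\<close> with
  $Y(p) = v$. The value does not depend on the choice of \<open>Y\<close>.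
\<close>

definition second_fundamental_form ::
  "('a::topological_space, 'b::euclidean_space) chart set \<Rightarrow> ('a \<Rightarrow> 'b \<Rightarrow> 'b \<Rightarrow> real) \<Rightarrow>
    'a set \<Rightarrow> 'a \<Rightarrow> 'b \<Rightarrow> 'b \<Rightarrow> 'b" where
  "second_fundamental_form A g M p u v =
     normal_part (g p) (tangent_space_at A M p)
       (cov_deriv A g
         (SOME Y. C1_vectorfield A Y \<and> (\<forall>q\<in>M. Y q \<in> tangent_space_at A M q) \<and> Y p = v) p u)"

text \<open>The mean curvature vector is the trace of the second fundamental form, not its average.\<close>

definition mean_curvature_vector ::
  "('a::topological_space, 'b::euclidean_space) chart set \<Rightarrow> ('a \<Rightarrow> 'b \<Rightarrow> 'b \<Rightarrow> real) \<Rightarrow>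
    'a set \<Rightarrow> 'a \<Rightarrow> 'b" where
  "mean_curvature_vector A g M p =
     (\<Sum>e\<in>orthonormal_basis_of (g p) (tangent_space_at A M p). second_fundamental_form A g M p e e)"


section \<open>Varifolds\<close>

text \<open>
  The bundle of \<open>m\<close>-planes consists of the pairs \<open>(p, S)\<close> with \<open>S\<close> an \<open>m\<close>-dimensional subspace of
  the tangent space at \<open>p\<close>. Subspaces of \<open>'b\<close> are topologized via their Euclidean orthogonal
  projections, which are the maps \<open>closest_point S\<close>; the topology of the bundle is the one for which
  each chart of the manifold induces a homeomorphism to a product with the Grassmannian of \<open>'b\<close>.
\<close>

definition grassmann_topology ::
  "('a::topological_space, 'b::euclidean_space) chart set \<Rightarrow> nat \<Rightarrow> ('a \<times> 'b set) topology" where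
  "grassmann_topology A m = topology_generated_by
     {{(p, S). p \<in> fst c \<and> subspace S \<and> dim S = m \<and>
         (snd c p, Blinfun (closest_point (to_chart A c p ` S))) \<in> W} | c W. c \<in> A \<and> open W}"

text \<open>
  Varifolds are the Radon measures on the bundle. The bundle is locally compact and second
  countable, so that regularity of Borel measures finite on compact sets is automatic.
\<close>

definition varifold ::
  "('a::topological_space, 'b::euclidean_space) chart set \<Rightarrow> nat \<Rightarrow> ('a \<times> 'b set) measure \<Rightarrow> bool" where
  "varifold A m V \<longleftrightarrow> space V = topspace (grassmann_topology A m) \<and>
     sets V = sigma_sets (topspace (grassmann_topology A m)) {W. openin (grassmann_topology A m) W} \<and>
     (\<forall>K. compactin (grassmann_topology A m) K \<longrightarrow> emeasure V K < \<infinity>)"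

definition weight :: "('a::topological_space \<times> 'b set) measure \<Rightarrow> 'a measure" where
  "weight V = distr V borel fst"

definition varifold_support :: "('a::topological_space \<times> 'b set) measure \<Rightarrow> 'a set" where
  "varifold_support V = {p. \<forall>U. open U \<and> p \<in> U \<longrightarrow> emeasure (weight V) U > 0}"

definition plane_divergence ::
  "('a, 'b::euclidean_space) chart set \<Rightarrow> ('a \<Rightarrow> 'b \<Rightarrow> 'b \<Rightarrow> real) \<Rightarrow>
    ('a \<Rightarrow> 'b) \<Rightarrow> 'a \<Rightarrow> 'b set \<Rightarrow> real" where
  "plane_divergence A g X p S =
     (\<Sum>e\<in>orthonormal_basis_of (g p) S. g p (cov_deriv A g X p e) e)"

definition first_variation ::
  "('a, 'b::euclidean_space) chart set \<Rightarrow> ('a \<Rightarrow> 'b \<Rightarrow> 'b \<Rightarrow> real) \<Rightarrow>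
    ('a \<times> 'b set) measure \<Rightarrow> ('a \<Rightarrow> 'b) \<Rightarrow> real" where
  "first_variation A g V X = (\<integral>(p, S). plane_divergence A g X p S \<partial>V)"

definition test_fields ::
  "('a::topological_space, 'b::euclidean_space) chart set \<Rightarrow> 'a set \<Rightarrow> ('a \<Rightarrow> 'b) set" where
  "test_fields A U =
     {X. C1_vectorfield A X \<and> compact (closure {p. X p \<noteq> 0}) \<and> closure {p. X p \<noteq> 0} \<subseteq> U}"

text \<open>
  The total variation $\|\delta V\|$, first on open sets and then on arbitrary sets by outer
  regularity.
\<close>

definition variation_open ::
  "('a::topological_space, 'b::euclidean_space) chart set \<Rightarrow> ('a \<Rightarrow> 'b \<Rightarrow> 'b \<Rightarrow> real) \<Rightarrow>
    ('a \<times> 'b set) measure \<Rightarrow> 'a set \<Rightarrow> ereal" where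
  "variation_open A g V U =
     (SUP X\<in>{X \<in> test_fields A U. \<forall>p. gnorm g p (X p) \<le> 1}. ereal (first_variation A g V X))"

definition variation ::
  "('a::topological_space, 'b::euclidean_space) chart set \<Rightarrow> ('a \<Rightarrow> 'b \<Rightarrow> 'b \<Rightarrow> real) \<Rightarrow>
    ('a \<times> 'b set) measure \<Rightarrow> 'a set \<Rightarrow> ereal" where
  "variation A g V B = (INF U\<in>{U. open U \<and> B \<subseteq> U}. variation_open A g V U)"

definition locally_bounded_first_variation ::
  "('a::topological_space, 'b::euclidean_space) chart set \<Rightarrow> ('a \<Rightarrow> 'b \<Rightarrow> 'b \<Rightarrow> real) \<Rightarrow>
    ('a \<times> 'b set) measure \<Rightarrow> bool" where
  "locally_bounded_first_variation A g V \<longleftrightarrow>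
     (\<forall>U. open U \<and> compact (closure U) \<longrightarrow> variation_open A g V U < \<infinity>)"

definition no_generalized_boundary ::
  "('a::topological_space, 'b::euclidean_space) chart set \<Rightarrow> ('a \<Rightarrow> 'b \<Rightarrow> 'b \<Rightarrow> real) \<Rightarrow>
    ('a \<times> 'b set) measure \<Rightarrow> bool" where
  "no_generalized_boundary A g V \<longleftrightarrow>
     (\<forall>B\<in>sets borel. emeasure (weight V) B = 0 \<longrightarrow> variation A g V B = 0)"

text \<open>
  For a varifold without generalized boundary, \<open>H\<close> is (a representative of) the generalized mean
  curvature if it is a Borel vectorfield, locally integrable for the weight measure, that is the
  density of $-\delta V$ with respect to the weight measure.
\<close>

definition generalized_mean_curvature ::
  "('a::topological_space, 'b::euclidean_space) chart set \<Rightarrow> ('a \<Rightarrow> 'b \<Rightarrow> 'b \<Rightarrow> real) \<Rightarrow>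
    ('a \<times> 'b set) measure \<Rightarrow> ('a \<Rightarrow> 'b) \<Rightarrow> bool" where
  "generalized_mean_curvature A g V H \<longleftrightarrow>
     (\<forall>c\<in>A. (\<lambda>p. indicator (fst c) p *\<^sub>R to_chart A c p (H p)) \<in> borel_measurable borel) \<and>
     (\<forall>K. compact K \<longrightarrow> set_integrable (weight V) K (\<lambda>p. gnorm g p (H p))) \<and>
     (\<forall>X\<in>test_fields A UNIV. first_variation A g V X = - (\<integral>p. g p (H p) (X p) \<partial>weight V))"

end

theory Submission
  imports Defs
begin

text \<open>
  Suppose that \<open>f\<close> restricted to the set has a local maximum at \<open>p\<close>.

  On a submanifold \<open>M\<close>, a tangent field \<open>Y\<close> satisfies \<open>Y(Yf) = D\<^sup>2f(Y,Y) + Df(\<nabla>\<^sub>Y Y) \<le> 0\<close> at \<open>p\<close>,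
  where \<open>Df\<close> vanishes on tangent vectors. Summing over an orthonormal basis of the tangent space, the
  trace of the Hessian on that space is at most \<open>-Df(H) \<le> h |Df|\<close>, and by Ky Fan's principle it is at
  least the sum of the \<open>m\<close> lowest eigenvalues.

  For a varifold, subtract \<open>|x - p|\<^sup>4\<close> in a chart to obtain a function \<open>F\<close> with a strict maximum. If the
  inequality fails at \<open>p\<close>, then near \<open>p\<close> the trace of the Hessian of \<open>F\<close> on every \<open>m\<close>-plane exceeds
  \<open>h |DF|\<close>. Testing the first variation with \<open>X = \<psi> \<nabla>F\<close>, where \<open>\<psi>\<close> is an increasing function of
  \<open>F\<close> cut off near \<open>p\<close>, gives \<open>\<integral> div\<^sub>S X > \<integral> h |X|\<close>, which contradicts \<open>|H| \<le> h\<close>.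
\<close>

section \<open>Inner products and Ky Fan's principle\<close>

text \<open>The metric is only of class C^1, so the Christoffel symbols are merely continuous and
  are never differentiated. The gradient of a C^2 function solves a linear system with C^1
  coefficients, hence is C^1, which is exactly the regularity of a test field; C^1 cutoffs then
  suffice as well. The planes carried by a varifold are unrelated to any tangent plane, so a bound
  is needed for every m-plane at once. This is what the m lowest eigenvalues provide, and because
  orthonormal frames form a compact set the strict inequality at \<open>p\<close> persists nearby
  with a uniform margin. The quartic does not change gradient and Hessian at \<open>p\<close>, yet
  on the support it pushes \<open>F\<close> down to at most \<open>F(p) - r^4\<close> at distance at
  least \<open>r\<close>. The function of \<open>F\<close> is chosen to vanish there, so the
  derivative of the localizing bump never enters the divergence on the support. Tangent vectors at
  \<open>p\<close> are components in a chart that depends on \<open>p\<close>. Global quantities are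
  therefore first transported to one fixed chart, where they become functions of the
  coordinates.\<close>

locale inner_form =
  fixes G :: "'b::euclidean_space \<Rightarrow> 'b \<Rightarrow> real"
  assumes bilin: "bilinear G" and sym: "G u v = G v u" and pos: "u \<noteq> 0 \<Longrightarrow> G u u > 0"
begin

lemmas G_simps = bilinear_ladd[OF bilin] bilinear_radd[OF bilin] bilinear_lmul[OF bilin]
  bilinear_rmul[OF bilin] bilinear_lzero[OF bilin] bilinear_rzero[OF bilin]
  bilinear_lsub[OF bilin] bilinear_rsub[OF bilin] bilinear_lneg[OF bilin] bilinear_rneg[OF bilin]

lemma G_sum_left: "G (\<Sum>i\<in>I. f i) w = (\<Sum>i\<in>I. G (f i) w)"
  using linear_sum[of "\<lambda>x. G x w"] bilin unfolding bilinear_def by blast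

lemma G_sum_right: "G w (\<Sum>i\<in>I. f i) = (\<Sum>i\<in>I. G w (f i))"
  using linear_sum[of "\<lambda>x. G w x"] bilin unfolding bilinear_def by blast

lemma G_nonneg: "G u u \<ge> 0"
  by (cases "u = 0") (use pos[of u] in \<open>auto simp: G_simps\<close>)

lemma G_eq_0_iff [simp]: "G u u = 0 \<longleftrightarrow> u = 0"
  using pos[of u] by (cases "u = 0") (auto simp: G_simps)

lemma G_right_eqI: "(\<And>w. G u w = G v w) \<Longrightarrow> u = v"
  using G_eq_0_iff[of "u - v"] by (simp add: G_simps)

lemma bounded_bilinear_G: "bounded_bilinear G"
  using bilin bilinear_conv_bounded_bilinear by blast

lemma cauchy_schwarz: "\<bar>G u v\<bar> \<le> sqrt (G u u) * sqrt (G v v)"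
proof (cases "v = 0")
  case False
  then have v: "G v v > 0" by (rule pos)
  have "0 \<le> G (G v v *\<^sub>R u - G u v *\<^sub>R v) (G v v *\<^sub>R u - G u v *\<^sub>R v)"
    by (rule G_nonneg)
  also have "\<dots> = G v v * (G u u * G v v - G u v * G u v)"
    by (simp add: G_simps sym[of v u] algebra_simps)
  finally have "G u v * G u v \<le> G u u * G v v"
    using v by (simp add: zero_le_mult_iff)
  then have "sqrt ((G u v)\<^sup>2) \<le> sqrt (G u u * G v v)"
    by (intro real_sqrt_le_mono) (simp add: power2_eq_square)
  then show ?thesis by (simp add: real_sqrt_mult)
qed (simp add: G_simps)

text \<open>The minimum of \<open>G u u\<close> over the compact Euclidean unit sphere is positive,
  and homogeneity does the rest. This coercivity is what turns bounds in \<open>G\<close> into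
  Euclidean bounds.\<close>

lemma lower_bound: "\<exists>c>0. \<forall>u. c * norm u ^ 2 \<le> G u u"
proof -
  have "continuous_on (sphere 0 1) (\<lambda>u. G u u)"
    by (intro bounded_bilinear.continuous_on[OF bounded_bilinear_G] continuous_intros)
  moreover have "sphere (0::'b) 1 \<noteq> {}" by simp
  ultimately obtain v where v: "v \<in> sphere 0 1" "\<And>u. u \<in> sphere 0 1 \<Longrightarrow> G v v \<le> G u u"
    using continuous_attains_inf[of "sphere 0 1" "\<lambda>u. G u u"] by auto
  have "G v v * norm u ^ 2 \<le> G u u" for u
  proof (cases "u = 0")
    case False
    have "G v v \<le> G (u /\<^sub>R norm u) (u /\<^sub>R norm u)"
      using v(2)[of "u /\<^sub>R norm u"] False by simp
    also have "\<dots> = G u u / norm u ^ 2"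
      by (simp add: G_simps power2_eq_square field_simps)
    finally show ?thesis using False by (simp add: field_simps)
  qed (simp add: G_simps)
  moreover have "G v v > 0" using v(1) by (intro pos) auto
  ultimately show ?thesis by blast
qed

text \<open>Frames are indexed families rather than sets, so that a sequence of frames can converge
  entry by entry. The set-valued \<open>orthonormal_basis_of\<close> is converted by
  \<open>orthonormal_basis_of_family\<close>.\<close>

definition orthonormal :: "nat \<Rightarrow> (nat \<Rightarrow> 'b) \<Rightarrow> bool" where
  "orthonormal n e \<longleftrightarrow> (\<forall>i<n. \<forall>j<n. G (e i) (e j) = (if i = j then 1 else 0))"

lemma orthonormal_coeff:
  assumes "orthonormal n e" "j < n"
  shows "G (\<Sum>i<n. c i *\<^sub>R e i) (e j) = c j"
proof -
  have "G (\<Sum>i<n. c i *\<^sub>R e i) (e j) = (\<Sum>i<n. c i * G (e i) (e j))"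
    by (simp add: G_sum_left G_simps)
  also have "\<dots> = (\<Sum>i<n. if i = j then c i else 0)"
    using assms by (intro sum.cong) (auto simp: orthonormal_def)
  finally show ?thesis using assms(2) by simp
qed

lemma orthonormal_inj_on: "orthonormal n e \<Longrightarrow> inj_on e {..<n}"
  unfolding inj_on_def orthonormal_def by (metis lessThan_iff zero_neq_one)

lemma orthonormal_nonzero: "orthonormal n e \<Longrightarrow> i < n \<Longrightarrow> e i \<noteq> 0"
  by (metis G_eq_0_iff orthonormal_def zero_neq_one)

lemma orthonormal_independent:
  assumes "orthonormal n e" shows "independent (e ` {..<n})"
proof -
  have inj: "inj_on e {..<n}" using assms by (rule orthonormal_inj_on)
  have "\<forall>v\<in>e ` {..<n}. u v = 0" if u: "(\<Sum>v\<in>e ` {..<n}. u v *\<^sub>R v) = 0" for u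
  proof
    fix v assume "v \<in> e ` {..<n}"
    then obtain j where j: "j < n" "v = e j" by auto
    have "(\<Sum>i<n. u (e i) *\<^sub>R e i) = 0"
      using u by (simp add: sum.reindex[OF inj])
    then show "u v = 0"
      using orthonormal_coeff[OF assms j(1), of "\<lambda>i. u (e i)"] j by (simp add: G_simps)
  qed
  then show ?thesis unfolding independent_explicit by blast
qed

lemma orthonormal_span:
  assumes "orthonormal n e" "\<And>i. i < n \<Longrightarrow> e i \<in> S" "subspace S" "dim S = n"
  shows "span (e ` {..<n}) = S"
proof -
  have "card (e ` {..<n}) = n" using orthonormal_inj_on[OF assms(1)] by (simp add: card_image)
  then have "S \<subseteq> span (e ` {..<n})"
    using assms by (intro card_ge_dim_independent orthonormal_independent) auto
  moreover have "span (e ` {..<n}) \<subseteq> S"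
    using assms by (intro span_minimal) auto
  ultimately show ?thesis by blast
qed

lemma orthonormal_expand:
  assumes "orthonormal n e" "v \<in> span (e ` {..<n})"
  shows "v = (\<Sum>i<n. G v (e i) *\<^sub>R e i)"
proof -
  have inj: "inj_on e {..<n}" using assms by (simp add: orthonormal_inj_on)
  obtain u where "v = (\<Sum>w\<in>e ` {..<n}. u w *\<^sub>R w)"
    using assms(2) by (auto simp: span_finite)
  then have v: "v = (\<Sum>i<n. u (e i) *\<^sub>R e i)" by (simp add: sum.reindex[OF inj])
  have "G v (e i) = u (e i)" if "i < n" for i
    unfolding v using orthonormal_coeff[OF assms(1) that, of "\<lambda>i. u (e i)"] by simp
  then show ?thesis using v by simp
qed

lemma parseval:
  assumes "orthonormal n e" "v \<in> span (e ` {..<n})"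
  shows "G v w = (\<Sum>i<n. G v (e i) * G w (e i))"
proof -
  have "G v w = G (\<Sum>i<n. G v (e i) *\<^sub>R e i) w"
    using orthonormal_expand[OF assms] by simp
  also have "\<dots> = (\<Sum>i<n. G v (e i) * G (e i) w)" by (simp add: G_sum_left G_simps)
  also have "\<dots> = (\<Sum>i<n. G v (e i) * G w (e i))" by (simp only: sym[of "e _" w])
  finally show ?thesis .
qed

text \<open>The residual of \<open>v\<close> after subtracting its projection \<open>p\<close> has
  nonnegative square. In Ky Fan's principle this bounds the weights by 1.\<close>

lemma bessel:
  assumes "orthonormal n e"
  shows "(\<Sum>i<n. (G v (e i))\<^sup>2) \<le> G v v"
proof -
  define p where "p = (\<Sum>i<n. G v (e i) *\<^sub>R e i)"
  have pe: "G p (e i) = G v (e i)" if "i < n" for i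
    unfolding p_def by (rule orthonormal_coeff[OF assms that])
  have "G w p = (\<Sum>i<n. G v (e i) * G w (e i))" for w
    by (simp add: p_def G_sum_right G_simps)
  then have "G v p = (\<Sum>i<n. (G v (e i))\<^sup>2)" "G p p = (\<Sum>i<n. (G v (e i))\<^sup>2)"
    using pe by (simp_all add: power2_eq_square)
  moreover have "0 \<le> G (v - p) (v - p)" by (rule G_nonneg)
  ultimately show ?thesis by (simp add: G_simps sym[of p v])
qed

text \<open>The minimum of the Rayleigh quotient on \<open>S\<close> is an eigenvector; the remaining ones are found
  in its orthogonal complement.\<close>

lemma spectral_subspace:
  assumes "bilinear Q" "\<And>u v. Q u v = Q v u"
  shows "subspace S \<Longrightarrow> dim S = n \<Longrightarrow> \<exists>e l. orthonormal n e \<and>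
    (\<forall>i<n. e i \<in> S \<and> (\<forall>w\<in>S. Q (e i) w = l i * G (e i) w)) \<and>
    (\<forall>i<n. \<forall>j<n. i \<le> j \<longrightarrow> l i \<le> (l j :: real))"
proof (induction n arbitrary: S)
  case 0
  then show ?case by (auto simp: orthonormal_def)
next
  case (Suc n)
  note Q_simps = bilinear_ladd[OF assms(1)] bilinear_radd[OF assms(1)] bilinear_lmul[OF assms(1)]
    bilinear_rmul[OF assms(1)] bilinear_lsub[OF assms(1)] bilinear_rsub[OF assms(1)]
    bilinear_lzero[OF assms(1)] bilinear_rzero[OF assms(1)]
  note subS = \<open>subspace S\<close>
  obtain c where c: "c > 0" "\<And>u. c * norm u ^ 2 \<le> G u u" using lower_bound by blast
  define K where "K = {v\<in>S. G v v = 1}"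
  have "bounded K"
  proof (rule boundedI[of _ "sqrt (1 / c)"])
    fix v assume "v \<in> K"
    then have "c * norm v ^ 2 \<le> 1" using c(2)[of v] by (auto simp: K_def)
    then show "norm v \<le> sqrt (1 / c)"
      using c(1) by (intro real_le_rsqrt) (simp add: field_simps)
  qed
  moreover have "closed K"
  proof -
    have "continuous_on UNIV (\<lambda>v. G v v)"
      by (intro bounded_bilinear.continuous_on[OF bounded_bilinear_G] continuous_intros)
    then have "closed {v. G v v = 1}"
      by (intro closed_Collect_eq continuous_intros)
    moreover have "K = S \<inter> {v. G v v = 1}" by (auto simp: K_def)
    ultimately show ?thesis using closed_subspace[OF subS] by auto
  qed
  ultimately have "compact K" by (simp add: compact_eq_bounded_closed)
  have normalize: "u /\<^sub>R sqrt (G u u) \<in> K" if "u \<in> S" "u \<noteq> 0" for u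
  proof -
    have "sqrt (G u u) * sqrt (G u u) = G u u" using G_nonneg by simp
    then show ?thesis using that subS pos[of u]
      by (auto simp: K_def subspace_scale G_simps field_simps)
  qed
  have "\<not> S \<subseteq> {0}" using Suc.prems(2) dim_eq_0[of S] by linarith
  then have "K \<noteq> {}" using normalize by blast
  have "continuous_on K (\<lambda>v. Q v v)"
    using assms(1) unfolding bilinear_conv_bounded_bilinear
    by (intro bounded_bilinear.continuous_on[of Q] continuous_intros) auto
  from continuous_attains_inf[OF \<open>compact K\<close> \<open>K \<noteq> {}\<close> this] obtain v where
    v: "v \<in> K" "\<And>u. u \<in> K \<Longrightarrow> Q v v \<le> Q u u" by blast
  define l0 where "l0 = Q v v"
  have vS: "v \<in> S" and Gv: "G v v = 1" using v(1) by (auto simp: K_def)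
  have min: "l0 * G u u \<le> Q u u" if "u \<in> S" for u
  proof (cases "u = 0")
    case False
    have sq: "sqrt (G u u) * sqrt (G u u) = G u u" using G_nonneg by simp
    have "l0 \<le> Q (u /\<^sub>R sqrt (G u u)) (u /\<^sub>R sqrt (G u u))"
      unfolding l0_def by (intro v normalize that False)
    also have "\<dots> = Q u u / (sqrt (G u u) * sqrt (G u u))" by (simp add: Q_simps field_simps)
    finally show ?thesis using pos[OF False] sq by (simp add: field_simps)
  qed (simp add: G_simps Q_simps)
  have orth: "Q v w = 0" if "w \<in> S" "G v w = 0" for w
  proof (rule ccontr)
    assume q: "Q v w \<noteq> 0"
    \<comment> \<open>Minimality of \<open>v\<close> makes the quadratic
      \<open>2 * t * Q v w + t\<^sup>2 * K\<close> nonnegative for all \<open>t\<close>. Replacing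
      the number \<open>K\<close> (which shadows the unit sphere above) by the larger, positive
      \<open>D\<close> allows a division, and the \<open>t\<close> below minimizes that
      majorant.\<close>
    define K where "K = Q w w - l0 * G w w"
    define D where "D = 1 + \<bar>K\<bar>"
    have D: "D > 0" "K \<le> D" by (auto simp: D_def)
    define t where "t = - Q v w / D"
    have "0 \<le> Q (v + t *\<^sub>R w) (v + t *\<^sub>R w) - l0 * G (v + t *\<^sub>R w) (v + t *\<^sub>R w)"
      using min[of "v + t *\<^sub>R w"] subS vS that by (simp add: subspace_add subspace_scale)
    also have "\<dots> = 2 * t * Q v w + t\<^sup>2 * K"
      by (simp add: K_def Q_simps G_simps sym[of w v] that(2) assms(2)[of w v] Gv power2_eq_square
        algebra_simps l0_def[symmetric])
    also have "\<dots> \<le> 2 * t * Q v w + t\<^sup>2 * D"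
      using D by (intro add_left_mono mult_left_mono) auto
    also have "\<dots> = - (Q v w)\<^sup>2 / D"
      using D by (simp add: t_def power2_eq_square field_simps)
    also have "\<dots> < 0" using q D by simp
    finally show False by simp
  qed
  define S' where "S' = {w\<in>S. G v w = 0}"
  have subS': "subspace S'"
    using subS by (auto simp: S'_def subspace_def G_simps)
  have "v \<notin> S'" using Gv by (auto simp: S'_def)
  have "S = span (insert v S')"
  proof (intro subset_antisym subsetI)
    fix u assume "u \<in> S"
    then have "u - G v u *\<^sub>R v \<in> S'"
      using subS vS Gv by (auto simp: S'_def subspace_diff subspace_scale G_simps)
    then have "(u - G v u *\<^sub>R v) + G v u *\<^sub>R v \<in> span (insert v S')"
      by (intro span_add span_scale span_base) auto
    then show "u \<in> span (insert v S')" by simp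
  next
    fix u assume "u \<in> span (insert v S')"
    moreover have "span (insert v S') \<subseteq> S"
      using subS vS by (intro span_minimal) (auto simp: S'_def)
    ultimately show "u \<in> S" by blast
  qed
  then have "dim S = Suc (dim S')"
    using dim_insert[of v S'] \<open>v \<notin> S'\<close> subS' by (metis dim_span span_eq_iff add.commute plus_1_eq_Suc)
  then have "dim S' = n" using Suc.prems(2) by simp
  from Suc.IH[OF subS' this] obtain e l where e: "orthonormal n e"
    "\<And>i. i < n \<Longrightarrow> e i \<in> S'" "\<And>i w. i < n \<Longrightarrow> w \<in> S' \<Longrightarrow> Q (e i) w = l i * G (e i) w"
    and l: "\<And>i j. i < n \<Longrightarrow> j < n \<Longrightarrow> i \<le> j \<Longrightarrow> l i \<le> l j" by blast
  define e' where "e' = (\<lambda>i. case i of 0 \<Rightarrow> v | Suc k \<Rightarrow> e k)"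
  define l' where "l' = (\<lambda>i. case i of 0 \<Rightarrow> l0 | Suc k \<Rightarrow> l k)"
  have ev: "G v (e i) = 0" "e i \<in> S" "Q v (e i) = 0" if "i < n" for i
    using e(2)[OF that] orth by (auto simp: S'_def)
  have "orthonormal (Suc n) e'"
    using e(1) ev Gv sym by (auto simp: orthonormal_def e'_def split: nat.splits)
  moreover have "e' i \<in> S \<and> (\<forall>w\<in>S. Q (e' i) w = l' i * G (e' i) w)" if "i < Suc n" for i
  proof (intro conjI ballI)
    show "e' i \<in> S" using vS ev that by (auto simp: e'_def split: nat.splits)
    fix w assume w: "w \<in> S"
    \<comment> \<open>The induction hypothesis gives the eigenvalue equation only against vectors of
      \<open>S'\<close>, so the test vector is split into its part in \<open>S'\<close> and a
      multiple of \<open>v\<close>.\<close>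
    define w' where "w' = w - G v w *\<^sub>R v"
    have w': "w' \<in> S'"
      using subS vS Gv w by (auto simp: S'_def w'_def subspace_diff subspace_scale G_simps)
    have ww: "w = w' + G v w *\<^sub>R v" by (simp add: w'_def)
    have w'0: "w' \<in> S" "G v w' = 0" using w' by (auto simp: S'_def)
    show "Q (e' i) w = l' i * G (e' i) w"
    proof (cases i)
      case 0
      have "Q v w = G v w * l0"
        using orth[OF w'0] by (subst ww) (simp add: Q_simps l0_def)
      then show ?thesis using 0 by (simp add: e'_def l'_def)
    next
      case (Suc k)
      then have k: "k < n" using that by simp
      have "Q (e k) w = Q (e k) w' + G v w * Q (e k) v" by (subst ww) (simp add: Q_simps)
      moreover have "G (e k) w = G (e k) w' + G v w * G (e k) v" by (subst ww) (simp add: G_simps)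
      ultimately show ?thesis using e(3)[OF k w'] ev[OF k] assms(2)[of v] sym[of v] Suc
        by (simp add: e'_def l'_def)
    qed
  qed
  moreover have "l' i \<le> l' j" if "i < Suc n" "j < Suc n" "i \<le> j" for i j
  proof (cases i)
    case 0
    show ?thesis
    proof (cases j)
      case (Suc k)
      then have k: "k < n" using that by simp
      have "l0 * G (e k) (e k) \<le> Q (e k) (e k)" by (rule min) (rule ev(2)[OF k])
      also have "\<dots> = l k * G (e k) (e k)" using e(2,3) k by blast
      finally show ?thesis using 0 Suc k e(1) by (simp add: l'_def orthonormal_def)
    qed (simp add: 0)
  next
    case (Suc k)
    then show ?thesis using that l by (auto simp: l'_def split: nat.splits)
  qed
  ultimately show ?case by blast
qed

text \<open>Gram-Schmidt comes for free: for the zero form the spectral statement has nothing to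
  diagonalize and still returns an orthonormal frame.\<close>

lemma ex_orthonormal:
  assumes "subspace S" "dim S = n"
  obtains e where "orthonormal n e" "\<And>i. i < n \<Longrightarrow> e i \<in> S"
proof -
  have "bilinear (\<lambda>u v :: 'b. 0 :: real)" by (simp add: bilinear_def linear_iff)
  from spectral_subspace[OF this _ assms] show ?thesis using that by blast
qed

lemma orthonormal_basis_of_props:
  assumes "subspace S"
  defines "E \<equiv> orthonormal_basis_of G S"
  shows "finite E" "E \<subseteq> S" "span E = S" "\<And>e e'. e \<in> E \<Longrightarrow> e' \<in> E \<Longrightarrow> G e e' = (if e = e' then 1 else 0)"
proof -
  obtain f where f: "orthonormal (dim S) f" "\<And>i. i < dim S \<Longrightarrow> f i \<in> S"
    using ex_orthonormal[OF assms(1) refl] by blast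
  have "finite (f ` {..<dim S}) \<and> f ` {..<dim S} \<subseteq> S \<and> span (f ` {..<dim S}) = S \<and>
    (\<forall>e\<in>f ` {..<dim S}. \<forall>e'\<in>f ` {..<dim S}. G e e' = (if e = e' then 1 else 0))"
    using f orthonormal_span[OF f assms(1) refl] orthonormal_inj_on[OF f(1)]
    by (auto simp: orthonormal_def inj_on_def)
  from someI[where P = "\<lambda>E. finite E \<and> E \<subseteq> S \<and> span E = S \<and>
     (\<forall>e\<in>E. \<forall>e'\<in>E. G e e' = (if e = e' then 1 else 0))", OF this]
  show "finite E" "E \<subseteq> S" "span E = S" "\<And>e e'. e \<in> E \<Longrightarrow> e' \<in> E \<Longrightarrow> G e e' = (if e = e' then 1 else 0)"
    unfolding E_def orthonormal_basis_of_def by blast+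
qed

lemma orthonormal_basis_of_family:
  assumes "subspace S"
  obtains e where "orthonormal (dim S) e" "\<And>i. i < dim S \<Longrightarrow> e i \<in> S"
    "inj_on e {..<dim S}" "orthonormal_basis_of G S = e ` {..<dim S}"
proof -
  let ?E = "orthonormal_basis_of G S"
  note E = orthonormal_basis_of_props[OF assms]
  obtain e where e: "bij_betw e {..<card ?E} ?E"
    using ex_bij_betw_nat_finite[OF E(1)] by (auto simp: atLeast0LessThan)
  have on: "orthonormal (card ?E) e"
    unfolding orthonormal_def
  proof (intro allI impI)
    fix i j assume ij: "i < card ?E" "j < card ?E"
    then have "e i \<in> ?E" "e j \<in> ?E" using e by (auto simp: bij_betw_def)
    moreover have "e i = e j \<longleftrightarrow> i = j" using e ij by (auto simp: bij_betw_def inj_on_def)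
    ultimately show "G (e i) (e j) = (if i = j then 1 else 0)" using E(4) by simp
  qed
  have im: "e ` {..<card ?E} = ?E" using e by (auto simp: bij_betw_def)
  have "dim S = card ?E"
    using dim_span_eq_card_independent[OF orthonormal_independent[OF on]] E(3) im by simp
  moreover have "e i \<in> S" if "i < card ?E" for i
    using e that E(2) by (auto simp: bij_betw_def)
  ultimately show thesis using that[of e] on im orthonormal_inj_on[OF on] by metis
qed

section \<open>Traces over subspaces and lists of eigenvalues\<close>

definition trace_on :: "'b set \<Rightarrow> ('b \<Rightarrow> 'b \<Rightarrow> real) \<Rightarrow> real" where
  "trace_on S B = (\<Sum>e\<in>orthonormal_basis_of G S. B e e)"

text \<open>Basis independence of the trace. Expanding the chosen basis \<open>f\<close> in
  \<open>e\<close> produces products of coefficients, and Parseval in the basis \<open>f\<close>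
  collapses their sum over \<open>i\<close> to \<open>G (e j) (e k)\<close>.\<close>

lemma trace_on_eq:
  assumes "subspace S" "dim S = n" "orthonormal n e" "\<And>i. i < n \<Longrightarrow> e i \<in> S" "bilinear B"
  shows "trace_on S B = (\<Sum>i<n. B (e i) (e i))"
proof -
  obtain f where f: "orthonormal n f" "\<And>i. i < n \<Longrightarrow> f i \<in> S"
    "inj_on f {..<n}" "orthonormal_basis_of G S = f ` {..<n}"
    using orthonormal_basis_of_family[OF assms(1)] assms(2) by auto
  note sp = orthonormal_span[OF assms(3,4,1,2), simplified] orthonormal_span[OF f(1,2) assms(1,2), simplified]
  interpret B: bounded_bilinear B using assms(5) by (simp add: bilinear_conv_bounded_bilinear)
  have "trace_on S B = (\<Sum>i<n. B (f i) (f i))"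
    unfolding trace_on_def f(4) by (simp add: sum.reindex[OF f(3)])
  also have "\<dots> = (\<Sum>i<n. \<Sum>j<n. \<Sum>k<n. G (f i) (e j) * G (f i) (e k) * B (e j) (e k))"
  proof (intro sum.cong refl)
    fix i assume i: "i \<in> {..<n}"
    have fi: "f i = (\<Sum>j<n. G (f i) (e j) *\<^sub>R e j)"
      using orthonormal_expand[OF assms(3)] sp f(2) i by auto
    from fi fi have "B (f i) (f i) = B (\<Sum>j<n. G (f i) (e j) *\<^sub>R e j) (\<Sum>j<n. G (f i) (e j) *\<^sub>R e j)"
      by (rule arg_cong2)
    also have "\<dots> = (\<Sum>j<n. \<Sum>k<n. G (f i) (e j) * G (f i) (e k) * B (e j) (e k))"
      by (simp only: B.sum_left B.sum_right B.scaleR_left B.scaleR_right sum_distrib_left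
          real_scaleR_def mult.assoc)
       (rule sum.swap[THEN trans], simp only: mult.left_commute)
    finally show "B (f i) (f i) = \<dots>" .
  qed
  also have "\<dots> = (\<Sum>j<n. \<Sum>k<n. (\<Sum>i<n. G (f i) (e j) * G (f i) (e k)) * B (e j) (e k))"
    (is "_ = ?R")
  proof -
    have "?R = (\<Sum>j<n. \<Sum>i<n. \<Sum>k<n. G (f i) (e j) * G (f i) (e k) * B (e j) (e k))"
      unfolding sum_distrib_right by (intro sum.cong refl sum.swap)
    also have "\<dots> = (\<Sum>i<n. \<Sum>j<n. \<Sum>k<n. G (f i) (e j) * G (f i) (e k) * B (e j) (e k))"
      by (rule sum.swap)
    finally show ?thesis by simp
  qed
  also have "\<dots> = (\<Sum>j<n. \<Sum>k<n. (if j = k then B (e j) (e k) else 0))"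
  proof (intro sum.cong refl)
    fix j k assume jk: "j \<in> {..<n}" "k \<in> {..<n}"
    have "(\<Sum>i<n. G (f i) (e j) * G (f i) (e k)) = G (e j) (e k)"
      using parseval[OF f(1), of "e j" "e k"] sp assms(4) jk by (simp add: sym)
    then show "(\<Sum>i<n. G (f i) (e j) * G (f i) (e k)) * B (e j) (e k) = (if j = k then B (e j) (e k) else 0)"
      using assms(3) jk by (simp add: orthonormal_def)
  qed
  also have "\<dots> = (\<Sum>i<n. B (e i) (e i))" by simp
  finally show ?thesis .
qed

text \<open>Sorted lists with equal multiplicities coincide. The multiplicity of \<open>a\<close> in
  \<open>eigenvalue_list\<close> is the dimension of its eigenspace; that space is spanned by the
  \<open>e i\<close> with \<open>l i = a\<close>, because a coefficient of an eigenvector can be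
  nonzero only at such an index.\<close>

lemma eigenvalue_list_eq:
  fixes l :: "nat \<Rightarrow> real"
  assumes "bilinear Q" and e: "orthonormal n e" "n = DIM('b)"
    "\<And>i w. i < n \<Longrightarrow> Q (e i) w = l i * G (e i) w"
    and l: "\<And>i j. i < n \<Longrightarrow> j < n \<Longrightarrow> i \<le> j \<Longrightarrow> l i \<le> l j"
  shows "eigenvalue_list G Q = map l [0..<n]"
proof -
  have span: "span (e ` {..<n}) = UNIV"
    using orthonormal_span[OF e(1), of UNIV] e(2) by simp
  interpret B: bounded_bilinear Q using assms(1) by (simp add: bilinear_conv_bounded_bilinear)
  have Qv: "Q v (e i) = l i * G v (e i)" if "i < n" for v i
  proof -
    have "v = (\<Sum>j<n. G v (e j) *\<^sub>R e j)" using orthonormal_expand[OF e(1)] span by auto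
    then have "Q v (e i) = Q (\<Sum>j<n. G v (e j) *\<^sub>R e j) (e i)" by (rule arg_cong)
    also have "\<dots> = (\<Sum>j<n. G v (e j) * Q (e j) (e i))"
      by (simp add: B.sum_left B.scaleR_left)
    also have "\<dots> = (\<Sum>j<n. if j = i then l i * G v (e i) else 0)"
      using e(1,3) that by (intro sum.cong) (auto simp: orthonormal_def)
    finally show ?thesis using that by simp
  qed
  have mem: "u \<in> form_eigenspace G Q a \<longleftrightarrow> (\<forall>i<n. l i \<noteq> a \<longrightarrow> G u (e i) = 0)" for u a
  proof
    assume "u \<in> form_eigenspace G Q a"
    then have "Q u (e i) = a * G u (e i)" for i by (auto simp: form_eigenspace_def)
    then have "i < n \<Longrightarrow> l i * G u (e i) = a * G u (e i)" for i using Qv by metis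
    then show "\<forall>i<n. l i \<noteq> a \<longrightarrow> G u (e i) = 0" by auto
  next
    assume *: "\<forall>i<n. l i \<noteq> a \<longrightarrow> G u (e i) = 0"
    have "Q u v = a * G u v" for v
    proof -
      have v: "v = (\<Sum>j<n. G v (e j) *\<^sub>R e j)" using orthonormal_expand[OF e(1)] span by auto
      then have "Q u v = Q u (\<Sum>j<n. G v (e j) *\<^sub>R e j)" by (rule arg_cong)
      also have "\<dots> = (\<Sum>j<n. G v (e j) * Q u (e j))" by (simp add: B.sum_right B.scaleR_right)
      also have "\<dots> = (\<Sum>j<n. G v (e j) * (a * G u (e j)))"
      proof (intro sum.cong refl)
        fix j assume "j \<in> {..<n}"
        then show "G v (e j) * Q u (e j) = G v (e j) * (a * G u (e j))"
          using * Qv[of j u] by (cases "l j = a") auto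
      qed
      also have "\<dots> = a * G u (\<Sum>j<n. G v (e j) *\<^sub>R e j)"
        by (simp add: G_sum_right G_simps sum_distrib_left mult_ac)
      finally show ?thesis using v by metis
    qed
    then show "u \<in> form_eigenspace G Q a" by (auto simp: form_eigenspace_def)
  qed
  have ei: "e i \<in> form_eigenspace G Q (l i)" if "i < n" for i
    using e(3)[OF that] by (auto simp: form_eigenspace_def)
  have dim: "dim (form_eigenspace G Q a) = card {i\<in>{..<n}. l i = a}" for a
  proof -
    let ?I = "{i\<in>{..<n}. l i = a}"
    have sub: "e ` ?I \<subseteq> e ` {..<n}" by auto
    have "form_eigenspace G Q a = span (e ` ?I)"
    proof (intro subset_antisym subsetI)
      fix u assume u: "u \<in> form_eigenspace G Q a"
      have "u = (\<Sum>j<n. G u (e j) *\<^sub>R e j)" using orthonormal_expand[OF e(1)] span by auto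
      also have "\<dots> \<in> span (e ` ?I)"
      proof (rule span_sum)
        fix j assume j: "j \<in> {..<n}"
        show "G u (e j) *\<^sub>R e j \<in> span (e ` ?I)"
        proof (cases "l j = a")
          case True
          then show ?thesis using j by (intro span_scale span_base) auto
        next
          case False
          then have "G u (e j) = 0" using u mem j by blast
          then show ?thesis by (simp add: span_zero)
        qed
      qed
      finally show "u \<in> span (e ` ?I)" .
    next
      fix u assume "u \<in> span (e ` ?I)"
      moreover have "subspace (form_eigenspace G Q a)"
        by (auto simp: subspace_def form_eigenspace_def B.add_left B.scaleR_left B.zero_left G_simps algebra_simps)
      then have "span (e ` ?I) \<subseteq> form_eigenspace G Q a"
        using ei by (intro span_minimal) auto
      ultimately show "u \<in> form_eigenspace G Q a" by blast
    qed
    moreover have "dim (span (e ` ?I)) = card (e ` ?I)"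
      using dim_span_eq_card_independent
        orthonormal_independent[OF e(1)] sub independent_mono by blast
    moreover have "card (e ` ?I) = card ?I"
      by (rule card_image, rule inj_on_subset[OF orthonormal_inj_on[OF e(1)]]) auto
    ultimately show ?thesis by simp
  qed
  let ?L = "{a. \<exists>u. u \<noteq> 0 \<and> u \<in> form_eigenspace G Q a}"
  have L: "?L = l ` {..<n}"
  proof (intro subset_antisym subsetI)
    fix a assume "a \<in> ?L"
    then obtain u where u: "u \<noteq> 0" "u \<in> form_eigenspace G Q a" by auto
    have "u = (\<Sum>j<n. G u (e j) *\<^sub>R e j)" using orthonormal_expand[OF e(1)] span by auto
    then obtain j where "j < n" "G u (e j) \<noteq> 0"
      using u(1) by (metis (no_types, lifting) lessThan_iff scaleR_eq_0_iff sum.neutral)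
    then show "a \<in> l ` {..<n}" using u mem by auto
  next
    fix a assume "a \<in> l ` {..<n}"
    then show "a \<in> ?L" using ei orthonormal_nonzero[OF e(1)] by fastforce
  qed
  let ?xs = "sorted_list_of_set ?L"
  have fin: "finite ?L" using L by simp
  have sorted_conc: "sorted (concat (map (\<lambda>a. replicate (k a) a) xs))" if "sorted xs" for k and xs :: "real list"
    using that by (induction xs) (auto simp: sorted_append)
  have count_conc: "count_list (concat (map (\<lambda>a. replicate (k a) a) xs)) x = (if x \<in> set xs then k x else 0)"
    if "distinct xs" for k x and xs :: "real list"
  proof -
    have *: "count_list (replicate c y) x = (if x = y then c else 0)" for c y
      by (induction c) auto
    show ?thesis using that by (induction xs) (auto simp: *)
  qed
  have cl: "count_list (map l [0..<n]) x = card {i\<in>{..<n}. l i = x}" for x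
  proof -
    have "count_list (map l [0..<n]) x = length (filter (\<lambda>i. x = l i) [0..<n])"
      by (simp add: count_list_eq_length_filter filter_map o_def)
    also have "\<dots> = card (set (filter (\<lambda>i. x = l i) [0..<n]))"
      by (rule distinct_card[symmetric]) simp
    also have "set (filter (\<lambda>i. x = l i) [0..<n]) = {i\<in>{..<n}. l i = x}" by auto
    finally show ?thesis .
  qed
  have mset: "mset (eigenvalue_list G Q) = mset (map l [0..<n])"
  proof (rule multiset_eqI)
    fix x
    have "count_list (eigenvalue_list G Q) x = count_list (map l [0..<n]) x"
      unfolding eigenvalue_list_def count_conc[OF distinct_sorted_list_of_set] cl
      using fin L dim by (auto simp: card_eq_0_iff)
    then show "count (mset (eigenvalue_list G Q)) x = count (mset (map l [0..<n])) x"
      by (simp only: count_mset)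
  qed
  have s: "sorted (map l [0..<n])" using l by (simp add: sorted_iff_nth_mono)
  have "sorted (eigenvalue_list G Q)"
    unfolding eigenvalue_list_def by (rule sorted_conc) simp
  with mset have "sort (map l [0..<n]) = eigenvalue_list G Q"
    by (rule properties_for_sort)
  with sorted_sort_id[OF s] show ?thesis by metis
qed

text \<open>Ky Fan's minimum principle. Weights \<open>w j \<in> [0,1]\<close> of total mass \<open>m\<close> against an increasing
  sequence are minimized by putting all mass on the first \<open>m\<close> entries.\<close>

lemma lowest_trace_le:
  assumes Q: "bilinear Q" "\<And>u v. Q u v = Q v u" and f: "orthonormal m f"
  shows "lowest_trace m G Q \<le> (\<Sum>i<m. Q (f i) (f i))"
proof -
  define n where "n = DIM('b)"
  obtain e l where e: "orthonormal n e" "\<And>i w. i < n \<Longrightarrow> Q (e i) w = l i * G (e i) w"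
    and l: "\<And>i j. i < n \<Longrightarrow> j < n \<Longrightarrow> i \<le> j \<Longrightarrow> l i \<le> (l j :: real)"
  proof -
    have "subspace (UNIV :: 'b set)" "dim (UNIV :: 'b set) = n" by (simp_all add: n_def)
    from spectral_subspace[OF Q this] show ?thesis using that by blast
  qed
  have span: "span (e ` {..<n}) = UNIV"
    using orthonormal_span[OF e(1), of UNIV] n_def by simp
  have "m = card (f ` {..<m})" using orthonormal_inj_on[OF f] by (simp add: card_image)
  also have "\<dots> \<le> n"
    unfolding n_def using independent_bound[OF orthonormal_independent[OF f]] by simp
  finally have mn: "m \<le> n" .
  interpret B: bounded_bilinear Q using Q(1) by (simp add: bilinear_conv_bounded_bilinear)
  have Qf: "Q u u = (\<Sum>j<n. l j * (G u (e j))\<^sup>2)" for u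
  proof -
    have u: "u = (\<Sum>j<n. G u (e j) *\<^sub>R e j)" using orthonormal_expand[OF e(1)] span by auto
    then have "Q u u = Q (\<Sum>j<n. G u (e j) *\<^sub>R e j) u" by (rule arg_cong)
    also have "\<dots> = (\<Sum>j<n. G u (e j) * (l j * G (e j) u))"
      by (simp add: B.sum_left B.scaleR_left e(2))
    finally show ?thesis by (simp add: power2_eq_square sym[of _ u] mult_ac)
  qed
  \<comment> \<open>The squared length of the projection of \<open>e j\<close> to the span of
    \<open>f\<close>. Bessel for \<open>f\<close> bounds it by 1, and Parseval for \<open>e\<close>
    gives the total mass \<open>m\<close>.\<close>
  define w where "w j = (\<Sum>i<m. (G (f i) (e j))\<^sup>2)" for j
  have w01: "0 \<le> w j" "w j \<le> 1" if "j < n" for j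
  proof -
    show "0 \<le> w j" unfolding w_def by (intro sum_nonneg) auto
    have "w j \<le> G (e j) (e j)" unfolding w_def using bessel[OF f, of "e j"] by (simp add: sym)
    then show "w j \<le> 1" using e(1) that by (simp add: orthonormal_def)
  qed
  have sw: "(\<Sum>j<n. w j) = m"
  proof -
    have "(\<Sum>j<n. w j) = (\<Sum>i<m. \<Sum>j<n. (G (f i) (e j))\<^sup>2)"
      unfolding w_def by (rule sum.swap)
    also have "\<dots> = (\<Sum>i<m. G (f i) (f i))"
    proof (intro sum.cong refl)
      fix i show "(\<Sum>j<n. (G (f i) (e j))\<^sup>2) = G (f i) (f i)"
        using parseval[OF e(1), of "f i" "f i"] span by (simp only: power2_eq_square UNIV_I)
    qed
    also have "\<dots> = m" using f by (simp add: orthonormal_def)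
    finally show ?thesis .
  qed
  have total: "(\<Sum>i<m. Q (f i) (f i)) = (\<Sum>j<n. l j * w j)"
    unfolding Qf w_def sum_distrib_left by (rule sum.swap)
  have "lowest_trace m G Q = sum_list (map l [0..<m])"
    unfolding lowest_trace_def using eigenvalue_list_eq[OF Q(1) e(1) n_def e(2) l] mn
    by (simp add: take_map)
  also have "\<dots> = (\<Sum>j<m. l j)" by (simp add: interv_sum_list_conv_sum_set_nat atLeast0LessThan)
  also have "\<dots> \<le> (\<Sum>j<n. l j * w j)"
  proof (cases m)
    case 0
    then have "(\<Sum>j<n. w j) = 0" using sw by simp
    then have "\<forall>j<n. w j = 0" using w01 by (subst (asm) sum_nonneg_eq_0_iff) auto
    then show ?thesis using 0 by simp
  next
    case (Suc k)
    \<comment> \<open>The threshold is the last eigenvalue counted, with index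
      \<open>k = m - 1\<close> since indices start at 0. Relative to it the entries below index
      \<open>m\<close> are nonpositive, where weight 1 is the worst case, and the others
      nonnegative, where weight 0 is.\<close>
    define t where "t = l k"
    have "(\<Sum>j<n. l j * w j) - t * m = (\<Sum>j<n. (l j - t) * w j)"
      by (simp add: sw[symmetric] sum_distrib_left left_diff_distrib sum_subtractf)
    also have "\<dots> \<ge> (\<Sum>j<n. if j < m then l j - t else 0)"
    proof (rule sum_mono)
      fix j assume j: "j \<in> {..<n}"
      show "(if j < m then l j - t else 0) \<le> (l j - t) * w j"
      proof (cases "j < m")
        case True
        then have "l j - t \<le> 0" using l[of j k] j Suc mn by (simp add: t_def)
        then show ?thesis using True w01(2)[of j] j mult_left_mono_neg[of "w j" 1 "l j - t"] by simp
      next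
        case False
        then have "l j - t \<ge> 0" using l[of k j] j Suc mn by (simp add: t_def)
        then show ?thesis using False w01(1)[of j] j by simp
      qed
    qed
    finally have "(\<Sum>j<n. if j < m then l j - t else 0) \<le> (\<Sum>j<n. l j * w j) - t * m" .
    moreover have "(\<Sum>j<n. if j < m then l j - t else 0) = (\<Sum>j<m. l j - t)"
      using mn by (simp add: sum.If_cases lessThan_def Int_def conj_commute)
        (metis (mono_tags, lifting) order_less_le_trans)
    ultimately show ?thesis by (simp add: sum_subtractf mult.commute)
  qed
  finally show ?thesis using total by simp
qed

end

section \<open>Functions of class $C^k$\<close>

abbreviation fderiv ::
  "('b::real_normed_vector \<Rightarrow> 'c::real_normed_vector) \<Rightarrow> 'b \<Rightarrow> 'b \<Rightarrow> 'c" where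
  "fderiv f x \<equiv> frechet_derivative f (at x)"

lemma Ck_on_subset: "Ck_on k S f \<Longrightarrow> T \<subseteq> S \<Longrightarrow> Ck_on k T f"
proof (induction k arbitrary: f)
  case 0
  then show ?case by (auto intro: continuous_on_subset)
qed auto

lemma Ck_on_cong:
  assumes "open S" "\<And>x. x \<in> S \<Longrightarrow> f x = g x"
  shows "Ck_on k S f \<Longrightarrow> Ck_on k S g"
  using assms(2)
proof (induction k arbitrary: f g)
  case 0
  then show ?case by (simp cong: continuous_on_cong)
next
  case (Suc k)
  have d: "f differentiable (at x)" if "x \<in> S" for x using Suc.prems(1) that by simp
  have dg: "g differentiable (at x)" if "x \<in> S" for x
  proof -
    have "(f has_derivative fderiv f x) (at x)"
      using d[OF that] frechet_derivative_works by blast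
    then have "(g has_derivative fderiv f x) (at x)"
      by (rule has_derivative_transform_within_open[OF _ \<open>open S\<close> that]) (rule Suc.prems(2))
    then show ?thesis by (rule differentiableI)
  qed
  have D: "fderiv f x = fderiv g x" if "x \<in> S" for x
    by (rule frechet_derivative_transform_within_open[OF d[OF that] \<open>open S\<close> that]) (rule Suc.prems(2))
  have "Ck_on k S (\<lambda>x. fderiv g x v)" for v
  proof (rule Suc.IH)
    show "Ck_on k S (\<lambda>x. fderiv f x v)" using Suc.prems(1) by simp
  qed (simp add: D)
  with dg show ?case by simp
qed

lemma Ck_on_SucD: "Ck_on (Suc k) S f \<Longrightarrow> Ck_on k S f"
proof (induction k arbitrary: f)
  case 0
  then have "isCont f x" if "x \<in> S" for x
    using that by (intro differentiable_imp_continuous_within) simp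
  then show ?case by (simp add: continuous_at_imp_continuous_on)
qed simp

lemma Ck_on_antimono: "Ck_on k S f \<Longrightarrow> j \<le> k \<Longrightarrow> Ck_on j S f"
  by (induction k) (use Ck_on_SucD in \<open>auto simp del: Ck_on.simps(2) simp: le_Suc_eq\<close>)

lemma Ck_on_locally:
  "(\<And>x. x \<in> S \<Longrightarrow> \<exists>T. open T \<and> x \<in> T \<and> Ck_on k T f) \<Longrightarrow> Ck_on k S f"
proof (induction k arbitrary: f)
  case 0
  have "continuous (at x) f" if "x \<in> S" for x
    using 0[OF that] by (auto simp: continuous_on_eq_continuous_at)
  then show ?case
    by (auto simp: continuous_on_eq_continuous_within intro: continuous_at_imp_continuous_within)
next
  case (Suc k)
  have "\<exists>T. open T \<and> x \<in> T \<and> Ck_on k T (\<lambda>x. fderiv f x v)" if "x \<in> S" for x v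
    using Suc.prems[OF that] by auto
  then show ?case using Suc.prems Suc.IH by fastforce
qed

lemma Ck_on_differentiable: "Ck_on (Suc k) S f \<Longrightarrow> x \<in> S \<Longrightarrow> f differentiable (at x)"
  by simp

lemma Ck_on_has_derivative:
  "Ck_on (Suc k) S f \<Longrightarrow> x \<in> S \<Longrightarrow> (f has_derivative fderiv f x) (at x)"
  using Ck_on_differentiable frechet_derivative_works by blast

lemma Ck_on_frechet_derivative:
  "Ck_on (Suc k) S f \<Longrightarrow> Ck_on k S (\<lambda>x. fderiv f x v)"
  by simp

lemma Ck_on_imp_continuous_on: "Ck_on k S f \<Longrightarrow> continuous_on S f"
  using Ck_on_antimono[of k S f 0] by simp

lemma Ck_on_SucI:
  assumes "open S" "\<And>x. x \<in> S \<Longrightarrow> (f has_derivative f' x) (at x)"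
    "\<And>v. Ck_on k S (\<lambda>x. f' x v)"
  shows "Ck_on (Suc k) S f"
proof -
  have eq: "f' x = fderiv f x" if "x \<in> S" for x
    using assms(2)[OF that] by (rule frechet_derivative_at)
  have "Ck_on k S (\<lambda>x. fderiv f x v)" for v
    by (rule Ck_on_cong[OF assms(1) _ assms(3)[of v]]) (simp add: eq)
  then show ?thesis using assms(2) by (auto simp: differentiable_def)
qed

lemma Ck_on_const: "Ck_on k S (\<lambda>x. c)"
  by (induction k arbitrary: c) auto

lemma Ck_on_add:
  assumes "open S"
  shows "Ck_on k S f \<Longrightarrow> Ck_on k S g \<Longrightarrow> Ck_on k S (\<lambda>x. f x + g x)"
proof (induction k arbitrary: f g)
  case 0
  then show ?case by (simp add: continuous_on_add)
next
  case (Suc k)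
  show ?case
  proof (rule Ck_on_SucI[OF assms(1)])
    show "((\<lambda>x. f x + g x) has_derivative
        (\<lambda>v. fderiv f x v + fderiv g x v)) (at x)" if "x \<in> S" for x
      by (rule has_derivative_add) (use Suc.prems that Ck_on_has_derivative in blast)+
    show "Ck_on k S (\<lambda>x. fderiv f x v + fderiv g x v)" for v
      by (rule Suc.IH) (use Suc.prems in auto)
  qed
qed

lemma Ck_on_bounded_bilinear:
  assumes "open S" "bounded_bilinear P"
  shows "Ck_on k S f \<Longrightarrow> Ck_on k S g \<Longrightarrow> Ck_on k S (\<lambda>x. P (f x) (g x))"
proof (induction k arbitrary: f g)
  case 0
  then show ?case using bounded_bilinear.continuous_on[OF assms(2)] by simp
next
  case (Suc k)
  show ?case
  proof (rule Ck_on_SucI[OF assms(1)])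
    show "((\<lambda>x. P (f x) (g x)) has_derivative
        (\<lambda>v. P (f x) (fderiv g x v) + P (fderiv f x v) (g x))) (at x)"
      if "x \<in> S" for x
      by (rule bounded_bilinear.FDERIV[OF assms(2)]) (use Suc.prems that Ck_on_has_derivative in blast)+
    show "Ck_on k S (\<lambda>x. P (f x) (fderiv g x v) + P (fderiv f x v) (g x))" for v
      by (rule Ck_on_add[OF assms(1)
            Suc.IH[OF Ck_on_SucD[OF Suc.prems(1)] Ck_on_frechet_derivative[OF Suc.prems(2)]]
            Suc.IH[OF Ck_on_frechet_derivative[OF Suc.prems(1)] Ck_on_SucD[OF Suc.prems(2)]]])
  qed
qed

lemmas Ck_on_scaleR = Ck_on_bounded_bilinear[OF _ bounded_bilinear_scaleR]
lemmas Ck_on_mult = Ck_on_bounded_bilinear[OF _ bounded_bilinear_mult]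
lemmas Ck_on_inner = Ck_on_bounded_bilinear[OF _ bounded_bilinear_inner]

lemma Ck_on_sum:
  assumes "open S" "\<And>i. i \<in> I \<Longrightarrow> Ck_on k S (f i)"
  shows "Ck_on k S (\<lambda>x. \<Sum>i\<in>I. f i x)"
  using assms(2)
  by (induction I rule: infinite_finite_induct) (auto simp: Ck_on_const intro!: Ck_on_add[OF assms(1)])

lemma Ck_on_ident: "open S \<Longrightarrow> Ck_on k S (\<lambda>x. x)"
proof (cases k)
  case (Suc j)
  assume "open S"
  then show ?thesis unfolding Suc
    by (rule Ck_on_SucI[where f' = "\<lambda>x v. v"]) (auto simp: Ck_on_const)
qed simp

lemma linear_expand_Basis:
  fixes f :: "'b::euclidean_space \<Rightarrow> 'c::real_vector"
  assumes "linear f" shows "f v = (\<Sum>b\<in>Basis. (v \<bullet> b) *\<^sub>R f b)"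
proof -
  have "f v = f (\<Sum>b\<in>Basis. (v \<bullet> b) *\<^sub>R b)" by (simp add: euclidean_representation)
  then show ?thesis by (simp only: linear_sum[OF assms] linear_cmul[OF assms])
qed

text \<open>The definition of C^k controls derivatives in constant directions only. A direction that
  varies with the point is expanded in the basis, which leaves constant directions with C^k
  coefficients.\<close>

lemma Ck_on_frechet_derivative_apply:
  fixes f :: "'b::euclidean_space \<Rightarrow> 'c::real_normed_vector"
  assumes "open S" "Ck_on (Suc k) S f" "Ck_on k S w"
  shows "Ck_on k S (\<lambda>x. fderiv f x (w x))"
proof (rule Ck_on_cong[OF assms(1)])
  show "Ck_on k S (\<lambda>x. \<Sum>b\<in>Basis. (w x \<bullet> b) *\<^sub>R fderiv f x b)"
    using assms by (intro Ck_on_sum Ck_on_scaleR Ck_on_inner Ck_on_const) auto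
  show "(\<Sum>b\<in>Basis. (w x \<bullet> b) *\<^sub>R fderiv f x b) = fderiv f x (w x)"
    if "x \<in> S" for x
    using linear_expand_Basis[OF linear_frechet_derivative[OF Ck_on_differentiable[OF assms(2) that]]]
    by metis
qed

text \<open>The chain rule produces the direction \<open>fderiv \<phi> x v\<close>, which moves with
  \<open>x\<close>; expanding it in the basis leaves compositions with the derivatives of
  \<open>f\<close> in constant directions, to which the induction hypothesis applies.\<close>

lemma Ck_on_compose:
  fixes f :: "'c::euclidean_space \<Rightarrow> 'd::real_normed_vector" and \<phi> :: "'b::euclidean_space \<Rightarrow> 'c"
  assumes "open V" "\<phi> ` V \<subseteq> U"
  shows "Ck_on k U f \<Longrightarrow> Ck_on k V \<phi> \<Longrightarrow> Ck_on k V (\<lambda>x. f (\<phi> x))"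
proof (induction k arbitrary: f)
  case 0
  then show ?case using continuous_on_compose2[of U f V \<phi>] assms(2) by simp
next
  case (Suc k)
  have d: "f differentiable (at (\<phi> x))" if "x \<in> V" for x
    using Suc.prems(1) that assms(2) by (auto intro: Ck_on_differentiable)
  show ?case
  proof (rule Ck_on_SucI[OF assms(1)])
    show "((\<lambda>x. f (\<phi> x)) has_derivative
        (\<lambda>v. fderiv f (\<phi> x) (fderiv \<phi> x v))) (at x)" if "x \<in> V" for x
      using has_derivative_compose[OF Ck_on_has_derivative[OF Suc.prems(2) that]] d[OF that]
        frechet_derivative_works by blast
    fix v
    have "Ck_on k V (\<lambda>x. \<Sum>b\<in>Basis. (fderiv \<phi> x v \<bullet> b) *\<^sub>R fderiv f (\<phi> x) b)"
      using Suc.prems assms(1)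
      by (intro Ck_on_sum Ck_on_scaleR Ck_on_inner Ck_on_const Suc.IH Ck_on_frechet_derivative Ck_on_SucD[of k V \<phi>])
    then show "Ck_on k V (\<lambda>x. fderiv f (\<phi> x) (fderiv \<phi> x v))"
      by (rule Ck_on_cong[OF assms(1), rotated])
        (metis linear_expand_Basis linear_frechet_derivative d)
  qed
qed

section \<open>Symmetry of second derivatives\<close>

lemma has_derivative_along_line:
  assumes "f differentiable (at (x + s *\<^sub>R u))"
  shows "((\<lambda>s. f (x + s *\<^sub>R u)) has_vector_derivative fderiv f (x + s *\<^sub>R u) u) (at s)"
proof -
  have 1: "((\<lambda>s. x + s *\<^sub>R u) has_derivative (\<lambda>h. h *\<^sub>R u)) (at s)"
    by (auto intro!: derivative_eq_intros)
  have "((\<lambda>s. f (x + s *\<^sub>R u)) has_derivative (\<lambda>h. fderiv f (x + s *\<^sub>R u) (h *\<^sub>R u))) (at s)"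
    using has_derivative_compose[OF 1] assms frechet_derivative_works by blast
  moreover have "fderiv f (x + s *\<^sub>R u) (h *\<^sub>R u) = h *\<^sub>R fderiv f (x + s *\<^sub>R u) u" for h
    using linear_frechet_derivative[OF assms] by (rule linear_cmul)
  ultimately show ?thesis by (simp add: has_vector_derivative_def)
qed

text \<open>Two applications of the mean value theorem, first along \<open>u\<close> and then along
  \<open>v\<close>. The left-hand side of the equation is symmetric in \<open>u\<close> and
  \<open>v\<close>, so exchanging them expresses it by the other mixed derivative at another nearby
  point.\<close>

lemma second_difference:
  fixes f :: "'b::euclidean_space \<Rightarrow> real"
  assumes f: "Ck_on 2 (ball x r) f" and t: "t > 0" "t * (norm u + norm v) < r"
  shows "\<exists>\<xi>\<in>cball x (t * (norm u + norm v)).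
    f (x + t *\<^sub>R u + t *\<^sub>R v) - f (x + t *\<^sub>R u) - f (x + t *\<^sub>R v) + f x =
      t * (t * fderiv (\<lambda>y. fderiv f y u) \<xi> v)"
proof -
  have near: "dist x (x + s *\<^sub>R u + q *\<^sub>R v) \<le> t * (norm u + norm v)"
    if "0 \<le> s" "s \<le> t" "0 \<le> q" "q \<le> t" for s q
  proof -
    have "dist x (x + s *\<^sub>R u + q *\<^sub>R v) = norm (s *\<^sub>R u + q *\<^sub>R v)"
      by (metis add.assoc add_diff_cancel_left' dist_commute dist_norm)
    also have "\<dots> \<le> s * norm u + q * norm v"
      using norm_triangle_ineq[of "s *\<^sub>R u" "q *\<^sub>R v"] that by simp
    also have "\<dots> \<le> t * norm u + t * norm v"
      using that by (intro add_mono mult_right_mono) auto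
    finally show ?thesis by (simp add: algebra_simps)
  qed
  have inb: "x + s *\<^sub>R u + q *\<^sub>R v \<in> ball x r" if "0 \<le> s" "s \<le> t" "0 \<le> q" "q \<le> t" for s q
    using near[OF that] t(2) by simp
  have f1: "f differentiable (at y)" if "y \<in> ball x r" for y
    using f that by (simp add: numeral_2_eq_2)
  have f2: "(\<lambda>y. fderiv f y u) differentiable (at y)" if "y \<in> ball x r" for y
    using f that by (simp add: numeral_2_eq_2)
  have "\<exists>z>0. z < t \<and> (f ((x + t *\<^sub>R v) + t *\<^sub>R u) - f (x + t *\<^sub>R u)) - (f ((x + t *\<^sub>R v) + 0 *\<^sub>R u) - f (x + 0 *\<^sub>R u)) =
    (t - 0) * (fderiv f ((x + t *\<^sub>R v) + z *\<^sub>R u) u - fderiv f (x + z *\<^sub>R u) u)"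
  proof (rule MVT2[OF t(1)])
    fix s assume s: "0 \<le> s" "s \<le> t"
    have "(x + t *\<^sub>R v) + s *\<^sub>R u \<in> ball x r" "x + s *\<^sub>R u \<in> ball x r"
      using inb[of s t] inb[of s 0] s t(1) by (auto simp: algebra_simps)
    from this[THEN f1, THEN has_derivative_along_line]
    show "((\<lambda>s. f ((x + t *\<^sub>R v) + s *\<^sub>R u) - f (x + s *\<^sub>R u)) has_real_derivative
      fderiv f ((x + t *\<^sub>R v) + s *\<^sub>R u) u - fderiv f (x + s *\<^sub>R u) u) (at s)"
      by (intro DERIV_diff) (simp_all add: has_real_derivative_iff_has_vector_derivative)
  qed
  then obtain z where z: "0 < z" "z < t"
    "f (x + t *\<^sub>R u + t *\<^sub>R v) - f (x + t *\<^sub>R u) - f (x + t *\<^sub>R v) + f x =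
    t * (fderiv f ((x + z *\<^sub>R u) + t *\<^sub>R v) u - fderiv f (x + z *\<^sub>R u) u)"
    by (auto simp: algebra_simps)
  have "\<exists>q>0. q < t \<and> fderiv f ((x + z *\<^sub>R u) + t *\<^sub>R v) u -
      fderiv f ((x + z *\<^sub>R u) + 0 *\<^sub>R v) u =
    (t - 0) * fderiv (\<lambda>y. fderiv f y u) ((x + z *\<^sub>R u) + q *\<^sub>R v) v"
  proof (rule MVT2[OF t(1)])
    fix s assume s: "0 \<le> s" "s \<le> t"
    have "(x + z *\<^sub>R u) + s *\<^sub>R v \<in> ball x r"
      using inb[of z s] s z by auto
    from this[THEN f2, THEN has_derivative_along_line]
    show "((\<lambda>q. fderiv f ((x + z *\<^sub>R u) + q *\<^sub>R v) u) has_real_derivative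
      fderiv (\<lambda>y. fderiv f y u) ((x + z *\<^sub>R u) + s *\<^sub>R v) v) (at s)"
      by (simp add: has_real_derivative_iff_has_vector_derivative)
  qed
  then obtain q where "0 < q" "q < t" and q: "fderiv f ((x + z *\<^sub>R u) + t *\<^sub>R v) u -
      fderiv f (x + z *\<^sub>R u) u =
    t * fderiv (\<lambda>y. fderiv f y u) ((x + z *\<^sub>R u) + q *\<^sub>R v) v"
    by auto
  then show ?thesis
    using near[of z q] z by (intro bexI[of _ "x + z *\<^sub>R u + q *\<^sub>R v"]) auto
qed

text \<open>Both mixed derivatives equal the same second difference, up to the factor
  \<open>t * t\<close>, at points that tend to \<open>x\<close>; their continuity at
  \<open>x\<close> finishes the argument.\<close>

lemma second_derivative_symmetric_real:
  fixes f :: "'b::euclidean_space \<Rightarrow> real"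
  assumes "open S" "Ck_on 2 S f" "x \<in> S"
  shows "fderiv (\<lambda>y. fderiv f y u) x v =
    fderiv (\<lambda>y. fderiv f y v) x u"
proof -
  define A where "A y = fderiv (\<lambda>y. fderiv f y u) y v" for y
  define B where "B y = fderiv (\<lambda>y. fderiv f y v) y u" for y
  obtain r where r: "r > 0" "ball x r \<subseteq> S" using assms openE by blast
  have f: "Ck_on 2 (ball x r) f" using Ck_on_subset[OF assms(2) r(2)] .
  have "isCont A x" "isCont B x"
    using f r(1) unfolding A_def B_def by (auto simp: numeral_2_eq_2 continuous_on_eq_continuous_at)
  have "\<bar>A x - B x\<bar> \<le> 0 + e" if "e > 0" for e
  proof -
    obtain d where d: "d > 0" "\<And>y. dist y x < d \<Longrightarrow> \<bar>A y - A x\<bar> < e / 2"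
      using \<open>isCont A x\<close>[unfolded continuous_at_eps_delta dist_real_def, rule_format, OF half_gt_zero[OF \<open>e > 0\<close>]]
      by blast
    obtain d' where d': "d' > 0" "\<And>y. dist y x < d' \<Longrightarrow> \<bar>B y - B x\<bar> < e / 2"
      using \<open>isCont B x\<close>[unfolded continuous_at_eps_delta dist_real_def, rule_format, OF half_gt_zero[OF \<open>e > 0\<close>]]
      by blast
    define m where "m = min r (min d d')"
    have m: "m > 0" "m \<le> r" "m \<le> d" "m \<le> d'" using r d d' by (auto simp: m_def)
    \<comment> \<open>Small enough that the whole parallelogram lies within distance
      \<open>m\<close> of \<open>x\<close>; the summand 1 covers the case that \<open>u\<close> and
      \<open>v\<close> both vanish.\<close>
    define t where "t = m / (1 + norm u + norm v)"
    have n: "1 + norm u + norm v > 0" by (simp add: add_pos_nonneg)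
    have t: "t > 0" using m n by (simp add: t_def)
    have "t * (norm u + norm v) < t * (1 + norm u + norm v)" using t by simp
    also have "\<dots> = m" using n unfolding t_def by simp
    finally have tm: "t * (norm u + norm v) < m" .
    then have "t * (norm u + norm v) < r" "t * (norm v + norm u) < r" using m by (auto simp: add.commute)
    from second_difference[OF f t this(1)] second_difference[OF f t this(2)]
    obtain \<xi> \<eta> where \<xi>: "\<xi> \<in> cball x (t * (norm u + norm v))" "\<eta> \<in> cball x (t * (norm u + norm v))"
      "t * (t * A \<xi>) = t * (t * B \<eta>)"
      unfolding A_def B_def by (auto simp: algebra_simps)
    then have "A \<xi> = B \<eta>" using t by simp
    moreover have "dist \<xi> x < d" "dist \<eta> x < d'" using \<xi> tm m by (auto simp: dist_commute)
    then have "\<bar>A \<xi> - A x\<bar> < e / 2" "\<bar>B \<eta> - B x\<bar> < e / 2" using d(2) d'(2) by auto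
    ultimately show ?thesis by linarith
  qed
  then have "\<bar>A x - B x\<bar> \<le> 0" by (rule field_le_epsilon)
  then show ?thesis by (simp add: A_def B_def)
qed

lemma frechet_derivative_inner:
  assumes "f differentiable (at x)"
  shows "fderiv (\<lambda>y. f y \<bullet> c) x = (\<lambda>h. fderiv f x h \<bullet> c)"
  using assms has_derivative_inner_left frechet_derivative_works frechet_derivative_at by metis

lemma second_derivative_symmetric:
  fixes f :: "'b::euclidean_space \<Rightarrow> 'c::euclidean_space"
  assumes "open S" "Ck_on 2 S f" "x \<in> S"
  shows "fderiv (\<lambda>y. fderiv f y u) x v =
    fderiv (\<lambda>y. fderiv f y v) x u"
proof (rule euclidean_eqI)
  fix c :: 'c
  have f: "Ck_on (Suc 1) S f" using assms(2) by (simp add: numeral_2_eq_2)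
  have d1: "f differentiable (at y)" if "y \<in> S" for y
    using f that by (rule Ck_on_differentiable)
  have d2: "(\<lambda>y. fderiv f y w) differentiable (at x)" for w
    using f assms(3) by simp
  have "Ck_on 2 S (\<lambda>y. f y \<bullet> c)"
    using assms by (intro Ck_on_inner Ck_on_const)
  note * = second_derivative_symmetric_real[OF assms(1) this assms(3), of u v]
  have "fderiv (\<lambda>y. fderiv (\<lambda>y. f y \<bullet> c) y w) x =
    fderiv (\<lambda>y. fderiv f y w \<bullet> c) x" for w
    by (rule frechet_derivative_transform_within_open[OF _ assms(1,3), symmetric])
      (use d1 d2 in \<open>auto simp: frechet_derivative_inner intro!: differentiable_inner\<close>)
  then show "fderiv (\<lambda>y. fderiv f y u) x v \<bullet> c =
    fderiv (\<lambda>y. fderiv f y v) x u \<bullet> c"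
    using * by (simp add: frechet_derivative_inner[OF d2])
qed

text \<open>Where \<open>g\<close> vanishes, the product rule needs only continuity of
  \<open>f\<close>: the error is \<open>f y\<close> times the error of \<open>g\<close>, plus
  \<open>f y - f x\<close> times \<open>g' (y - x)\<close>. This gives differentiability of
  solutions so far known only to be continuous, and of \<open>pos_sq\<close> at 0.\<close>

lemma has_derivative_mult_zero:
  fixes f g :: "'b::real_normed_vector \<Rightarrow> real"
  assumes f: "isCont f x" and g: "(g has_derivative g') (at x)" "g x = 0"
  shows "((\<lambda>y. f y * g y) has_derivative (\<lambda>h. f x * g' h)) (at x)"
proof -
  have bl: "bounded_linear g'" using g(1) by (rule has_derivative_bounded_linear)
  obtain K where K: "\<And>h. norm (g' h) \<le> norm h * K" using bounded_linear.bounded[OF bl] by blast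
  have 1: "((\<lambda>y. (1 / norm (y - x)) *\<^sub>R (g y - g' (y - x))) \<longlongrightarrow> 0) (at x)"
    using g unfolding has_derivative_within by simp
  have fl: "(f \<longlongrightarrow> f x) (at x)" using f by (simp add: isCont_def)
  have 2: "((\<lambda>y. f y * ((1 / norm (y - x)) *\<^sub>R (g y - g' (y - x)))) \<longlongrightarrow> 0) (at x)"
    using tendsto_mult[OF fl 1] by simp
  have 3: "((\<lambda>y. (f y - f x) * (g' (y - x) / norm (y - x))) \<longlongrightarrow> 0) (at x)"
  proof (rule Lim_null_comparison)
    show "((\<lambda>y. \<bar>f y - f x\<bar> * \<bar>K\<bar>) \<longlongrightarrow> 0) (at x)"
      using fl by (intro tendsto_mult_left_zero tendsto_rabs_zero) (simp add: LIM_zero)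
    have "norm ((f y - f x) * (g' (y - x) / norm (y - x))) \<le> \<bar>f y - f x\<bar> * \<bar>K\<bar>" for y
    proof (cases "y = x")
      case False
      have "\<bar>g' (y - x)\<bar> \<le> norm (y - x) * \<bar>K\<bar>"
        using K[of "y - x"] abs_ge_self[of K] mult_left_mono[of K "\<bar>K\<bar>" "norm (y - x)"] by simp
      then have "\<bar>f y - f x\<bar> * (\<bar>g' (y - x)\<bar> / norm (y - x)) \<le> \<bar>f y - f x\<bar> * \<bar>K\<bar>"
        using False by (intro mult_left_mono) (auto simp: field_simps)
      then show ?thesis by (simp add: abs_mult)
    qed simp
    then show "\<forall>\<^sub>F y in at x. norm ((f y - f x) * (g' (y - x) / norm (y - x))) \<le> \<bar>f y - f x\<bar> * \<bar>K\<bar>"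
      by simp
  qed
  have "((\<lambda>y. (1 / norm (y - x)) *\<^sub>R (f y * g y - (f x * g x + f x * g' (y - x)))) \<longlongrightarrow> 0) (at x)"
    by (rule Lim_transform_eventually[OF tendsto_add_zero[OF 2 3]])
      (simp add: g(2) diff_divide_distrib algebra_simps)
  then show ?thesis
    using bounded_linear_const_mult[OF bl, of "f x"] by (simp add: has_derivative_within)
qed

section \<open>Riemannian metrics on open subsets of a Euclidean space\<close>

lemmas has_frechet_derivative = frechet_derivative_works[THEN iffD1]

lemma Ck_on_2_differentiable:
  assumes "Ck_on 2 S f" "x \<in> S"
  shows "f differentiable (at x)" "(\<lambda>y. fderiv f y u) differentiable (at x)"
  using assms by (auto simp: numeral_2_eq_2)

lemma (in inner_form) riesz:
  assumes "linear \<omega>"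
  obtains z where "\<And>w. G z w = \<omega> w"
proof -
  define n where "n = DIM('b)"
  obtain e where e: "orthonormal n e"
    using ex_orthonormal[of UNIV n] unfolding n_def by (metis dim_UNIV subspace_UNIV)
  have sp: "span (e ` {..<n}) = UNIV"
    using orthonormal_span[OF e, of UNIV] by (simp add: n_def)
  have "G (\<Sum>i<n. \<omega> (e i) *\<^sub>R e i) w = \<omega> w" for w
  proof -
    have "w = (\<Sum>i<n. G w (e i) *\<^sub>R e i)" using orthonormal_expand[OF e] sp by blast
    then have "\<omega> w = \<omega> (\<Sum>i<n. G w (e i) *\<^sub>R e i)" by (rule arg_cong)
    also have "\<dots> = (\<Sum>i<n. G w (e i) * \<omega> (e i))"
      using assms by (simp add: linear_sum linear_cmul)
    also have "\<dots> = G (\<Sum>i<n. \<omega> (e i) *\<^sub>R e i) w"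
      by (simp add: G_sum_left G_simps sym[of w] mult.commute)
    finally show ?thesis by simp
  qed
  then show thesis by (rule that)
qed

lemma bilinear_expand_left:
  fixes B :: "'b::euclidean_space \<Rightarrow> 'b \<Rightarrow> real"
  assumes "bilinear B"
  shows "B v w = (\<Sum>b\<in>Basis. (v \<bullet> b) * B b w)"
proof -
  have "linear (\<lambda>v. B v w)" using assms by (simp add: bilinear_def)
  from linear_expand_Basis[OF this, of v] show ?thesis by simp
qed

lemma bilinear_expand:
  fixes B :: "'b::euclidean_space \<Rightarrow> 'b \<Rightarrow> real"
  assumes "bilinear B"
  shows "B u v = (\<Sum>b\<in>Basis. \<Sum>b'\<in>Basis. (u \<bullet> b) * (v \<bullet> b') * B b b')"
proof -
  have "B u v = (\<Sum>b\<in>Basis. (u \<bullet> b) * B b v)"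
    using assms by (rule bilinear_expand_left)
  also have "\<dots> = (\<Sum>b\<in>Basis. \<Sum>b'\<in>Basis. (u \<bullet> b) * (v \<bullet> b') * B b b')"
  proof (intro sum.cong refl)
    fix b :: 'b assume "b \<in> Basis"
    have "B b v = (\<Sum>b'\<in>Basis. (v \<bullet> b') * B b b')"
      using linear_expand_Basis[of "\<lambda>v. B b v" v] assms unfolding bilinear_def by simp
    then show "(u \<bullet> b) * B b v = (\<Sum>b'\<in>Basis. (u \<bullet> b) * (v \<bullet> b') * B b b')"
      by (simp add: sum_distrib_left mult.assoc)
  qed
  finally show ?thesis .
qed

text \<open>Kept independent of manifolds because it is instantiated three times: with the metric
  read in a chart, with its restriction to an overlap of charts, and with the constant Euclidean
  product.\<close>

locale chart_metric =
  fixes U :: "'b::euclidean_space set" and G :: "'b \<Rightarrow> 'b \<Rightarrow> 'b \<Rightarrow> real"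
  assumes open_U: "open U" and inner_form: "x \<in> U \<Longrightarrow> inner_form (G x)"
    and C1: "Ck_on 1 U (\<lambda>x. G x u v)"
begin

lemma bilinear_G: "x \<in> U \<Longrightarrow> bilinear (G x)"
  using inner_form inner_form.bilin by blast

lemma G_sym: "x \<in> U \<Longrightarrow> G x u v = G x v u"
  using inner_form inner_form.sym by blast

lemma G_continuous: "continuous_on U (\<lambda>x. G x u v)"
  using Ck_on_imp_continuous_on[OF C1] .

section \<open>Derivatives of the metric coefficients\<close>

definition dG :: "'b \<Rightarrow> 'b \<Rightarrow> 'b \<Rightarrow> 'b \<Rightarrow> real" where
  "dG x h u v = fderiv (\<lambda>y. G y u v) x h"

lemma has_derivative_G_const: "x \<in> U \<Longrightarrow> ((\<lambda>y. G y u v) has_derivative (\<lambda>h. dG x h u v)) (at x)"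
  unfolding dG_def using Ck_on_has_derivative[of 0 U "\<lambda>y. G y u v" x] C1 by simp

lemma continuous_dG: "continuous_on U (\<lambda>x. dG x h u v)"
  unfolding dG_def using Ck_on_frechet_derivative[of 0 U "\<lambda>x. G x u v" h] C1 by simp

lemma dG_sym: "x \<in> U \<Longrightarrow> dG x h u v = dG x h v u"
  unfolding dG_def
  by (subst frechet_derivative_transform_within_open[OF _ open_U, where g = "\<lambda>y. G y v u"])
    (use C1[of u v] G_sym in auto)

lemma dG_expand:
  assumes x: "x \<in> U"
  shows "dG x h u v = (\<Sum>b\<in>Basis. \<Sum>b'\<in>Basis. (u \<bullet> b) * (v \<bullet> b') * dG x h b b')"
proof -
  have "((\<lambda>y. \<Sum>b\<in>Basis. \<Sum>b'\<in>Basis. (u \<bullet> b) * (v \<bullet> b') * G y b b') has_derivative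
      (\<lambda>h. \<Sum>b\<in>Basis. \<Sum>b'\<in>Basis. (u \<bullet> b) * (v \<bullet> b') * dG x h b b')) (at x)"
    by (intro has_derivative_sum has_derivative_mult_right has_derivative_G_const x)
  then have "((\<lambda>y. G y u v) has_derivative
      (\<lambda>h. \<Sum>b\<in>Basis. \<Sum>b'\<in>Basis. (u \<bullet> b) * (v \<bullet> b') * dG x h b b')) (at x)"
    by (rule has_derivative_transform_within_open[OF _ open_U x])
      (rule bilinear_expand[OF bilinear_G, symmetric])
  from has_derivative_unique[OF has_derivative_G_const[OF x] this] show ?thesis by metis
qed

lemma bilinear_dG:
  assumes x: "x \<in> U"
  shows "bilinear (dG x h)"
proof -
  have "linear (\<lambda>u. dG x h u v)" for v
  proof (rule linearI)
    show "dG x h (u + u') v = dG x h u v + dG x h u' v" for u u'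
      unfolding dG_expand[OF x, of h "u + u'"] dG_expand[OF x, of h u] dG_expand[OF x, of h u']
        sum.distrib[symmetric] by (simp add: inner_add_left algebra_simps)
    show "dG x h (c *\<^sub>R u) v = c *\<^sub>R dG x h u v" for c u
      unfolding dG_expand[OF x, of h "c *\<^sub>R u"] dG_expand[OF x, of h u]
      by (simp add: sum_distrib_left algebra_simps)
  qed
  then show ?thesis
    unfolding bilinear_def using dG_sym[OF x] by auto
qed

lemma linear_dG: "x \<in> U \<Longrightarrow> linear (\<lambda>h. dG x h u v)"
  using has_derivative_G_const has_derivative_linear by blast

text \<open>Differentiability of the metric is known entry by entry. Expanding both arguments in the
  basis turns the claim into the ordinary product rule for three scalar factors.\<close>

lemma has_derivative_G:
  assumes \<phi>: "(\<phi> has_derivative \<phi>') (at y)" "\<phi> y \<in> U"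
    and Y: "(Y has_derivative Y') (at y)" and Z: "(Z has_derivative Z') (at y)"
  shows "((\<lambda>y. G (\<phi> y) (Y y) (Z y)) has_derivative (\<lambda>h. dG (\<phi> y) (\<phi>' h) (Y y) (Z y) +
      G (\<phi> y) (Y' h) (Z y) + G (\<phi> y) (Y y) (Z' h))) (at y)"
proof -
  have "isCont \<phi> y" using \<phi>(1) by (rule has_derivative_continuous)
  then have "\<forall>\<^sub>F z in nhds y. \<phi> z \<in> U"
    using \<phi>(2) open_U unfolding continuous_at_open eventually_nhds by blast
  then obtain W where W: "open W" "y \<in> W" "\<And>z. z \<in> W \<Longrightarrow> \<phi> z \<in> U"
    unfolding eventually_nhds by blast
  have d: "((\<lambda>y. G (\<phi> y) u v) has_derivative (\<lambda>h. dG (\<phi> y) (\<phi>' h) u v)) (at y)" for u v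
    using has_derivative_compose[OF \<phi>(1) has_derivative_G_const[OF \<phi>(2)]] .
  let ?D = "\<lambda>h. \<Sum>b\<in>Basis. \<Sum>b'\<in>Basis. (Y y \<bullet> b) * (Z y \<bullet> b') * dG (\<phi> y) (\<phi>' h) b b' +
      ((Y y \<bullet> b) * (Z' h \<bullet> b') + (Y' h \<bullet> b) * (Z y \<bullet> b')) * G (\<phi> y) b b'"
  have "((\<lambda>z. \<Sum>b\<in>Basis. \<Sum>b'\<in>Basis. (Y z \<bullet> b) * (Z z \<bullet> b') * G (\<phi> z) b b') has_derivative ?D) (at y)"
    by (intro has_derivative_sum has_derivative_mult d has_derivative_inner_left Y Z)
  then have "((\<lambda>z. G (\<phi> z) (Y z) (Z z)) has_derivative ?D) (at y)"
    by (rule has_derivative_transform_within_open[OF _ W(1,2)])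
      (rule bilinear_expand[OF bilinear_G[OF W(3)], symmetric])
  moreover have "?D h = dG (\<phi> y) (\<phi>' h) (Y y) (Z y) + G (\<phi> y) (Y' h) (Z y) + G (\<phi> y) (Y y) (Z' h)" for h
    unfolding bilinear_expand[OF bilinear_dG[OF \<phi>(2)], of _ "Y y" "Z y"]
      bilinear_expand[OF bilinear_G[OF \<phi>(2)], of "Y' h" "Z y"]
      bilinear_expand[OF bilinear_G[OF \<phi>(2)], of "Y y" "Z' h"] sum.distrib[symmetric]
    by (intro sum.cong refl) (simp add: algebra_simps)
  ultimately show ?thesis by simp
qed

lemma continuous_on_form:
  fixes S :: "'b set" and Y Z :: "'b \<Rightarrow> 'b"
  assumes "S \<subseteq> U" "\<And>b b'. continuous_on S (\<lambda>x. B x b b')" "\<And>x. x \<in> U \<Longrightarrow> bilinear (B x)"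
    "continuous_on S Y" "continuous_on S Z"
  shows "continuous_on S (\<lambda>x. B x (Y x) (Z x) :: real)"
proof -
  have "continuous_on S (\<lambda>x. \<Sum>b\<in>Basis. \<Sum>b'\<in>Basis. (Y x \<bullet> b) * (Z x \<bullet> b') * B x b b')"
    using assms by (intro continuous_intros) auto
  then show ?thesis
    by (rule continuous_on_eq) (rule bilinear_expand[OF assms(3), symmetric], rule subsetD[OF assms(1)])
qed

text \<open>The musical isomorphism from covectors to vectors. It is a description rather than a
  formula, so that \<open>chr\<close> unfolds to the very term that defines
  \<open>christoffel\<close>.\<close>

definition sharp :: "'b \<Rightarrow> ('b \<Rightarrow> real) \<Rightarrow> 'b" where
  "sharp x \<omega> = (THE z. \<forall>w. G x z w = \<omega> w)"

lemma sharp_eqI: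
  assumes "x \<in> U" "\<And>w. G x z w = \<omega> w" shows "sharp x \<omega> = z"
proof -
  interpret inner_form "G x" using assms(1) by (rule inner_form)
  show ?thesis unfolding sharp_def using assms(2) G_right_eqI by (intro the_equality) auto
qed

lemma G_sharp:
  assumes "x \<in> U" "linear \<omega>" shows "G x (sharp x \<omega>) w = \<omega> w"
proof -
  interpret inner_form "G x" using assms(1) by (rule inner_form)
  obtain z where "\<And>w. G x z w = \<omega> w" using riesz[OF assms(2)] by blast
  then show ?thesis using sharp_eqI[OF assms(1)] by metis
qed

text \<open>Continuous dependence without inverting a matrix. For \<open>d = z y - z x\<close>,
  subtracting the two equations expresses \<open>G x d w\<close> by the changes of
  \<open>\<omega>\<close> and \<open>G\<close>; coercivity of \<open>G x\<close> bounds
  \<open>d\<close>, and the part of the bound proportional to \<open>norm d\<close> is absorbed once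
  \<open>G y\<close> is close to \<open>G x\<close>.\<close>

lemma solution_continuous:
  assumes z: "\<And>x w. x \<in> U \<Longrightarrow> G x (z x) w = \<omega> x w"
    and \<omega>: "\<And>w. continuous_on U (\<lambda>x. \<omega> x w)"
  shows "continuous_on U z"
proof (intro continuous_at_imp_continuous_on ballI)
  fix x assume x: "x \<in> U"
  interpret inner_form "G x" using x by (rule inner_form)
  obtain c where c: "c > 0" "\<And>u. c * norm u ^ 2 \<le> G x u u" using lower_bound by blast
  define N where "N = real DIM('b)"
  define a where "a y = (\<Sum>w\<in>Basis. \<bar>\<omega> y w - \<omega> x w\<bar>)" for y
  define k where "k y = (\<Sum>w\<in>Basis. \<Sum>b\<in>Basis. \<bar>G y b w - G x b w\<bar>)" for y
  have tend: "((\<lambda>y. \<omega> y w) \<longlongrightarrow> \<omega> x w) (at x)" "((\<lambda>y. G y b w) \<longlongrightarrow> G x b w) (at x)" for b w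
    using \<omega>[of w] G_continuous[of b w] x open_U
    by (auto simp: continuous_on_eq_continuous_at isCont_def)
  have a0: "(a \<longlongrightarrow> 0) (at x)"
    unfolding a_def by (intro tendsto_null_sum tendsto_rabs_zero LIM_zero tend)
  have k0: "(k \<longlongrightarrow> 0) (at x)"
    unfolding k_def by (intro tendsto_null_sum tendsto_rabs_zero LIM_zero tend)
  \<comment> \<open>\<open>N\<close> counts the basis vectors over which the estimate is summed. The
    threshold on \<open>k y\<close> makes \<open>N * k y\<close> less than \<open>c / 2\<close>, so
    half of the coercive term survives the absorption, whence the factor 2.\<close>
  have est: "norm (z y - z x) \<le> (2 * N / c) * (a y + norm (z x) * k y)"
    if y: "y \<in> U" "k y < c / (2 * N)" for y
  proof (cases "z y = z x")
    case True
    have "0 \<le> a y" "0 \<le> k y" unfolding a_def k_def by (auto intro!: sum_nonneg)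
    then show ?thesis using True c(1) by (simp add: N_def)
  next
    case False
    define d where "d = z y - z x"
    have d: "norm d > 0" using False by (simp add: d_def)
    have Gd: "\<bar>G x d w\<bar> \<le> a y + norm (z y) * k y" if w: "w \<in> Basis" for w
    proof -
      have "G x d w = (\<omega> y w - \<omega> x w) - (G y (z y) w - G x (z y) w)"
        using z[OF y(1), of w] z[OF x, of w] by (simp add: d_def G_simps)
      also have "G y (z y) w = (\<Sum>b\<in>Basis. (z y \<bullet> b) * G y b w)"
        by (rule bilinear_expand_left[OF bilinear_G[OF y(1)]])
      also have "G x (z y) w = (\<Sum>b\<in>Basis. (z y \<bullet> b) * G x b w)"
        by (rule bilinear_expand_left[OF bilinear_G[OF x]])
      also have "(\<Sum>b\<in>Basis. (z y \<bullet> b) * G y b w) - (\<Sum>b\<in>Basis. (z y \<bullet> b) * G x b w) =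
          (\<Sum>b\<in>Basis. (z y \<bullet> b) * (G y b w - G x b w))"
        by (simp add: sum_subtractf right_diff_distrib)
      finally have "\<bar>G x d w\<bar> \<le> \<bar>\<omega> y w - \<omega> x w\<bar> + \<bar>\<Sum>b\<in>Basis. (z y \<bullet> b) * (G y b w - G x b w)\<bar>"
        by simp
      also have "\<bar>\<Sum>b\<in>Basis. (z y \<bullet> b) * (G y b w - G x b w)\<bar> \<le>
          (\<Sum>b\<in>Basis. norm (z y) * \<bar>G y b w - G x b w\<bar>)"
        by (intro order_trans[OF sum_abs] sum_mono)
          (auto simp: abs_mult Basis_le_norm intro!: mult_right_mono)
      also have "\<dots> = norm (z y) * (\<Sum>b\<in>Basis. \<bar>G y b w - G x b w\<bar>)"
        by (simp add: sum_distrib_left)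
      also have "\<dots> \<le> norm (z y) * k y"
        unfolding k_def using w by (intro mult_left_mono member_le_sum sum_nonneg) auto
      also have "\<bar>\<omega> y w - \<omega> x w\<bar> \<le> a y"
        unfolding a_def using w by (intro member_le_sum) auto
      finally show ?thesis by simp
    qed
    have k_nonneg: "0 \<le> k y" unfolding k_def by (auto intro!: sum_nonneg)
    have "c * norm d ^ 2 \<le> G x d d" by (rule c)
    also have "\<dots> = (\<Sum>w\<in>Basis. (d \<bullet> w) * G x d w)"
      by (subst G_sum_right[symmetric, where f = "\<lambda>w. (d \<bullet> w) *\<^sub>R w", unfolded G_simps real_scaleR_def])
        (simp add: euclidean_representation)
    also have "\<dots> \<le> (\<Sum>w\<in>(Basis::'b set). norm d * (a y + norm (z y) * k y))"
    proof (rule sum_mono)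
      fix w :: 'b assume w: "w \<in> Basis"
      have "(d \<bullet> w) * G x d w \<le> \<bar>d \<bullet> w\<bar> * \<bar>G x d w\<bar>" by (metis abs_ge_self abs_mult)
      also have "\<dots> \<le> norm d * (a y + norm (z y) * k y)"
        using w Gd[OF w] by (intro mult_mono) (auto simp: Basis_le_norm)
      finally show "(d \<bullet> w) * G x d w \<le> norm d * (a y + norm (z y) * k y)" .
    qed
    also have "\<dots> = norm d * (N * (a y + norm (z y) * k y))" by (simp add: N_def)
    finally have "c * norm d \<le> N * (a y + norm (z y) * k y)"
      using d by (simp add: power2_eq_square)
    also have "\<dots> \<le> N * (a y + (norm (z x) + norm d) * k y)"
      using k_nonneg norm_triangle_ineq[of "z x" d]
      by (intro mult_left_mono add_left_mono mult_right_mono) (auto simp: d_def N_def)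
    also have "\<dots> = N * (a y + norm (z x) * k y) + norm d * (N * k y)" by (simp add: algebra_simps)
    also have "norm d * (N * k y) \<le> norm d * (c / 2)"
      using y(2) by (intro mult_left_mono) (auto simp: N_def field_simps)
    finally show ?thesis using c(1) by (simp add: d_def field_simps)
  qed
  have "((\<lambda>y. z y - z x) \<longlongrightarrow> 0) (at x)"
  proof (rule Lim_null_comparison)
    have "\<forall>\<^sub>F y in at x. y \<in> U" using open_U x by (rule eventually_at_in_open')
    moreover have "\<forall>\<^sub>F y in at x. k y < c / (2 * N)"
      using c(1) by (intro order_tendstoD(2)[OF k0]) (simp add: N_def)
    ultimately show "\<forall>\<^sub>F y in at x. norm (z y - z x) \<le> (2 * N / c) * (a y + norm (z x) * k y)"
      by eventually_elim (rule est)
    show "((\<lambda>y. (2 * N / c) * (a y + norm (z x) * k y)) \<longlongrightarrow> 0) (at x)"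
      by (intro tendsto_mult_right_zero tendsto_add_zero a0 k0)
  qed
  then show "isCont z x" by (simp add: isCont_def LIM_zero_iff)
qed

text \<open>Freezing the metric at \<open>x\<close>, the equation reads
  \<open>G x (z y) w = \<omega> y w - (G y - G x) (z y) w\<close>, whose right-hand side is differentiable at \<open>x\<close>
  because \<open>z\<close> is continuous there.\<close>

lemma solution_C1:
  assumes z: "\<And>x w. x \<in> U \<Longrightarrow> G x (z x) w = \<omega> x w"
    and \<omega>: "\<And>w. Ck_on 1 U (\<lambda>x. \<omega> x w)"
  shows "Ck_on 1 U z"
proof -
  have cz: "continuous_on U z"
    using z Ck_on_imp_continuous_on[OF \<omega>] by (rule solution_continuous)
  have d\<omega>: "((\<lambda>y. \<omega> y w) has_derivative fderiv (\<lambda>y. \<omega> y w) x) (at x)" if "x \<in> U" for x w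
    using Ck_on_has_derivative[of 0 U "\<lambda>y. \<omega> y w", OF _ that] \<omega> by simp
  have dz: "z differentiable (at x)" if x: "x \<in> U" for x
  proof -
    interpret inner_form "G x" using x by (rule inner_form)
    have izx: "isCont (\<lambda>y. z y \<bullet> b) x" for b
      using cz x open_U by (auto simp: continuous_on_eq_continuous_at intro!: continuous_intros)
    define \<rho> where "\<rho> w y = \<omega> y w - (\<Sum>b\<in>Basis. (z y \<bullet> b) * (G y b w - G x b w))" for w y
    have d\<rho>: "\<rho> w differentiable (at x)" for w
    proof -
      have "((\<lambda>y. (z y \<bullet> b) * (G y b w - G x b w)) has_derivative (\<lambda>h. (z x \<bullet> b) * (dG x h b w - 0))) (at x)" for b
        by (intro has_derivative_mult_zero izx has_derivative_diff has_derivative_G_const x has_derivative_const) simp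
      then have "((\<lambda>y. \<Sum>b\<in>Basis. (z y \<bullet> b) * (G y b w - G x b w)) has_derivative
          (\<lambda>h. \<Sum>b\<in>Basis. (z x \<bullet> b) * (dG x h b w - 0))) (at x)"
        by (intro has_derivative_sum)
      from has_derivative_diff[OF d\<omega>[OF x, of w] this]
      show ?thesis unfolding \<rho>_def[abs_def] differentiable_def by blast
    qed
    define n where "n = DIM('b)"
    obtain e where e: "orthonormal n e"
      using ex_orthonormal[of UNIV n] unfolding n_def by (metis dim_UNIV subspace_UNIV)
    have sp: "span (e ` {..<n}) = UNIV"
      using orthonormal_span[OF e, of UNIV] by (simp add: n_def)
    have eq: "(\<Sum>i<n. \<rho> (e i) y *\<^sub>R e i) = z y" if y: "y \<in> U" for y
    proof -
      have "\<rho> w y = G x (z y) w" for w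
      proof -
        have "G y (z y) w = (\<Sum>b\<in>Basis. (z y \<bullet> b) * G y b w)"
          by (rule bilinear_expand_left[OF bilinear_G[OF y]])
        moreover have "G x (z y) w = (\<Sum>b\<in>Basis. (z y \<bullet> b) * G x b w)"
          by (rule bilinear_expand_left[OF bilinear_G[OF x]])
        ultimately show ?thesis
          using z[OF y, of w] by (simp add: \<rho>_def right_diff_distrib sum_subtractf)
      qed
      then show ?thesis using orthonormal_expand[OF e, of "z y"] sp by simp
    qed
    have "(\<lambda>y. \<Sum>i<n. \<rho> (e i) y *\<^sub>R e i) differentiable (at x)"
      using d\<rho> by (intro differentiable_sum ballI differentiable_scaleR) auto
    then obtain D where "((\<lambda>y. \<Sum>i<n. \<rho> (e i) y *\<^sub>R e i) has_derivative D) (at x)"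
      unfolding differentiable_def by blast
    then have "(z has_derivative D) (at x)"
      by (rule has_derivative_transform_within_open[OF _ open_U x]) (rule eq)
    then show ?thesis by (rule differentiableI)
  qed
  \<comment> \<open>Differentiating \<open>G y (z y) w = \<omega> y w\<close> shows that the
    derivative of \<open>z\<close> in direction \<open>h\<close> solves a system of the same kind
    with continuous right-hand side.\<close>
  have "continuous_on U (\<lambda>x. fderiv z x h)" for h
  proof (rule solution_continuous)
    fix x w assume x: "x \<in> U"
    have "(z has_derivative fderiv z x) (at x)"
      using dz[OF x] frechet_derivative_works by blast
    from has_derivative_G[OF has_derivative_ident x this has_derivative_const[of w]]
    have "((\<lambda>y. G y (z y) w) has_derivative (\<lambda>h. dG x h (z x) w + G x (fderiv z x h) w)) (at x)"
      using bilinear_rzero[OF bilinear_G[OF x]] by simp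
    then have "((\<lambda>y. \<omega> y w) has_derivative (\<lambda>h. dG x h (z x) w + G x (fderiv z x h) w)) (at x)"
      by (rule has_derivative_transform_within_open[OF _ open_U x]) (rule z)
    from has_derivative_unique[OF this d\<omega>[OF x]]
    have "dG x h (z x) w + G x (fderiv z x h) w = fderiv (\<lambda>y. \<omega> y w) x h"
      by metis
    then show "G x (fderiv z x h) w =
        fderiv (\<lambda>y. \<omega> y w) x h - dG x h (z x) w" by simp
  next
    fix w
    have "continuous_on U (\<lambda>x. fderiv (\<lambda>y. \<omega> y w) x h)"
      using \<omega>[of w] by simp
    moreover have "continuous_on U (\<lambda>x. dG x h (z x) w)"
      by (rule continuous_on_form[OF subset_refl continuous_dG bilinear_dG cz continuous_on_const])
    ultimately show "continuous_on U (\<lambda>x. fderiv (\<lambda>y. \<omega> y w) x h - dG x h (z x) w)"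
      by (rule continuous_on_diff)
  qed
  then show ?thesis using dz by simp
qed

section \<open>The Levi-Civita connection, gradient and Hessian in coordinates\<close>

definition chr :: "'b \<Rightarrow> 'b \<Rightarrow> 'b \<Rightarrow> 'b" where
  "chr x u v = sharp x (\<lambda>w. (dG x u v w + dG x v u w - dG x w u v) / 2)"

text \<open>\<open>cov_deriv\<close> at all points of one fixed coordinate domain; the global
  version changes its chart from point to point and cannot be studied as a function of the point.
  The same holds for \<open>chr\<close> and \<open>hess\<close>.\<close>

definition cov :: "('b \<Rightarrow> 'b) \<Rightarrow> 'b \<Rightarrow> 'b \<Rightarrow> 'b" where
  "cov Y x u = fderiv Y x u + chr x u (Y x)"

definition grad :: "('b \<Rightarrow> real) \<Rightarrow> 'b \<Rightarrow> 'b" where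
  "grad F x = sharp x (fderiv F x)"

definition hess :: "('b \<Rightarrow> real) \<Rightarrow> 'b \<Rightarrow> 'b \<Rightarrow> 'b \<Rightarrow> real" where
  "hess F x u v = fderiv (\<lambda>y. fderiv F y u) x v -
     fderiv F x (chr x u v)"

lemmas dG_simps = bilinear_ladd[OF bilinear_dG] bilinear_radd[OF bilinear_dG]
  bilinear_lmul[OF bilinear_dG] bilinear_rmul[OF bilinear_dG]
  linear_add[OF linear_dG] linear_cmul[OF linear_dG]

lemma G_chr:
  assumes "x \<in> U"
  shows "G x (chr x u v) w = (dG x u v w + dG x v u w - dG x w u v) / 2"
  unfolding chr_def
  by (rule G_sharp[OF assms]) (auto intro!: linearI simp: dG_simps[OF assms] field_simps)

lemma chr_eqI:
  assumes "x \<in> U" "\<And>w. G x z w = (dG x u v w + dG x v u w - dG x w u v) / 2"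
  shows "chr x u v = z"
  unfolding chr_def by (rule sharp_eqI[OF assms])

lemma bilinear_chr: "x \<in> U \<Longrightarrow> bilinear (chr x)"
  unfolding bilinear_def
  by (auto intro!: linearI chr_eqI
      simp: bilinear_ladd[OF bilinear_G] bilinear_lmul[OF bilinear_G] G_chr dG_simps field_simps)

lemma chr_sym: "x \<in> U \<Longrightarrow> chr x u v = chr x v u"
  by (intro chr_eqI) (simp_all add: G_chr dG_sym[of x _ u v])

lemma continuous_chr:
  assumes "continuous_on U Y"
  shows "continuous_on U (\<lambda>x. chr x u (Y x))"
proof (rule solution_continuous)
  show "G x (chr x u (Y x)) w = (dG x u (Y x) w + dG x (Y x) u w - dG x w u (Y x)) / 2"
    if "x \<in> U" for x w using that by (rule G_chr)
  have "continuous_on U (\<lambda>x. \<Sum>b\<in>Basis. (Y x \<bullet> b) * dG x b u w)" for w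
    by (intro continuous_intros assms continuous_dG)
  then have "continuous_on U (\<lambda>x. dG x (Y x) u w)" for w
    by (rule continuous_on_eq) (rule linear_expand_Basis[OF linear_dG, unfolded real_scaleR_def, symmetric])
  moreover have "continuous_on U (\<lambda>x. dG x u (Y x) w)" for w
    by (rule continuous_on_form[OF subset_refl continuous_dG bilinear_dG assms continuous_on_const])
  moreover have "continuous_on U (\<lambda>x. dG x w u (Y x))" for w
    by (rule continuous_on_form[OF subset_refl continuous_dG bilinear_dG continuous_on_const assms])
  ultimately show "continuous_on U (\<lambda>x. (dG x u (Y x) w + dG x (Y x) u w - dG x w u (Y x)) / 2)" for w
    by (intro continuous_intros) auto
qed

lemma continuous_cov:
  assumes "Ck_on 1 U Y"
  shows "continuous_on U (\<lambda>x. cov Y x u)"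
  unfolding cov_def
  using assms Ck_on_imp_continuous_on[OF assms] by (intro continuous_on_add continuous_chr) auto

lemma linear_cov:
  assumes "x \<in> U" "Y differentiable (at x)"
  shows "linear (cov Y x)"
  using linear_frechet_derivative[OF assms(2)] bilinear_chr[OF assms(1)]
  unfolding cov_def[abs_def] bilinear_def by (intro linear_compose_add) auto

lemma cov_scaleR:
  assumes "x \<in> U" "\<psi> differentiable (at x)" "Y differentiable (at x)"
  shows "cov (\<lambda>y. \<psi> y *\<^sub>R Y y) x u = fderiv \<psi> x u *\<^sub>R Y x + \<psi> x *\<^sub>R cov Y x u"
proof -
  have "((\<lambda>y. \<psi> y *\<^sub>R Y y) has_derivative
      (\<lambda>h. \<psi> x *\<^sub>R fderiv Y x h + fderiv \<psi> x h *\<^sub>R Y x)) (at x)"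
    by (intro has_derivative_scaleR has_frechet_derivative assms)
  from frechet_derivative_at[OF this, symmetric]
  show ?thesis
    by (simp add: cov_def bilinear_rmul[OF bilinear_chr[OF assms(1)]] algebra_simps)
qed

lemma G_grad:
  assumes "x \<in> U" "F differentiable (at x)"
  shows "G x (grad F x) w = fderiv F x w"
  unfolding grad_def by (rule G_sharp[OF assms(1) linear_frechet_derivative[OF assms(2)]])

text \<open>The defining equation of the gradient has C^1 coefficients and the C^1 right-hand side
  \<open>fderiv F\<close>, so \<open>solution_C1\<close> applies. This is why
  \<open>\<psi> \<nabla>F\<close> is admissible in the first variation.\<close>

lemma grad_C1:
  assumes "Ck_on 2 U F"
  shows "Ck_on 1 U (grad F)"
  by (rule solution_C1[of _ "\<lambda>x. fderiv F x"])
    (use assms in \<open>auto simp: numeral_2_eq_2 intro!: G_grad\<close>)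

lemma bilinear_hess:
  assumes F: "Ck_on 2 U F" and x: "x \<in> U"
  shows "bilinear (hess F x)"
proof -
  have d: "linear (fderiv F y)" if "y \<in> U" for y
    using F that by (auto simp: numeral_2_eq_2 intro!: linear_frechet_derivative)
  have d2: "(\<lambda>y. fderiv F y u) differentiable (at x)" for u
    using F x by (auto simp: numeral_2_eq_2)
  let ?D = "\<lambda>u v. fderiv (\<lambda>y. fderiv F y u) x v"
  have 1: "linear (?D u)" for u using d2 by (rule linear_frechet_derivative)
  have s: "?D u v = ?D v u" for u v
    by (rule second_derivative_symmetric[OF open_U F x])
  have 2: "linear (\<lambda>u. ?D u v)" for v using 1[of v] by (subst s)
  have 3: "linear (\<lambda>v. fderiv F x (chr x u v))"
    "linear (\<lambda>u. fderiv F x (chr x u v))" for u v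
    using linear_compose[OF _ d[OF x]] bilinear_chr[OF x] unfolding bilinear_def o_def by blast+
  show ?thesis
    unfolding bilinear_def hess_def using linear_compose_sub[OF 1 3(1)] linear_compose_sub[OF 2 3(2)] by blast
qed

lemma hess_sym:
  assumes F: "Ck_on 2 U F" and x: "x \<in> U"
  shows "hess F x u v = hess F x v u"
  unfolding hess_def chr_sym[OF x, of u v]
  using second_derivative_symmetric[OF open_U F x] by simp

text \<open>Differentiate \<open>G y (grad F y) v = fderiv F y v\<close> in direction
  \<open>u\<close>. The derivative of the metric that appears is the sum of the Christoffel term of
  the gradient field and that of the Hessian, which is compatibility of the connection with the
  metric.\<close>

lemma G_cov_grad:
  assumes F: "Ck_on 2 U F" and x: "x \<in> U"
  shows "G x (cov (grad F) x u) v = hess F x u v"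
proof -
  let ?z = "grad F x"
  have d: "F differentiable (at y)" if "y \<in> U" for y
    using F that by (auto simp: numeral_2_eq_2)
  have "(grad F has_derivative fderiv (grad F) x) (at x)"
    using Ck_on_has_derivative[of 0] grad_C1[OF F] x by simp
  from has_derivative_G[OF has_derivative_ident x this has_derivative_const[of v]]
  have "((\<lambda>y. G y (grad F y) v) has_derivative (\<lambda>h. dG x h ?z v + G x (fderiv (grad F) x h) v)) (at x)"
    using bilinear_rzero[OF bilinear_G[OF x]] by simp
  then have "((\<lambda>y. fderiv F y v) has_derivative
      (\<lambda>h. dG x h ?z v + G x (fderiv (grad F) x h) v)) (at x)"
    by (rule has_derivative_transform_within_open[OF _ open_U x]) (rule G_grad[OF _ d])
  from frechet_derivative_at[OF this]
  have "fderiv (\<lambda>y. fderiv F y v) x u =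
      dG x u ?z v + G x (fderiv (grad F) x u) v" by (rule fun_cong[OF sym])
  then have 1: "G x (fderiv (grad F) x u) v =
      fderiv (\<lambda>y. fderiv F y u) x v - dG x u ?z v"
    using second_derivative_symmetric[OF open_U F x, of u v] by simp
  have "fderiv F x (chr x u v) = G x (chr x u v) ?z"
    using G_grad[OF x d[OF x]] G_sym[OF x] by metis
  then show ?thesis
    unfolding cov_def hess_def
    by (simp add: bilinear_ladd[OF bilinear_G[OF x]] 1 G_chr[OF x] dG_sym[OF x, of _ ?z] field_simps)
qed

lemma continuous_hess:
  assumes F: "Ck_on 2 U F"
  shows "continuous_on U (\<lambda>x. hess F x u v)"
proof -
  have "continuous_on U (\<lambda>x. G x (cov (grad F) x u) v)"
    by (rule continuous_on_form[OF subset_refl G_continuous bilinear_G])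
      (auto intro!: continuous_cov grad_C1[OF F])
  then show ?thesis
    by (rule continuous_on_eq) (rule G_cov_grad[OF F])
qed

end

text \<open>Product rule for the derivative of \<open>F\<close>, taken at the moving point
  \<open>\<psi> y\<close> and in the moving direction \<open>Z y\<close>, once more by expanding the
  direction in the basis.\<close>

lemma has_derivative_frechet_apply_compose:
  fixes F :: "'b::euclidean_space \<Rightarrow> 'c::real_normed_vector" and \<psi> :: "'d::real_normed_vector \<Rightarrow> 'b"
  assumes U: "open U" "Ck_on 2 U F" and V: "open V" "y \<in> V" "\<psi> ` V \<subseteq> U"
    and \<psi>: "(\<psi> has_derivative \<psi>') (at y)" and Z: "(Z has_derivative Z') (at y)"
  shows "((\<lambda>y. fderiv F (\<psi> y) (Z y)) has_derivative
    (\<lambda>h. fderiv (\<lambda>x. fderiv F x (Z y)) (\<psi> y) (\<psi>' h) +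
      fderiv F (\<psi> y) (Z' h))) (at y)"
proof -
  have py: "\<psi> z \<in> U" if "z \<in> V" for z using V(3) that by auto
  have l: "linear (fderiv F z)" if "z \<in> U" for z
    by (rule linear_frechet_derivative[OF Ck_on_2_differentiable(1)[OF U(2) that]])
  have d: "((\<lambda>y. fderiv F y b) has_derivative
      fderiv (\<lambda>y. fderiv F y b) (\<psi> y)) (at (\<psi> y))" for b
    by (intro has_frechet_derivative Ck_on_2_differentiable[OF U(2) py] V)
  have lin2: "fderiv (\<lambda>x. fderiv F x z) (\<psi> y) h =
     (\<Sum>b\<in>Basis. (z \<bullet> b) *\<^sub>R fderiv (\<lambda>y. fderiv F y b) (\<psi> y) h)" for z h
  proof -
    have "((\<lambda>x. \<Sum>b\<in>Basis. (z \<bullet> b) *\<^sub>R fderiv F x b) has_derivative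
      (\<lambda>h. \<Sum>b\<in>Basis. (z \<bullet> b) *\<^sub>R fderiv (\<lambda>y. fderiv F y b) (\<psi> y) h)) (at (\<psi> y))"
      by (intro has_derivative_sum has_derivative_scaleR_right d)
    then have "((\<lambda>x. fderiv F x z) has_derivative
      (\<lambda>h. \<Sum>b\<in>Basis. (z \<bullet> b) *\<^sub>R fderiv (\<lambda>y. fderiv F y b) (\<psi> y) h)) (at (\<psi> y))"
      by (rule has_derivative_transform_within_open[OF _ U(1) py[OF V(2)]])
        (rule linear_expand_Basis[OF l, symmetric])
    from frechet_derivative_at[OF this] show ?thesis by (rule fun_cong[OF sym])
  qed
  have "((\<lambda>y. \<Sum>b\<in>Basis. (Z y \<bullet> b) *\<^sub>R fderiv F (\<psi> y) b) has_derivative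
      (\<lambda>h. \<Sum>b\<in>Basis. (Z y \<bullet> b) *\<^sub>R fderiv (\<lambda>y. fderiv F y b) (\<psi> y) (\<psi>' h)
      + (Z' h \<bullet> b) *\<^sub>R fderiv F (\<psi> y) b)) (at y)" (is "(_ has_derivative ?D) _")
    by (intro has_derivative_sum has_derivative_scaleR has_derivative_inner_left Z has_derivative_compose[OF \<psi> d])
  then have "((\<lambda>y. fderiv F (\<psi> y) (Z y)) has_derivative ?D) (at y)"
    by (rule has_derivative_transform_within_open[OF _ V(1,2)]) (rule linear_expand_Basis[OF l[OF py], symmetric])
  moreover have "?D = (\<lambda>h. fderiv (\<lambda>x. fderiv F x (Z y)) (\<psi> y) (\<psi>' h) +
      fderiv F (\<psi> y) (Z' h))"
  proof
    fix h
    show "?D h = fderiv (\<lambda>x. fderiv F x (Z y)) (\<psi> y) (\<psi>' h) +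
        fderiv F (\<psi> y) (Z' h)"
      unfolding sum.distrib lin2[of "Z y" "\<psi>' h"]
      using linear_expand_Basis[OF l[OF py[OF V(2)]], of "Z' h"] by simp
  qed
  ultimately show ?thesis by simp
qed

lemma has_derivative_frechet_apply:
  fixes \<phi> :: "'b::euclidean_space \<Rightarrow> 'c::real_normed_vector"
  assumes "open V" "Ck_on 2 V \<phi>" "y \<in> V" "(Z has_derivative Z') (at y)"
  shows "((\<lambda>y. fderiv \<phi> y (Z y)) has_derivative
    (\<lambda>h. fderiv (\<lambda>z. fderiv \<phi> z (Z y)) y h +
      fderiv \<phi> y (Z' h))) (at y)"
  using has_derivative_frechet_apply_compose[OF assms(1,2,1,3) _ has_derivative_ident assms(4)] by simp

text \<open>The second derivative of the coordinate change enters the Christoffel symbols and the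
  derivative of the components of the field with opposite signs.\<close>

lemma cov_coordinate_change:
  fixes \<phi> :: "'b::euclidean_space \<Rightarrow> 'b"
  assumes GU: "chart_metric U G" and HV: "chart_metric V H"
    and \<phi>: "Ck_on 2 V \<phi>" "\<phi> ` V \<subseteq> U"
    and H: "\<And>y u v. y \<in> V \<Longrightarrow> H y u v = G (\<phi> y) (fderiv \<phi> y u) (fderiv \<phi> y v)"
    and Y: "Ck_on 1 U Y" and Z: "Ck_on 1 V Z"
    and YZ: "\<And>y. y \<in> V \<Longrightarrow> Y (\<phi> y) = fderiv \<phi> y (Z y)"
    and y: "y \<in> V" "surj (fderiv \<phi> y)"
  shows "chart_metric.cov G Y (\<phi> y) (fderiv \<phi> y u) =
    fderiv \<phi> y (chart_metric.cov H Z y u)"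
proof -
  interpret G: chart_metric U G by fact
  interpret H: chart_metric V H by fact
  define D where "D = fderiv \<phi> y"
  define D2 where "D2 u = fderiv (\<lambda>y. fderiv \<phi> y u) y" for u
  have py: "\<phi> y \<in> U" using \<phi>(2) y by auto
  interpret Gy: inner_form "G (\<phi> y)" using py by (rule G.inner_form)
  have d\<phi>: "(\<phi> has_derivative D) (at y)"
    unfolding D_def by (intro has_frechet_derivative Ck_on_2_differentiable[OF \<phi>(1) y(1)])
  have dZ: "(Z has_derivative fderiv Z y) (at y)"
    using Ck_on_has_derivative[of 0] Z y(1) by simp
  have dY: "(Y has_derivative fderiv Y (\<phi> y)) (at (\<phi> y))"
    using Ck_on_has_derivative[of 0] Y py by simp
  have dD: "((\<lambda>y. fderiv \<phi> y u) has_derivative D2 u) (at y)" for u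
    unfolding D2_def by (intro has_frechet_derivative Ck_on_2_differentiable[OF \<phi>(1) y(1)])
  have D2s: "D2 u v = D2 v u" for u v
    unfolding D2_def by (rule second_derivative_symmetric[OF H.open_U \<phi>(1) y(1)])
  have "((\<lambda>z. G (\<phi> z) (fderiv \<phi> z u) (fderiv \<phi> z v)) has_derivative
      (\<lambda>h. G.dG (\<phi> y) (D h) (D u) (D v) + G (\<phi> y) (D2 u h) (D v) + G (\<phi> y) (D u) (D2 v h))) (at y)" for u v
    using G.has_derivative_G[OF d\<phi> py dD dD] by (simp add: D_def)
  then have "((\<lambda>z. H z u v) has_derivative
      (\<lambda>h. G.dG (\<phi> y) (D h) (D u) (D v) + G (\<phi> y) (D2 u h) (D v) + G (\<phi> y) (D u) (D2 v h))) (at y)" for u v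
    by (rule has_derivative_transform_within_open[OF _ H.open_U y(1)]) (rule H[symmetric])
  then have dH: "H.dG y h u v = G.dG (\<phi> y) (D h) (D u) (D v) + G (\<phi> y) (D2 u h) (D v) + G (\<phi> y) (D u) (D2 v h)" for h u v
    by (rule fun_cong[OF has_derivative_unique[OF H.has_derivative_G_const[OF y(1)]]])
  \<comment> \<open>In the combination of three derivatives of \<open>H\<close> that defines the
    Christoffel symbol there are six terms with \<open>D2\<close>. Four cancel by symmetry of
    \<open>D2\<close>, and the other two are equal.\<close>
  have chr: "H y (H.chr y u v) w = G (\<phi> y) (G.chr (\<phi> y) (D u) (D v)) (D w) + G (\<phi> y) (D2 u v) (D w)" for u v w
    unfolding H.G_chr[OF y(1)] G.G_chr[OF py] dH
    by (simp add: Gy.sym[of "D _" "D2 _ _"] D2s[of w] D2s[of v u])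
  have "((\<lambda>z. Y (\<phi> z)) has_derivative (\<lambda>h. fderiv Y (\<phi> y) (D h))) (at y)"
    by (rule has_derivative_compose[OF d\<phi> dY])
  moreover have "((\<lambda>z. fderiv \<phi> z (Z z)) has_derivative
      (\<lambda>h. D2 (Z y) h + D (fderiv Z y h))) (at y)"
    using has_derivative_frechet_apply[OF H.open_U \<phi>(1) y(1) dZ] by (simp add: D_def D2_def)
  then have "((\<lambda>z. Y (\<phi> z)) has_derivative
      (\<lambda>h. D2 (Z y) h + D (fderiv Z y h))) (at y)"
    by (rule has_derivative_transform_within_open[OF _ H.open_U y(1)]) (rule YZ[symmetric])
  ultimately have dYD: "fderiv Y (\<phi> y) (D u) = D2 (Z y) u + D (fderiv Z y u)" for u
    using has_derivative_unique by metis
  have lD: "linear D" using d\<phi> by (rule has_derivative_linear)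
  show ?thesis unfolding D_def[symmetric]
  proof (rule Gy.G_right_eqI)
    fix w
    \<comment> \<open>Surjectivity is what allows a vector to be tested only against images under
      \<open>D\<close>, where the pulled-back metric \<open>H\<close> is available.\<close>
    obtain w' where w: "w = D w'" using y(2) unfolding D_def surj_def by blast
    have "G (\<phi> y) (G.cov Y (\<phi> y) (D u)) w =
      G (\<phi> y) (D (fderiv Z y u)) (D w') + H y (H.chr y u (Z y)) w'"
      unfolding G.cov_def dYD w chr using YZ[OF y(1)]
      by (simp add: D_def[symmetric] Gy.G_simps D2s[of "Z y"])
    also have "\<dots> = G (\<phi> y) (D (H.cov Z y u)) w"
      unfolding H.cov_def using H[OF y(1)] by (simp add: D_def[symmetric] linear_add[OF lD] Gy.G_simps w)
    finally show "G (\<phi> y) (G.cov Y (\<phi> y) (D u)) w = G (\<phi> y) (D (H.cov Z y u)) w" .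
  qed
qed

section \<open>Charts\<close>

lemma (in chart_metric) chart_metric_subset:
  "open V \<Longrightarrow> V \<subseteq> U \<Longrightarrow> chart_metric V G"
  by (rule chart_metric.intro) (auto intro: inner_form Ck_on_subset[OF C1] simp del: Ck_on.simps One_nat_def)

locale chart_map =
  fixes c :: "('a::t2_space, 'b::euclidean_space) chart"
  assumes topological_chart: "topological_chart c"
begin

lemma open_dom: "open (fst c)" and open_image: "open (chart_image c)"
  and homeo: "homeomorphism (fst c) (chart_image c) (snd c) (chart_inv c)"
  using topological_chart by (auto simp: topological_chart_def)

lemma chart_inv_chart [simp]: "p \<in> fst c \<Longrightarrow> chart_inv c (snd c p) = p"
  using homeo by (auto simp: homeomorphism_def)

lemma chart_chart_inv [simp]: "x \<in> chart_image c \<Longrightarrow> snd c (chart_inv c x) = x"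
  using homeo by (auto simp: homeomorphism_def)

lemma chart_in_image [simp]: "p \<in> fst c \<Longrightarrow> snd c p \<in> chart_image c"
  by (auto simp: chart_image_def)

lemma chart_inv_in_dom [simp]: "x \<in> chart_image c \<Longrightarrow> chart_inv c x \<in> fst c"
  using homeo by (auto simp: homeomorphism_def)

lemma continuous_chart: "continuous_on (fst c) (snd c)"
  and continuous_chart_inv: "continuous_on (chart_image c) (chart_inv c)"
  using homeo by (auto simp: homeomorphism_def)

lemma isCont_chart_inv: "x \<in> chart_image c \<Longrightarrow> isCont (chart_inv c) x"
  using continuous_chart_inv open_image by (simp add: continuous_on_eq_continuous_at)

lemma open_chart_image:
  assumes "open V" shows "open (snd c ` (fst c \<inter> V))"
proof -
  have "openin (top_of_set (chart_image c)) (snd c ` (fst c \<inter> V))"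
    by (rule homeomorphism_imp_open_map[OF homeo]) (use assms in \<open>simp add: openin_open_Int\<close>)
  then show ?thesis using open_image by (simp add: openin_open_eq)
qed

lemma image_subset: "snd c ` (fst c \<inter> V) \<subseteq> chart_image c"
  by (auto simp: chart_image_def)

lemma mem_image_iff: "x \<in> snd c ` (fst c \<inter> V) \<longleftrightarrow> x \<in> chart_image c \<and> chart_inv c x \<in> V"
  using chart_inv_chart chart_chart_inv chart_inv_in_dom image_subset[of V] by (force simp: image_iff)

end

section \<open>Coordinate changes and their derivatives\<close>

definition transition_deriv ::
  "('a, 'b::euclidean_space) chart \<Rightarrow> ('a, 'b) chart \<Rightarrow> 'b \<Rightarrow> 'b \<Rightarrow> 'b" where
  "transition_deriv c d x = fderiv (snd d \<circ> chart_inv c) x"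

text \<open>Common to two charts of the atlas, which are related smoothly, and to an atlas chart and
  a slice chart, which are related only by C^2 maps.\<close>

definition C2_compatible ::
  "('a::t2_space, 'b::euclidean_space) chart \<Rightarrow> ('a, 'b) chart \<Rightarrow> bool" where
  "C2_compatible c d \<longleftrightarrow> topological_chart c \<and> topological_chart d \<and>
     Ck_on 2 (snd c ` (fst c \<inter> fst d)) (snd d \<circ> chart_inv c) \<and>
     Ck_on 2 (snd d ` (fst c \<inter> fst d)) (snd c \<circ> chart_inv d)"

lemma C2_compatible_sym: "C2_compatible c d \<Longrightarrow> C2_compatible d c"
  by (auto simp: C2_compatible_def Int_commute)

lemma C2_compatible_differentiable:
  assumes "C2_compatible c d" "p \<in> fst c" "p \<in> fst d"
  shows "(snd d \<circ> chart_inv c) differentiable (at (snd c p))"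
  using assms Ck_on_2_differentiable(1)[of "snd c ` (fst c \<inter> fst d)" "snd d \<circ> chart_inv c" "snd c p"]
  by (auto simp: C2_compatible_def)

lemma linear_transition_deriv:
  assumes "C2_compatible c d" "p \<in> fst c" "p \<in> fst d"
  shows "linear (transition_deriv c d (snd c p))"
  unfolding transition_deriv_def
  by (rule linear_frechet_derivative[OF C2_compatible_differentiable[OF assms]])

lemma has_derivative_transition:
  assumes "C2_compatible c d" "p \<in> fst c" "p \<in> fst d"
  shows "((snd d \<circ> chart_inv c) has_derivative transition_deriv c d (snd c p)) (at (snd c p))"
  unfolding transition_deriv_def
  by (rule has_frechet_derivative[OF C2_compatible_differentiable[OF assms]])

text \<open>Chain rule on the overlap. Since \<open>to_chart\<close> and \<open>from_chart\<close>
  are transition derivatives from and to the chosen chart at the point, their calculus consists of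
  special cases.\<close>

lemma transition_deriv_cocycle:
  assumes cd: "C2_compatible c d" and de: "C2_compatible d e"
    and p: "p \<in> fst c" "p \<in> fst d" "p \<in> fst e"
  shows "transition_deriv d e (snd d p) (transition_deriv c d (snd c p) v) = transition_deriv c e (snd c p) v"
proof -
  interpret c: chart_map c using cd by unfold_locales (simp add: C2_compatible_def)
  interpret d: chart_map d using cd by unfold_locales (simp add: C2_compatible_def)
  have 1: "((snd d \<circ> chart_inv c) has_derivative transition_deriv c d (snd c p)) (at (snd c p))"
    by (rule has_derivative_transition[OF cd p(1,2)])
  have 2: "((snd e \<circ> chart_inv d) has_derivative transition_deriv d e (snd d p)) (at ((snd d \<circ> chart_inv c) (snd c p)))"
    using has_derivative_transition[OF de p(2,3)] p by simp
  have "((\<lambda>x. (snd e \<circ> chart_inv d) ((snd d \<circ> chart_inv c) x)) has_derivative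
      (\<lambda>v. transition_deriv d e (snd d p) (transition_deriv c d (snd c p) v))) (at (snd c p))"
    by (rule has_derivative_compose[OF 1 2])
  then have "((snd e \<circ> chart_inv c) has_derivative
      (\<lambda>v. transition_deriv d e (snd d p) (transition_deriv c d (snd c p) v))) (at (snd c p))"
  proof (rule has_derivative_transform_within_open)
    show "open (snd c ` (fst c \<inter> fst d))" by (rule c.open_chart_image[OF d.open_dom])
    show "snd c p \<in> snd c ` (fst c \<inter> fst d)" using p by simp
  qed auto
  from frechet_derivative_at[OF this] show ?thesis unfolding transition_deriv_def by metis
qed

lemma transition_deriv_self:
  fixes c :: "('a::t2_space, 'b::euclidean_space) chart"
  assumes "topological_chart c" "p \<in> fst c"
  shows "transition_deriv c c (snd c p) v = v"
proof -
  interpret c: chart_map c using assms by unfold_locales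
  have "((\<lambda>x. x) has_derivative (\<lambda>x. x)) (at (snd c p))" by (rule has_derivative_ident)
  then have "((snd c \<circ> chart_inv c) has_derivative (\<lambda>x. x)) (at (snd c p))"
    by (rule has_derivative_transform_within_open[OF _ c.open_image]) (use assms in auto)
  from frechet_derivative_at[OF this] show ?thesis unfolding transition_deriv_def by metis
qed

lemma transition_deriv_inverse:
  assumes "C2_compatible c d" "p \<in> fst c" "p \<in> fst d"
  shows "transition_deriv d c (snd d p) (transition_deriv c d (snd c p) v) = v"
  using transition_deriv_cocycle[OF assms(1) C2_compatible_sym[OF assms(1)] assms(2,3,2)]
    transition_deriv_self[of c p v] assms by (simp add: C2_compatible_def)

lemma Ck_on_transition:
  assumes "C2_compatible c d"
  shows "Ck_on 2 (snd c ` (fst c \<inter> fst d)) (snd d \<circ> chart_inv c)"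
  using assms by (simp add: C2_compatible_def)

section \<open>Geometric objects of the manifold, read in a chart\<close>

locale riemannian_atlas =
  fixes A :: "('a::{t2_space, second_countable_topology}, 'b::euclidean_space) chart set"
    and g :: "'a \<Rightarrow> 'b \<Rightarrow> 'b \<Rightarrow> real"
  assumes atlas: "smooth_atlas A" and metric: "C1_metric A g"
begin

lemma atlas_chart: "c \<in> A \<Longrightarrow> topological_chart c"
  using atlas by (simp add: smooth_atlas_def)

lemma atlas_compatible:
  assumes "c \<in> A" "d \<in> A" shows "C2_compatible c d"
proof -
  have "Ck_on 2 (snd c ` (fst c \<inter> fst d)) (snd d \<circ> chart_inv c)"
    "Ck_on 2 (snd d ` (fst d \<inter> fst c)) (snd c \<circ> chart_inv d)"
    using atlas assms unfolding smooth_atlas_def smooth_on_def by blast+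
  then show ?thesis
    using atlas_chart assms by (simp add: C2_compatible_def Int_commute del: Ck_on.simps)
qed

lemma C2_chart_compatible: "C2_chart A d \<Longrightarrow> c \<in> A \<Longrightarrow> C2_compatible c d"
  using atlas_chart by (auto simp: C2_chart_def C2_compatible_def)

lemma chart_at: "chart_at A p \<in> A" "p \<in> fst (chart_at A p)"
proof -
  have "p \<in> (\<Union>c\<in>A. fst c)" using atlas by (simp add: smooth_atlas_def)
  then have "\<exists>c. c \<in> A \<and> p \<in> fst c" by blast
  from someI_ex[OF this] show "chart_at A p \<in> A" "p \<in> fst (chart_at A p)"
    unfolding chart_at_def by blast+
qed

abbreviation pt :: "'a \<Rightarrow> 'b" where "pt p \<equiv> snd (chart_at A p) p"

lemma to_chart_eq: "to_chart A c p = transition_deriv (chart_at A p) c (pt p)"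
  by (simp add: to_chart_def transition_deriv_def)

lemma from_chart_eq: "from_chart A c p = transition_deriv c (chart_at A p) (snd c p)"
  by (simp add: from_chart_def transition_deriv_def)

lemma to_from_chart [simp]: "c \<in> A \<Longrightarrow> p \<in> fst c \<Longrightarrow> to_chart A c p (from_chart A c p v) = v"
  unfolding to_chart_eq from_chart_eq by (rule transition_deriv_inverse[OF atlas_compatible]) (auto simp: chart_at)

lemma from_to_chart [simp]: "c \<in> A \<Longrightarrow> p \<in> fst c \<Longrightarrow> from_chart A c p (to_chart A c p v) = v"
  unfolding to_chart_eq from_chart_eq by (rule transition_deriv_inverse[OF atlas_compatible]) (auto simp: chart_at)

lemma linear_to_chart: "c \<in> A \<Longrightarrow> p \<in> fst c \<Longrightarrow> linear (to_chart A c p)"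
  unfolding to_chart_eq by (rule linear_transition_deriv[OF atlas_compatible]) (auto simp: chart_at)

lemma linear_from_chart: "c \<in> A \<Longrightarrow> p \<in> fst c \<Longrightarrow> linear (from_chart A c p)"
  unfolding from_chart_eq by (rule linear_transition_deriv[OF atlas_compatible]) (auto simp: chart_at)

lemma to_chart_at [simp]: "to_chart A (chart_at A p) p v = v"
  unfolding to_chart_eq by (rule transition_deriv_self) (auto simp: chart_at atlas_chart)

lemma from_chart_at [simp]: "from_chart A (chart_at A p) p v = v"
  unfolding from_chart_eq by (rule transition_deriv_self) (auto simp: chart_at atlas_chart)

lemma transition_to_chart:
  assumes "c \<in> A" "d \<in> A" "p \<in> fst c" "p \<in> fst d"
  shows "transition_deriv c d (snd c p) (to_chart A c p v) = to_chart A d p v"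
  unfolding to_chart_eq
  by (rule transition_deriv_cocycle) (use assms in \<open>auto simp: chart_at intro!: atlas_compatible\<close>)

lemma from_chart_transition:
  assumes "c \<in> A" "d \<in> A" "p \<in> fst c" "p \<in> fst d"
  shows "from_chart A d p (transition_deriv c d (snd c p) v) = from_chart A c p v"
  unfolding from_chart_eq
  by (rule transition_deriv_cocycle) (use assms in \<open>auto simp: chart_at intro!: atlas_compatible\<close>)

lemma inner_form_metric: "inner_form (g p)"
  using metric unfolding C1_metric_def by unfold_locales blast+

abbreviation mc :: "('a, 'b) chart \<Rightarrow> 'b \<Rightarrow> 'b \<Rightarrow> 'b \<Rightarrow> real" where "mc \<equiv> metric_in_chart A g"

lemma metric_in_chart_eq:
  assumes "c \<in> A" "p \<in> fst c"
  shows "mc c (snd c p) u v = g p (from_chart A c p u) (from_chart A c p v)"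
proof -
  interpret c: chart_map c using assms atlas_chart by unfold_locales auto
  show ?thesis using assms by (simp add: metric_in_chart_def Let_def)
qed

lemma metric_to_chart:
  assumes "c \<in> A" "p \<in> fst c"
  shows "mc c (snd c p) (to_chart A c p u) (to_chart A c p v) = g p u v"
  using assms by (simp add: metric_in_chart_eq)

lemma metric_chart_at [simp]: "mc (chart_at A p) (pt p) = g p"
  using chart_at by (intro ext) (simp add: metric_in_chart_eq)

lemma chart_metric_chart:
  assumes c: "c \<in> A" shows "chart_metric (chart_image c) (mc c)"
proof (rule chart_metric.intro)
  interpret c: chart_map c using assms atlas_chart by unfold_locales auto
  show "open (chart_image c)" by (rule c.open_image)
  show "Ck_on 1 (chart_image c) (\<lambda>x. mc c x u v)" for u v
    using metric c unfolding C1_metric_def by blast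
  show "inner_form (mc c x)" if "x \<in> chart_image c" for x
  proof -
    define p where "p = chart_inv c x"
    have p: "p \<in> fst c" "snd c p = x" using that by (auto simp: p_def)
    interpret inner_form "g p" by (rule inner_form_metric)
    note l = linear_from_chart[OF c p(1)]
    have eq: "mc c x u v = g p (from_chart A c p u) (from_chart A c p v)" for u v
      using metric_in_chart_eq[OF c p(1)] p(2) by simp
    show ?thesis
    proof
      show "bilinear (mc c x)"
        unfolding bilinear_def eq
        by (auto intro!: linearI simp: linear_add[OF l] linear_cmul[OF l] G_simps)
      show "mc c x u v = mc c x v u" for u v unfolding eq by (rule sym)
      fix u :: 'b assume "u \<noteq> 0"
      then have "from_chart A c p u \<noteq> 0"
        using to_from_chart[OF c p(1), of u] linear_0[OF linear_to_chart[OF c p(1)]] by metis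
      then show "mc c x u u > 0" unfolding eq by (rule pos)
    qed
  qed
qed

lemma field_in_chart_eq:
  assumes "c \<in> A" "p \<in> fst c"
  shows "field_in_chart A c X (snd c p) = to_chart A c p (X p)"
proof -
  interpret c: chart_map c using assms atlas_chart by unfold_locales auto
  show ?thesis using assms by (simp add: field_in_chart_def)
qed

abbreviation covc :: "('a, 'b) chart \<Rightarrow> ('b \<Rightarrow> 'b) \<Rightarrow> 'b \<Rightarrow> 'b \<Rightarrow> 'b" where
  "covc c \<equiv> chart_metric.cov (mc c)"

lemma christoffel_eq: "christoffel A g p u v = chart_metric.chr (mc (chart_at A p)) (pt p) u v"
proof -
  interpret chart_metric "chart_image (chart_at A p)" "mc (chart_at A p)"
    by (rule chart_metric_chart) (rule chart_at)
  show ?thesis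
    unfolding christoffel_def chr_def sharp_def metric_deriv_def dG_def metric_chart_at ..
qed

lemma cov_deriv_eq:
  "cov_deriv A g X p u = covc (chart_at A p) (field_in_chart A (chart_at A p) X) (pt p) u"
proof -
  interpret chart_metric "chart_image (chart_at A p)" "mc (chart_at A p)"
    by (rule chart_metric_chart) (rule chart_at)
  show ?thesis
    unfolding cov_deriv_def cov_def christoffel_eq
    using chart_at by (simp add: field_in_chart_eq)
qed

lemma hessian_eq:
  "hessian A g f p u v = chart_metric.hess (mc (chart_at A p)) (f \<circ> chart_inv (chart_at A p)) (pt p) u v"
proof -
  interpret chart_metric "chart_image (chart_at A p)" "mc (chart_at A p)"
    by (rule chart_metric_chart) (rule chart_at)
  show ?thesis unfolding hessian_def hess_def christoffel_eq fun_deriv_def ..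
qed

text \<open>The global covariant derivative is computed in the chart chosen at \<open>p\<close>.
  Coordinate invariance moves it to one fixed chart, where it depends on the point in a controlled
  way.\<close>

lemma cov_deriv_in_chart:
  assumes c: "c \<in> A" "p \<in> fst c" and X: "C1_vectorfield A X"
  shows "covc c (field_in_chart A c X) (snd c p) (to_chart A c p u) = to_chart A c p (cov_deriv A g X p u)"
proof -
  define d where "d = chart_at A p"
  have d: "d \<in> A" "p \<in> fst d" unfolding d_def by (rule chart_at)+
  interpret c: chart_map c using assms atlas_chart by unfold_locales auto
  interpret d: chart_map d using d atlas_chart by unfold_locales auto
  interpret mc: chart_metric "chart_image c" "mc c" using c by (intro chart_metric_chart)
  interpret md: chart_metric "chart_image d" "mc d" using d by (intro chart_metric_chart)
  define V where "V = snd d ` (fst d \<inter> fst c)"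
  define \<phi> where "\<phi> = snd c \<circ> chart_inv d"
  have comp: "C2_compatible d c" using d c by (intro atlas_compatible)
  have V: "open V" "V \<subseteq> chart_image d"
    unfolding V_def by (auto intro!: d.open_chart_image c.open_dom)
  have dp: "snd d p \<in> V" using c d by (auto simp: V_def)
  have T: "fderiv \<phi> (snd d q) = transition_deriv d c (snd d q)" for q
    by (simp add: \<phi>_def transition_deriv_def)
  have "chart_metric.cov (mc c) (field_in_chart A c X) (\<phi> (snd d p)) (fderiv \<phi> (snd d p) u) =
    fderiv \<phi> (snd d p) (chart_metric.cov (mc d) (field_in_chart A d X) (snd d p) u)"
  proof (rule cov_coordinate_change[where U = "chart_image c" and V = V])
    show "chart_metric (chart_image c) (mc c)" by unfold_locales
    show "chart_metric V (mc d)" by (rule md.chart_metric_subset[OF V])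
    show "Ck_on 2 V \<phi>" unfolding V_def \<phi>_def by (rule Ck_on_transition[OF comp])
    show "\<phi> ` V \<subseteq> chart_image c" by (auto simp: \<phi>_def V_def)
    show "Ck_on 1 (chart_image c) (field_in_chart A c X)"
      using X c unfolding C1_vectorfield_def by blast
    show "Ck_on 1 V (field_in_chart A d X)"
      using X d V(2) unfolding C1_vectorfield_def by (meson Ck_on_subset)
    fix y assume "y \<in> V"
    then obtain q where q: "q \<in> fst d" "q \<in> fst c" "y = snd d q" by (auto simp: V_def)
    have \<phi>y: "\<phi> y = snd c q" using q by (simp add: \<phi>_def)
    show "mc d y u v = mc c (\<phi> y) (fderiv \<phi> y u) (fderiv \<phi> y v)" for u v
      unfolding q(3) T \<phi>y[unfolded q(3)] using q c d by (simp add: metric_in_chart_eq from_chart_transition)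
    show "field_in_chart A c X (\<phi> y) = fderiv \<phi> y (field_in_chart A d X y)"
      unfolding q(3) T \<phi>y[unfolded q(3)] using q c d by (simp add: field_in_chart_eq transition_to_chart)
  next
    show "snd d p \<in> V" by (rule dp)
    show "surj (fderiv \<phi> (snd d p))"
      unfolding T by (rule surjI) (rule transition_deriv_inverse[OF C2_compatible_sym[OF comp] c(2) d(2)])
  qed
  moreover have "\<phi> (snd d p) = snd c p" using d by (simp add: \<phi>_def)
  moreover have "fderiv \<phi> (snd d p) = to_chart A c p"
    using T[of p] unfolding d_def to_chart_eq by auto
  ultimately show ?thesis by (simp add: cov_deriv_eq d_def)
qed

text \<open>Serves to show that the divergence of a test field vanishes off the support of the
  field; the Christoffel term vanishes together with the value of the field at
  \<open>p\<close>.\<close>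

lemma cov_deriv_local_zero:
  assumes V: "open V" "p \<in> V" "\<And>q. q \<in> V \<Longrightarrow> X q = 0"
  shows "cov_deriv A g X p u = 0"
proof -
  define d where "d = chart_at A p"
  have d: "d \<in> A" "p \<in> fst d" unfolding d_def by (rule chart_at)+
  interpret d: chart_map d using d atlas_chart by unfold_locales auto
  interpret md: chart_metric "chart_image d" "mc d" using d by (intro chart_metric_chart)
  have z: "field_in_chart A d X x = 0" if "x \<in> snd d ` (fst d \<inter> V)" for x
    using that V(3) d(1) by (auto simp: field_in_chart_eq linear_0[OF linear_to_chart])
  have "((\<lambda>x. 0) has_derivative (\<lambda>h. 0)) (at (snd d p))" by simp
  then have "(field_in_chart A d X has_derivative (\<lambda>h. 0)) (at (snd d p))"
    by (rule has_derivative_transform_within_open[OF _ d.open_chart_image[OF V(1)]]) (use z d V in auto)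
  from frechet_derivative_at[OF this]
  have "fderiv (field_in_chart A d X) (snd d p) u = 0" by metis
  moreover have "field_in_chart A d X (snd d p) = 0" using z d V by auto
  ultimately show ?thesis
    unfolding cov_deriv_eq d_def[symmetric] md.cov_def
    using bilinear_rzero[OF md.bilinear_chr] d by simp
qed

section \<open>Extending fields from a chart by zero\<close>

definition extend_field :: "('a, 'b) chart \<Rightarrow> ('b \<Rightarrow> 'b) \<Rightarrow> 'a \<Rightarrow> 'b" where
  "extend_field c Y q = (if q \<in> fst c then from_chart A c q (Y (snd c q)) else 0)"

lemma extend_field_in_chart:
  assumes "c \<in> A" "x \<in> chart_image c"
  shows "field_in_chart A c (extend_field c Y) x = Y x"
proof -
  interpret c: chart_map c using assms atlas_chart by unfold_locales auto
  show ?thesis using assms by (simp add: field_in_chart_def extend_field_def)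
qed

lemma extend_field_zero:
  assumes c: "c \<in> A" and Y: "\<And>x. x \<in> chart_image c \<Longrightarrow> x \<notin> K \<Longrightarrow> Y x = 0" and p: "p \<notin> chart_inv c ` K"
  shows "extend_field c Y p = 0"
proof (cases "p \<in> fst c")
  case True
  interpret c: chart_map c using assms atlas_chart by unfold_locales auto
  have "snd c p \<notin> K" using p True by (metis c.chart_inv_chart imageI)
  then show ?thesis using True Y linear_0[OF linear_from_chart[OF c True]] by (simp add: extend_field_def)
qed (simp add: extend_field_def)

lemma compact_chart_inv_image:
  assumes c: "c \<in> A" and K: "compact K" "K \<subseteq> chart_image c"
  shows "compact (chart_inv c ` K)"
proof -
  interpret c: chart_map c using assms atlas_chart by unfold_locales auto
  show ?thesis
    by (rule compact_continuous_image[OF continuous_on_subset[OF c.continuous_chart_inv K(2)] K(1)])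
qed

text \<open>The critical points are those outside the domain of \<open>c\<close>. The image of the
  compact set \<open>K\<close> is closed because the manifold is Hausdorff, so such a point has a
  neighbourhood on which the field is zero. Inside the domain the coordinate change costs one
  derivative, which its class C^2 affords.\<close>

lemma extend_field_C1:
  assumes c: "c \<in> A" and K: "compact K" "K \<subseteq> chart_image c"
    and Y: "Ck_on 1 (chart_image c) Y" "\<And>x. x \<in> chart_image c \<Longrightarrow> x \<notin> K \<Longrightarrow> Y x = 0"
  shows "C1_vectorfield A (extend_field c Y)"
  unfolding C1_vectorfield_def
proof (intro ballI Ck_on_locally)
  fix d y assume d: "d \<in> A" and y: "y \<in> chart_image d"
  interpret c: chart_map c using assms atlas_chart by unfold_locales auto
  interpret d: chart_map d using d atlas_chart by unfold_locales auto
  have comp: "C2_compatible c d" using d c by (intro atlas_compatible)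
  define q where "q = chart_inv d y"
  have q: "q \<in> fst d" "snd d q = y" using y by (auto simp: q_def)
  show "\<exists>T. open T \<and> y \<in> T \<and> Ck_on 1 T (field_in_chart A d (extend_field c Y))"
  proof (cases "q \<in> fst c")
    case True
    define V where "V = snd d ` (fst d \<inter> fst c)"
    define W where "W = snd c ` (fst c \<inter> fst d)"
    have V: "open V" unfolding V_def by (rule d.open_chart_image[OF c.open_dom])
    have W: "open W" "W \<subseteq> chart_image c" unfolding W_def
      using c.open_chart_image[OF d.open_dom] c.image_subset by auto
    have 1: "Ck_on 1 W (\<lambda>x. fderiv (snd d \<circ> chart_inv c) x (Y x))"
      using Ck_on_transition[OF comp] Ck_on_subset[OF Y(1) W(2)] unfolding W_def[symmetric]
      by (intro Ck_on_frechet_derivative_apply[OF W(1)]) (simp_all add: numeral_2_eq_2 del: Ck_on.simps)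
    have 2: "Ck_on 1 V (snd c \<circ> chart_inv d)"
      unfolding V_def using Ck_on_transition[OF C2_compatible_sym[OF comp]]
      by (rule Ck_on_antimono) simp
    have "Ck_on 1 V (\<lambda>y. fderiv (snd d \<circ> chart_inv c) ((snd c \<circ> chart_inv d) y) (Y ((snd c \<circ> chart_inv d) y)))"
      by (rule Ck_on_compose[OF V _ 1 2]) (auto simp: V_def W_def)
    then have "Ck_on 1 V (field_in_chart A d (extend_field c Y))"
    proof (rule Ck_on_cong[OF V, rotated])
      fix z assume "z \<in> V"
      then obtain r where r: "r \<in> fst d" "r \<in> fst c" "z = snd d r" by (auto simp: V_def)
      have "to_chart A d r (from_chart A c r w) = transition_deriv c d (snd c r) w" for w
        using transition_to_chart[OF c d r(2,1), of "from_chart A c r w"] r c by simp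
      then show "fderiv (snd d \<circ> chart_inv c) ((snd c \<circ> chart_inv d) z) (Y ((snd c \<circ> chart_inv d) z)) =
          field_in_chart A d (extend_field c Y) z"
        using r d by (simp add: field_in_chart_eq extend_field_def transition_deriv_def)
    qed
    moreover have "y \<in> V" using q True by (auto simp: V_def)
    ultimately show ?thesis using V by blast
  next
    case False
    define V where "V = snd d ` (fst d \<inter> - chart_inv c ` K)"
    have "closed (chart_inv c ` K)" by (intro compact_imp_closed compact_chart_inv_image c K)
    then have V: "open V" unfolding V_def by (intro d.open_chart_image open_Compl)
    have "Ck_on 1 V (\<lambda>_. 0 :: 'b)" by (rule Ck_on_const)
    then have "Ck_on 1 V (field_in_chart A d (extend_field c Y))"
    proof (rule Ck_on_cong[OF V, rotated])
      fix z assume "z \<in> V"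
      then obtain r where r: "r \<in> fst d" "r \<notin> chart_inv c ` K" "z = snd d r" by (auto simp: V_def)
      show "0 = field_in_chart A d (extend_field c Y) z"
        using r d extend_field_zero[OF c Y(2) r(2)] by (simp add: field_in_chart_eq linear_0[OF linear_to_chart])
    qed
    moreover have "q \<notin> chart_inv c ` K" using False K(2) by auto
    then have "y \<in> V" using q unfolding V_def by blast
    ultimately show ?thesis using V by blast
  qed
qed

lemma extend_field_test_field:
  assumes c: "c \<in> A" and K: "compact K" "K \<subseteq> chart_image c"
    and Y: "Ck_on 1 (chart_image c) Y" "\<And>x. x \<in> chart_image c \<Longrightarrow> x \<notin> K \<Longrightarrow> Y x = 0"
  shows "extend_field c Y \<in> test_fields A UNIV"
proof -
  have K': "compact (chart_inv c ` K)" by (intro compact_chart_inv_image c K)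
  have "p \<in> chart_inv c ` K" if "extend_field c Y p \<noteq> 0" for p
    using extend_field_zero[OF c, of K Y p] Y(2) that by blast
  then have "{p. extend_field c Y p \<noteq> 0} \<subseteq> chart_inv c ` K" by blast
  then have "closure {p. extend_field c Y p \<noteq> 0} \<subseteq> chart_inv c ` K"
    using K' by (intro closure_minimal compact_imp_closed)
  then have "compact (closure {p. extend_field c Y p \<noteq> 0})"
    using compact_Int_closed[OF K', of "closure {p. extend_field c Y p \<noteq> 0}"] by (simp add: Int_absorb1)
  then show ?thesis using extend_field_C1[OF assms] by (simp add: test_fields_def)
qed

lemma fun_deriv_eq_grad:
  assumes "C2_function A f"
  shows "fun_deriv A f p u = g p (chart_metric.grad (mc (chart_at A p)) (f \<circ> chart_inv (chart_at A p)) (pt p)) u"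
proof -
  define d where "d = chart_at A p"
  have d: "d \<in> A" "p \<in> fst d" unfolding d_def by (rule chart_at)+
  interpret d: chart_map d using d atlas_chart by unfold_locales auto
  interpret md: chart_metric "chart_image d" "mc d" using d by (intro chart_metric_chart)
  have "Ck_on 2 (chart_image d) (f \<circ> chart_inv d)" using assms d by (auto simp: C2_function_def)
  from md.G_grad[OF _ Ck_on_2_differentiable(1)[OF this], of "snd d p" u] d
  show ?thesis unfolding fun_deriv_def d_def[symmetric]
    using metric_chart_at[of p, folded d_def] by simp
qed

text \<open>The supremum defining the dual norm needs to be bounded for this inequality; it is attained
  at the normalized gradient.\<close>

lemma gradient_norm_le:
  assumes f: "\<And>u. fun_deriv A f p u = g p z u"
  shows "sqrt (g p z z) \<le> fun_deriv_norm A g f p"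
proof -
  interpret inner_form "g p" by (rule inner_form_metric)
  have bdd: "bdd_above ((\<lambda>u. \<bar>fun_deriv A f p u\<bar>) ` {u. gnorm g p u \<le> 1})"
  proof (rule bdd_aboveI2)
    fix u assume "u \<in> {u. gnorm g p u \<le> 1}"
    then have "sqrt (g p z z) * sqrt (g p u u) \<le> sqrt (g p z z) * 1"
      using G_nonneg by (intro mult_left_mono) (auto simp: gnorm_def)
    then show "\<bar>fun_deriv A f p u\<bar> \<le> sqrt (g p z z)"
      using cauchy_schwarz[of z u] unfolding f by simp
  qed
  define s where "s = sqrt (g p z z)"
  have s: "s * s = g p z z" using G_nonneg by (simp add: s_def)
  \<comment> \<open>For \<open>s = 0\<close> the scaled vector is 0 because
    \<open>inverse 0 = 0\<close>, so the case of vanishing gradient needs no other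
    competitor.\<close>
  have "gnorm g p (z /\<^sub>R s) \<le> 1"
    unfolding gnorm_def G_simps s[symmetric] by (cases "s = 0") (auto simp: field_simps)
  then have "\<bar>fun_deriv A f p (z /\<^sub>R s)\<bar> \<le> fun_deriv_norm A g f p"
    unfolding fun_deriv_norm_def by (intro cSUP_upper bdd) simp
  moreover have "fun_deriv A f p (z /\<^sub>R s) = s"
    unfolding f G_simps s[symmetric] by (cases "s = 0") (auto simp: field_simps)
  ultimately show ?thesis by (simp add: s_def)
qed

end

section \<open>Submanifolds\<close>

text \<open>The square of the positive part: of class C^1, zero on the negative axis and
  nondecreasing. Written as a product so that \<open>has_derivative_mult_zero\<close> handles the
  point 0, where \<open>max 0\<close> is only continuous.\<close>

definition pos_sq :: "real \<Rightarrow> real" where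
  "pos_sq t = max 0 t * t"

lemma has_derivative_pos_sq: "(pos_sq has_derivative (\<lambda>h. 2 * max 0 t * h)) (at t)"
proof (cases t "0 :: real" rule: linorder_cases)
  case less
  have "((\<lambda>t. 0) has_derivative (\<lambda>h. 0)) (at t)" by simp
  then have "(pos_sq has_derivative (\<lambda>h. 0)) (at t)"
    by (rule has_derivative_transform_within_open[of _ _ _ _ "{..<0}"]) (use less in \<open>auto simp: pos_sq_def\<close>)
  then show ?thesis using less by simp
next
  case equal
  have "isCont (\<lambda>t. max 0 t) (0 :: real)" by (intro continuous_intros)
  from has_derivative_mult_zero[OF this has_derivative_ident]
  show ?thesis using equal by (simp add: pos_sq_def[abs_def])
next
  case greater
  have "((\<lambda>t. t * t) has_derivative (\<lambda>h. t * h + h * t)) (at t)"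
    by (intro has_derivative_mult has_derivative_ident)
  then have "(pos_sq has_derivative (\<lambda>h. t * h + h * t)) (at t)"
    by (rule has_derivative_transform_within_open[of _ _ _ _ "{0<..}"]) (use greater in \<open>auto simp: pos_sq_def\<close>)
  then show ?thesis using greater by (simp add: algebra_simps)
qed

lemma Ck_on_pos_sq: "Ck_on 1 UNIV pos_sq"
  unfolding One_nat_def
proof (rule Ck_on_SucI)
  show "Ck_on 0 UNIV (\<lambda>t. 2 * max 0 t * v)" for v :: real
    by (auto intro!: continuous_intros)
qed (auto intro: has_derivative_pos_sq)

lemma pos_sq_nonneg: "pos_sq t \<ge> 0" and pos_sq_zero: "t \<le> 0 \<Longrightarrow> pos_sq t = 0"
  and pos_sq_pos: "t > 0 \<Longrightarrow> pos_sq t > 0"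
  by (auto simp: pos_sq_def max_def)

lemma ex_bump:
  fixes x0 :: "'b::euclidean_space"
  assumes r: "r > 0"
  obtains \<beta> :: "'b \<Rightarrow> real" where "Ck_on 1 UNIV \<beta>" "\<And>x. \<beta> x \<ge> 0"
    "\<And>x. norm (x - x0) \<le> r \<Longrightarrow> \<beta> x = 1" "\<And>x. norm (x - x0) \<ge> 2 * r \<Longrightarrow> \<beta> x = 0"
proof
  \<comment> \<open>\<open>N\<close> is at most 0 on the ball of radius \<open>r\<close> and at
    least 1 (indeed 3) from radius \<open>2 * r\<close> on. The inner \<open>pos_sq\<close> makes
    the first region flat, the outer one the second.\<close>
  define N where "N x = ((x - x0) \<bullet> (x - x0) - r\<^sup>2) * (1 / r\<^sup>2)" for x
  define \<beta> where "\<beta> x = pos_sq (1 - pos_sq (N x))" for x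
  have "Ck_on 1 UNIV (\<lambda>x :: 'b. x + (- x0))"
    by (rule Ck_on_add[OF open_UNIV Ck_on_ident[OF open_UNIV] Ck_on_const])
  note Ck_on_inner[OF open_UNIV this this]
  then have "Ck_on 1 UNIV (\<lambda>x. ((x + (- x0)) \<bullet> (x + (- x0)) + (- (r\<^sup>2))) * (1 / r\<^sup>2))"
    by (intro Ck_on_mult Ck_on_add[of _ _ _ "\<lambda>x. - (r\<^sup>2)"] Ck_on_const open_UNIV)
  then have N: "Ck_on 1 UNIV N" by (simp add: N_def[abs_def])
  have "Ck_on 1 UNIV (\<lambda>x. 1 + (-1) * pos_sq (N x))"
    using Ck_on_compose[OF open_UNIV _ Ck_on_pos_sq N] by (intro Ck_on_mult Ck_on_add Ck_on_const open_UNIV) auto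
  from Ck_on_compose[OF open_UNIV _ Ck_on_pos_sq this]
  show "Ck_on 1 UNIV \<beta>" by (simp add: \<beta>_def[abs_def])
  show "\<beta> x \<ge> 0" for x by (simp add: \<beta>_def pos_sq_nonneg)
  show "\<beta> x = 1" if "norm (x - x0) \<le> r" for x
  proof -
    have "(x - x0) \<bullet> (x - x0) \<le> r\<^sup>2"
      using that by (simp add: power2_norm_eq_inner[symmetric] power_mono)
    then have "N x \<le> 0" using r by (simp add: N_def divide_le_0_iff)
    then show ?thesis by (simp add: \<beta>_def pos_sq_zero) (simp add: pos_sq_def)
  qed
  show "\<beta> x = 0" if "norm (x - x0) \<ge> 2 * r" for x
  proof -
    have "(2 * r)\<^sup>2 \<le> (x - x0) \<bullet> (x - x0)"
      unfolding power2_norm_eq_inner[symmetric] using that r by (intro power_mono) auto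
    then have "2 * r\<^sup>2 \<le> (x - x0) \<bullet> (x - x0)"
      using zero_le_power2[of r] unfolding power2_eq_square by linarith
    then have "N x \<ge> 1" using r by (simp add: N_def field_simps)
    then have "pos_sq (N x) \<ge> 1" using mult_mono[of 1 "N x" 1 "N x"] by (simp add: pos_sq_def)
    then show ?thesis by (simp add: \<beta>_def pos_sq_zero)
  qed
qed

text \<open>The difference quotients lie in \<open>L\<close>, and a subspace of a Euclidean space is
  closed.\<close>

lemma vector_derivative_in_subspace:
  fixes \<eta> :: "real \<Rightarrow> 'b::euclidean_space"
  assumes L: "subspace L" and \<eta>: "\<forall>\<^sub>F t in nhds 0. \<eta> t \<in> L" "(\<eta> has_vector_derivative v) (at 0)"
  shows "v \<in> L"
proof -
  have e: "\<forall>\<^sub>F t in at 0. \<eta> t \<in> L" using \<eta>(1) by (auto simp: eventually_at_filter elim: eventually_mono)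
  have \<eta>0: "\<eta> 0 \<in> L" using \<eta>(1) by (rule eventually_nhds_x_imp_x)
  have "((\<lambda>t. (\<eta> t - \<eta> 0) /\<^sub>R (t - 0)) \<longlongrightarrow> v) (at 0)"
  proof (rule LIM_zero_cancel, rule tendsto_norm_zero_cancel)
    have "((\<lambda>t. (1 / norm (t - 0)) *\<^sub>R (\<eta> t - (\<eta> 0 + (t - 0) *\<^sub>R v))) \<longlongrightarrow> 0) (at 0)"
      using \<eta>(2) unfolding has_vector_derivative_def has_derivative_within by blast
    from tendsto_norm_zero[OF this]
    show "((\<lambda>t. norm ((\<eta> t - \<eta> 0) /\<^sub>R (t - 0) - v)) \<longlongrightarrow> 0) (at 0)"
    proof (rule Lim_transform_eventually)
      have "norm ((1 / norm (t - 0)) *\<^sub>R (\<eta> t - (\<eta> 0 + (t - 0) *\<^sub>R v))) = norm ((\<eta> t - \<eta> 0) /\<^sub>R (t - 0) - v)"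
        if "t \<noteq> 0" for t
      proof -
        have "(\<eta> t - \<eta> 0) /\<^sub>R (t - 0) - v = (1 / t) *\<^sub>R (\<eta> t - (\<eta> 0 + (t - 0) *\<^sub>R v))"
          using that by (simp add: scaleR_diff_right scaleR_add_right divide_inverse)
        then show ?thesis by simp
      qed
      then show "\<forall>\<^sub>F t in at 0. norm ((1 / norm (t - 0)) *\<^sub>R (\<eta> t - (\<eta> 0 + (t - 0) *\<^sub>R v))) =
          norm ((\<eta> t - \<eta> 0) /\<^sub>R (t - 0) - v)"
        by (simp add: eventually_at_filter)
    qed
  qed
  moreover have "\<forall>\<^sub>F t in at 0. (\<eta> t - \<eta> 0) /\<^sub>R (t - 0) \<in> L"
    using e by eventually_elim (intro subspace_scale subspace_diff L \<eta>0)
  ultimately show ?thesis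
    by (intro Lim_in_closed_set[OF closed_subspace[OF L]]) auto
qed

text \<open>Restrict to the line through \<open>y\<close> in direction \<open>w\<close>. If the
  second derivative at 0 were positive, the first one, which is 0 there, would be positive just to
  the right, and by the mean value theorem the function would exceed its maximum.\<close>

lemma local_max_along_subspace:
  fixes \<Phi> :: "'b::euclidean_space \<Rightarrow> real"
  assumes V: "open V" "Ck_on 2 V \<Phi>" and L: "subspace L" "w \<in> L" and y: "y \<in> V" "y \<in> L"
    and W: "open W" "y \<in> W" "\<And>z. z \<in> W \<Longrightarrow> z \<in> L \<Longrightarrow> \<Phi> z \<le> \<Phi> y"
  shows "fderiv \<Phi> y w = 0"
    "fderiv (\<lambda>z. fderiv \<Phi> z w) y w \<le> 0"
proof -
  define u where "u t = \<Phi> (y + t *\<^sub>R w)" for t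
  define u' where "u' t = fderiv \<Phi> (y + t *\<^sub>R w) w" for t
  define b where "b = fderiv (\<lambda>z. fderiv \<Phi> z w) y w"
  have "open (V \<inter> W)" "y \<in> V \<inter> W" using V W y by auto
  then obtain r where r: "r > 0" "ball y r \<subseteq> V \<inter> W" by (meson openE)
  define \<delta> where "\<delta> = r / (1 + norm w)"
  have n: "1 + norm w > 0" by (simp add: add_pos_nonneg)
  have \<delta>: "\<delta> > 0" using r n by (simp add: \<delta>_def)
  have inb: "y + t *\<^sub>R w \<in> V \<inter> W" if "\<bar>t\<bar> < \<delta>" for t
  proof -
    have "norm (t *\<^sub>R w) \<le> \<bar>t\<bar> * (1 + norm w)" by (simp add: mult_left_mono)
    also have "\<dots> < r" using that n by (simp add: \<delta>_def field_simps)
    finally show ?thesis using r(2) by (auto simp: dist_norm)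
  qed
  have max: "u t \<le> u 0" if "\<bar>t\<bar> < \<delta>" for t
    using inb[OF that] W(3)[of "y + t *\<^sub>R w"] L y by (auto simp: u_def subspace_add subspace_scale)
  have du: "(u has_real_derivative u' t) (at t)" if "\<bar>t\<bar> < \<delta>" for t
    unfolding u_def[abs_def] u'_def has_real_derivative_iff_has_vector_derivative
    by (rule has_derivative_along_line) (rule Ck_on_2_differentiable[OF V(2)], use inb[OF that] in blast)
  have "u' 0 = 0"
    by (rule DERIV_local_max[OF du \<delta>]) (use \<delta> max in auto)
  then show "fderiv \<Phi> y w = 0" by (simp add: u'_def)
  have "((\<lambda>t. fderiv \<Phi> (y + t *\<^sub>R w) w) has_vector_derivative
      fderiv (\<lambda>z. fderiv \<Phi> z w) (y + 0 *\<^sub>R w) w) (at 0)"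
    by (rule has_derivative_along_line) (use Ck_on_2_differentiable[OF V(2) y(1)] in simp)
  then have du': "(u' has_real_derivative b) (at 0)"
    by (simp add: u'_def[abs_def] b_def has_real_derivative_iff_has_vector_derivative)
  have "\<not> b > 0"
  proof
    assume "b > 0"
    from DERIV_pos_inc_right[OF du' this] obtain d where d: "d > 0"
      "\<And>h. h > 0 \<Longrightarrow> h < d \<Longrightarrow> u' 0 < u' (0 + h)" by blast
    define t where "t = min d \<delta> / 2"
    have t: "0 < t" "t < d" "t < \<delta>" using d \<delta> by (auto simp: t_def)
    have "\<exists>z>0. z < t \<and> u t - u 0 = (t - 0) * u' z"
      by (rule MVT2[OF t(1)]) (use t in \<open>auto intro: du\<close>)
    then obtain z where z: "z > 0" "z < t" "u t - u 0 = t * u' z" by auto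
    have "u' z > 0" using d(2)[of z] z t \<open>u' 0 = 0\<close> by simp
    then have "u t > u 0" using z t by (metis diff_gt_0_iff_gt mult_pos_pos)
    then show False using max[of t] t by simp
  qed
  then show "fderiv (\<lambda>z. fderiv \<Phi> z w) y w \<le> 0" by (simp add: b_def)
qed

locale slice_chart = riemannian_atlas A g
  for A :: "('a::{t2_space, second_countable_topology}, 'b::euclidean_space) chart set" and g +
  fixes M :: "'a set" and d :: "('a, 'b) chart" and L :: "'b set"
  assumes d: "C2_chart A d" and L: "subspace L"
    and slice: "snd d ` (fst d \<inter> M) = chart_image d \<inter> L"
begin

sublocale d: chart_map d
  using d by unfold_locales (simp add: C2_chart_def)

lemma compatible: "c \<in> A \<Longrightarrow> C2_compatible c d"
  by (rule C2_chart_compatible[OF d])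

lemma slice_iff: "q \<in> fst d \<Longrightarrow> q \<in> M \<longleftrightarrow> snd d q \<in> L"
proof
  assume "q \<in> fst d" "snd d q \<in> L"
  then have "snd d q \<in> snd d ` (fst d \<inter> M)" using slice by simp
  then obtain q' where "q' \<in> fst d" "q' \<in> M" "snd d q' = snd d q" by auto
  then show "q \<in> M" using \<open>q \<in> fst d\<close> by (metis d.chart_inv_chart)
qed (use slice in blast)

text \<open>A curve in \<open>M\<close> becomes a curve in \<open>L\<close> in slice coordinates, so
  its velocity lies in \<open>L\<close>. Conversely a vector of \<open>L\<close> is the velocity of
  a straight line in \<open>L\<close>, which the slice chart maps back into
  \<open>M\<close>.\<close>

lemma tangent_space_iff:
  assumes q: "q \<in> fst d" "q \<in> M"
  shows "v \<in> tangent_space_at A M q \<longleftrightarrow> transition_deriv (chart_at A q) d (pt q) v \<in> L"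
proof
  define c where "c = chart_at A q"
  have c: "c \<in> A" "q \<in> fst c" unfolding c_def by (rule chart_at)+
  interpret c: chart_map c using c atlas_chart by unfold_locales auto
  note comp = compatible[OF c(1)]
  {
    assume "v \<in> tangent_space_at A M q"
    then obtain \<gamma> :: "real \<Rightarrow> 'a" where \<gamma>: "\<gamma> 0 = q" "isCont \<gamma> 0" "\<forall>\<^sub>F t in nhds 0. \<gamma> t \<in> M"
      "((snd c \<circ> \<gamma>) has_vector_derivative v) (at 0)"
      unfolding tangent_space_at_def c_def by auto
    have "\<forall>\<^sub>F t in nhds 0. \<gamma> t \<in> fst c \<inter> fst d"
      using \<gamma>(1,2) q(1) c(2) open_Int[OF c.open_dom d.open_dom]
      unfolding continuous_at_open eventually_nhds by blast
    with \<gamma>(3) have ev: "\<forall>\<^sub>F t in nhds 0. \<gamma> t \<in> M \<and> \<gamma> t \<in> fst c \<inter> fst d"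
      by (rule eventually_conj)
    then obtain T where T: "open T" "0 \<in> T" "\<And>t. t \<in> T \<Longrightarrow> \<gamma> t \<in> M \<and> \<gamma> t \<in> fst c \<inter> fst d"
      unfolding eventually_nhds by blast
    have "((snd c \<circ> \<gamma>) has_derivative (\<lambda>h. h *\<^sub>R v)) (at 0)"
      using \<gamma>(4) by (simp add: has_vector_derivative_def)
    from has_derivative_compose[OF this, of "snd d \<circ> chart_inv c"] has_derivative_transition[OF comp c(2) q(1)] \<gamma>(1)
    have "((\<lambda>t. (snd d \<circ> chart_inv c) ((snd c \<circ> \<gamma>) t)) has_derivative
        (\<lambda>h. transition_deriv c d (snd c q) (h *\<^sub>R v))) (at 0)"
      by simp
    then have "((snd d \<circ> \<gamma>) has_derivative (\<lambda>h. transition_deriv c d (snd c q) (h *\<^sub>R v))) (at 0)"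
      by (rule has_derivative_transform_within_open[OF _ T(1,2)]) (use T(3) in auto)
    then have "((snd d \<circ> \<gamma>) has_vector_derivative transition_deriv c d (snd c q) v) (at 0)"
      unfolding has_vector_derivative_def by (simp add: linear_cmul[OF linear_transition_deriv[OF comp c(2) q(1)]])
    moreover have "\<forall>\<^sub>F t in nhds 0. (snd d \<circ> \<gamma>) t \<in> L"
      using ev by eventually_elim (use slice_iff in auto)
    ultimately show "transition_deriv c d (snd c q) v \<in> L"
      by (intro vector_derivative_in_subspace[OF L])
  next
    define w where "w = transition_deriv c d (snd c q) v"
    assume "transition_deriv c d (snd c q) v \<in> L"
    then have w: "w \<in> L" by (simp add: w_def)
    define \<gamma> where "\<gamma> t = chart_inv d (snd d q + t *\<^sub>R w)" for t :: real
    have line: "((\<lambda>t. snd d q + t *\<^sub>R w) has_derivative (\<lambda>h. h *\<^sub>R w)) (at 0)"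
      by (auto intro!: derivative_eq_intros)
    have cl: "isCont (\<lambda>t. snd d q + t *\<^sub>R w) 0" by (intro continuous_intros)
    have "\<gamma> 0 = q" using q by (simp add: \<gamma>_def)
    moreover have "isCont \<gamma> 0"
      unfolding \<gamma>_def using q by (intro isCont_o2[OF cl] d.isCont_chart_inv) simp
    moreover have "\<forall>\<^sub>F t in nhds 0. \<gamma> t \<in> M"
    proof -
      have "\<forall>\<^sub>F t in nhds 0. snd d q + t *\<^sub>R w \<in> chart_image d"
        using cl q(1) d.open_image unfolding continuous_at_open eventually_nhds
        by (metis add.right_neutral d.chart_in_image scaleR_zero_left)
      then show ?thesis
      proof eventually_elim
        case (elim t)
        have "snd d q + t *\<^sub>R w \<in> L"
          using slice_iff[OF q(1)] q(2) w L by (auto intro!: subspace_add subspace_scale)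
        then show ?case using slice_iff[of "\<gamma> t"] elim by (simp add: \<gamma>_def)
      qed
    qed
    moreover have "((snd c \<circ> \<gamma>) has_vector_derivative v) (at 0)"
    proof -
      have "((\<lambda>t. (snd c \<circ> chart_inv d) (snd d q + t *\<^sub>R w)) has_derivative
          (\<lambda>h. transition_deriv d c (snd d q) (h *\<^sub>R w))) (at 0)"
        using has_derivative_compose[OF line, of "snd c \<circ> chart_inv d"]
          has_derivative_transition[OF C2_compatible_sym[OF comp] q(1) c(2)] by simp
      moreover have "transition_deriv d c (snd d q) (h *\<^sub>R w) = h *\<^sub>R v" for h
        unfolding linear_cmul[OF linear_transition_deriv[OF C2_compatible_sym[OF comp] q(1) c(2)]]
        by (simp add: w_def transition_deriv_inverse[OF comp c(2) q(1)])
      ultimately show ?thesis by (simp add: has_vector_derivative_def o_def \<gamma>_def)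
    qed
    ultimately show "v \<in> tangent_space_at A M q"
      unfolding tangent_space_at_def c_def[symmetric] by blast
  }
qed

lemma tangent_space_subspace:
  assumes q: "q \<in> fst d" "q \<in> M"
  shows "subspace (tangent_space_at A M q)" "dim (tangent_space_at A M q) = dim L"
proof -
  define c where "c = chart_at A q"
  have c: "c \<in> A" "q \<in> fst c" unfolding c_def by (rule chart_at)+
  note comp = compatible[OF c(1)]
  note l = linear_transition_deriv[OF comp c(2) q(1)]
  note l' = linear_transition_deriv[OF C2_compatible_sym[OF comp] q(1) c(2)]
  note T = tangent_space_iff[OF q, folded c_def]
  show "subspace (tangent_space_at A M q)"
    using L T unfolding subspace_def by (auto simp: linear_add[OF l] linear_cmul[OF l] linear_0[OF l])
  have inv: "transition_deriv c d (snd c q) (transition_deriv d c (snd d q) v) = v" for v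
    by (rule transition_deriv_inverse[OF C2_compatible_sym[OF comp] q(1) c(2)])
  have "tangent_space_at A M q = transition_deriv d c (snd d q) ` L"
  proof (intro subset_antisym subsetI)
    fix v assume "v \<in> tangent_space_at A M q"
    then have "transition_deriv c d (snd c q) v \<in> L" using T by simp
    moreover have "transition_deriv d c (snd d q) (transition_deriv c d (snd c q) v) = v"
      by (rule transition_deriv_inverse[OF comp c(2) q(1)])
    ultimately show "v \<in> transition_deriv d c (snd d q) ` L" by (metis imageI)
  qed (use T inv in auto)
  moreover have "inj (transition_deriv d c (snd d q))" by (rule injI) (metis inv)
  ultimately show "dim (tangent_space_at A M q) = dim L"
    using dim_image_eq[OF l'] by (simp add: inj_on_subset)
qed

lemma zero_tangent: "q \<in> M \<Longrightarrow> 0 \<in> tangent_space_at A M q"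
  unfolding tangent_space_at_def
  by (auto intro!: exI[of _ "\<lambda>_. q"] has_vector_derivative_const simp: o_def)

text \<open>The choice operator in \<open>second_fundamental_form\<close> is meaningful only if a
  global tangent field through \<open>v\<close> exists. A constant vector of \<open>L\<close> in
  slice coordinates is tangent along \<open>M\<close>; it is cut off inside the overlap with an
  atlas chart and extended by zero. Slice charts are only C^2, so its components in the atlas chart
  are just C^1.\<close>

lemma ex_tangent_field:
  assumes p: "p \<in> fst d" "p \<in> M" and v: "v \<in> tangent_space_at A M p"
  obtains Y where "C1_vectorfield A Y" "\<And>q. q \<in> M \<Longrightarrow> Y q \<in> tangent_space_at A M q" "Y p = v"
proof -
  define c where "c = chart_at A p"
  have c: "c \<in> A" "p \<in> fst c" unfolding c_def by (rule chart_at)+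
  interpret c: chart_map c using c atlas_chart by unfold_locales auto
  note comp = compatible[OF c(1)]
  define w where "w = transition_deriv c d (snd c p) v"
  have w: "w \<in> L" using v tangent_space_iff[OF p] by (simp add: w_def c_def)
  define W where "W = snd c ` (fst c \<inter> fst d)"
  have W: "open W" "W \<subseteq> chart_image c" unfolding W_def
    using c.open_chart_image[OF d.open_dom] c.image_subset by auto
  have "snd c p \<in> W" using p c by (auto simp: W_def)
  then obtain r where r: "r > 0" "cball (snd c p) r \<subseteq> W" using W(1) open_contains_cball by blast
  define K where "K = cball (snd c p) r"
  have "r / 2 > 0" using r by simp
  from ex_bump[OF this, of "snd c p"] obtain \<beta> :: "'b \<Rightarrow> real" where \<beta>: "Ck_on 1 UNIV \<beta>"
    "\<And>x. norm (x - snd c p) \<le> r / 2 \<Longrightarrow> \<beta> x = 1" "\<And>x. norm (x - snd c p) \<ge> 2 * (r / 2) \<Longrightarrow> \<beta> x = 0"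
    by metis
  have \<beta>0: "\<beta> x = 0" if "x \<notin> K" for x
    using that \<beta>(3)[of x] by (simp add: K_def dist_norm norm_minus_commute)
  define Z where "Z x = (if x \<in> W then \<beta> x *\<^sub>R transition_deriv d c (snd d (chart_inv c x)) w else 0)" for x
  have Z0: "Z x = 0" if "x \<notin> K" for x using \<beta>0[OF that] by (simp add: Z_def)
  have "Ck_on 1 W (\<lambda>x. \<beta> x *\<^sub>R fderiv (snd c \<circ> chart_inv d) ((snd d \<circ> chart_inv c) x) w)"
  proof (intro Ck_on_scaleR W(1))
    show "Ck_on 1 W \<beta>" using \<beta>(1) by (rule Ck_on_subset) simp
    have 1: "Ck_on 1 (snd d ` (fst d \<inter> fst c)) (\<lambda>y. fderiv (snd c \<circ> chart_inv d) y w)"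
      using Ck_on_transition[OF C2_compatible_sym[OF comp]] by (simp add: numeral_2_eq_2)
    have 2: "Ck_on 1 W (snd d \<circ> chart_inv c)"
      using Ck_on_transition[OF comp] unfolding W_def by (rule Ck_on_antimono) simp
    show "Ck_on 1 W (\<lambda>x. fderiv (snd c \<circ> chart_inv d) ((snd d \<circ> chart_inv c) x) w)"
      by (rule Ck_on_compose[OF W(1) _ 1 2]) (auto simp: W_def)
  qed
  then have ZW: "Ck_on 1 W Z"
    by (rule Ck_on_cong[OF W(1), rotated]) (simp add: Z_def transition_deriv_def)
  have "Ck_on 1 (- K) (\<lambda>_. 0 :: 'b)" by (rule Ck_on_const)
  then have ZK: "Ck_on 1 (- K) Z"
    by (rule Ck_on_cong[rotated 2]) (auto simp: K_def Z0 open_Compl)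
  \<comment> \<open>The open sets \<open>W\<close> and \<open>- K\<close> cover everything. On the
    first the formula is C^1, on the second the field is zero.\<close>
  have Z: "Ck_on 1 (chart_image c) Z"
  proof (rule Ck_on_locally)
    fix x
    have "x \<in> W \<or> x \<in> - K" using r by (auto simp: K_def)
    moreover have "open (- K)" by (simp add: K_def open_Compl)
    ultimately show "\<exists>T. open T \<and> x \<in> T \<and> Ck_on 1 T Z" using ZW ZK W(1) by blast
  qed
  define Y where "Y = extend_field c Z"
  have K: "compact K" "K \<subseteq> chart_image c" using r W(2) by (auto simp: K_def)
  have "C1_vectorfield A Y"
    unfolding Y_def by (rule extend_field_C1[OF c(1) K Z Z0])
  moreover have "Y q \<in> tangent_space_at A M q" if q: "q \<in> M" for q
  proof (cases "q \<in> fst c \<and> q \<in> fst d")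
    case True
    define e where "e = chart_at A q"
    have e: "e \<in> A" "q \<in> fst e" unfolding e_def by (rule chart_at)+
    have "snd c q \<in> W" using True by (auto simp: W_def)
    then have "Y q = transition_deriv c e (snd c q) (\<beta> (snd c q) *\<^sub>R transition_deriv d c (snd d q) w)"
      using True by (simp add: Y_def extend_field_def Z_def from_chart_eq e_def)
    then have "transition_deriv e d (snd e q) (Y q) =
        transition_deriv c d (snd c q) (\<beta> (snd c q) *\<^sub>R transition_deriv d c (snd d q) w)"
      using True e c by (simp add: transition_deriv_cocycle atlas_compatible compatible)
    also have "\<dots> = \<beta> (snd c q) *\<^sub>R w"
      using True by (simp add: linear_cmul[OF linear_transition_deriv[OF comp]]
          transition_deriv_inverse[OF C2_compatible_sym[OF comp]])
    finally have "transition_deriv e d (snd e q) (Y q) \<in> L" using w L by (simp add: subspace_scale)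
    then show ?thesis using tangent_space_iff[of q] True q by (simp add: e_def)
  next
    case False
    then have "Y q = 0"
      using linear_0[OF linear_from_chart[OF c(1)]]
      by (auto simp: Y_def extend_field_def Z_def W_def) (metis c.chart_inv_chart)
    then show ?thesis using zero_tangent[OF q] by simp
  qed
  moreover have "Y p = v"
  proof -
    have "\<beta> (snd c p) = 1" using \<beta>(2)[of "snd c p"] r by simp
    moreover have "from_chart A c p u = u" for u unfolding c_def by simp
    ultimately show ?thesis
      using c p \<open>snd c p \<in> W\<close> transition_deriv_inverse[OF comp c(2) p(1)]
      by (simp add: Y_def extend_field_def Z_def w_def)
  qed
  ultimately show thesis by (rule that)
qed

text \<open>In slice coordinates, the components of a tangent field along \<open>M\<close> stay in \<open>L\<close>, and the
  restriction of \<open>f\<close> to \<open>L\<close> has a local maximum.\<close>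

lemma hessian_tangent_field:
  assumes p: "p \<in> fst d" "p \<in> M" and f: "C2_function A f"
    and max: "open N" "p \<in> N" "\<And>q. q \<in> N \<Longrightarrow> q \<in> M \<Longrightarrow> f q \<le> f p"
    and Y: "C1_vectorfield A Y" "\<And>q. q \<in> M \<Longrightarrow> Y q \<in> tangent_space_at A M q"
  shows "hessian A g f p (Y p) (Y p) + fun_deriv A f p (cov_deriv A g Y p (Y p)) \<le> 0"
    and "fun_deriv A f p (Y p) = 0"
proof -
  define c where "c = chart_at A p"
  have c: "c \<in> A" "p \<in> fst c" unfolding c_def by (rule chart_at)+
  interpret c: chart_map c using c atlas_chart by unfold_locales auto
  interpret mc: chart_metric "chart_image c" "mc c" using c by (intro chart_metric_chart)
  note comp = compatible[OF c(1)] and comp' = C2_compatible_sym[OF compatible[OF c(1)]]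
  define F where "F = f \<circ> chart_inv c"
  define Yc where "Yc = field_in_chart A c Y"
  define \<psi> where "\<psi> = snd c \<circ> chart_inv d"
  define V where "V = snd d ` (fst d \<inter> fst c)"
  define W where "W = snd c ` (fst c \<inter> fst d)"
  define \<Phi> where "\<Phi> y = F (\<psi> y)" for y
  \<comment> \<open>Components of \<open>Y\<close> in slice coordinates. The slice chart
    \<open>d\<close> need not belong to the atlas, so they are obtained from the components in
    \<open>c\<close> by the coordinate change.\<close>
  define Yd where "Yd y = fderiv (snd d \<circ> chart_inv c) (\<psi> y) (Yc (\<psi> y))" for y
  define y where "y = snd d p"
  define x where "x = snd c p"
  define e where "e = Y p"
  define w where "w = Yd y"
  have V: "open V" "V \<subseteq> chart_image d" unfolding V_def
    using d.open_chart_image[OF c.open_dom] d.image_subset by auto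
  have W: "open W" "W \<subseteq> chart_image c" unfolding W_def
    using c.open_chart_image[OF d.open_dom] c.image_subset by auto
  have \<psi>V: "\<psi> ` V \<subseteq> W" "\<psi> ` V \<subseteq> chart_image c" by (auto simp: \<psi>_def V_def W_def)
  have y: "y \<in> V" "y \<in> L" "\<psi> y = x" using p c slice_iff by (auto simp: y_def V_def \<psi>_def x_def)
  have x: "x \<in> chart_image c" using c by (simp add: x_def)
  have F: "Ck_on 2 (chart_image c) F" using f c by (auto simp: C2_function_def F_def)
  have \<psi>: "Ck_on 2 V \<psi>" unfolding V_def \<psi>_def by (rule Ck_on_transition[OF comp'])
  have \<Phi>: "Ck_on 2 V \<Phi>" unfolding \<Phi>_def[abs_def] by (rule Ck_on_compose[OF V(1) \<psi>V(2) F \<psi>])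
  have Yc: "Ck_on 1 (chart_image c) Yc" using Y(1) c by (simp add: C1_vectorfield_def Yc_def del: Ck_on.simps One_nat_def)
  have Yd: "Ck_on 1 V Yd"
  proof -
    have "Ck_on 1 W (\<lambda>x. fderiv (snd d \<circ> chart_inv c) x (Yc x))"
      using Ck_on_transition[OF comp] Ck_on_subset[OF Yc W(2)] unfolding W_def[symmetric]
      by (intro Ck_on_frechet_derivative_apply[OF W(1)]) (simp_all add: numeral_2_eq_2 del: Ck_on.simps)
    from Ck_on_compose[OF V(1) \<psi>V(1) this Ck_on_antimono[OF \<psi>]]
    show ?thesis unfolding Yd_def[abs_def] by simp
  qed
  have T: "fderiv \<psi> (snd d q) = transition_deriv d c (snd d q)" for q
    by (simp add: \<psi>_def transition_deriv_def)
  have Yd_q: "Yd (snd d q) = transition_deriv c d (snd c q) (to_chart A c q (Y q))"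
    if "q \<in> fst d" "q \<in> fst c" for q
    using that c by (simp add: Yd_def \<psi>_def Yc_def field_in_chart_eq transition_deriv_def)
  have D\<psi>Yd: "fderiv \<psi> z (Yd z) = Yc (\<psi> z)" if z: "z \<in> V" for z
  proof -
    obtain q where q: "q \<in> fst d" "q \<in> fst c" "z = snd d q" using z by (auto simp: V_def)
    show ?thesis unfolding q(3) T Yd_q[OF q(1,2)] transition_deriv_inverse[OF comp q(2,1)]
      using q c by (simp add: \<psi>_def Yc_def field_in_chart_eq)
  qed
  have YdL: "Yd z \<in> L" if z: "z \<in> V" "z \<in> L" for z
  proof -
    obtain q where q: "q \<in> fst d" "q \<in> fst c" "z = snd d q" using z by (auto simp: V_def)
    have "q \<in> M" using slice_iff[OF q(1)] z q by simp
    define b where "b = chart_at A q"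
    have b: "b \<in> A" "q \<in> fst b" unfolding b_def by (rule chart_at)+
    have "transition_deriv b d (snd b q) (Y q) \<in> L"
      using tangent_space_iff[OF q(1) \<open>q \<in> M\<close>] Y(2)[OF \<open>q \<in> M\<close>] by (simp add: b_def)
    moreover have "transition_deriv b d (snd b q) (Y q) = Yd (snd d q)"
      unfolding Yd_q[OF q(1,2)] to_chart_eq b_def[symmetric]
      using b c q by (simp add: transition_deriv_cocycle atlas_compatible compatible)
    ultimately show ?thesis using q by simp
  qed
  have wL: "w \<in> L" unfolding w_def by (rule YdL[OF y(1,2)])
  have Ycx: "Yc x = e" using c by (simp add: Yc_def x_def e_def field_in_chart_eq) (simp add: c_def)
  have D\<psi>w: "fderiv \<psi> y w = e" using D\<psi>Yd[OF y(1)] Ycx y(3) by (simp add: w_def)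
  have d\<psi>: "(\<psi> has_derivative fderiv \<psi> y) (at y)"
    by (rule has_frechet_derivative[OF Ck_on_2_differentiable(1)[OF \<psi> y(1)]])
  have dF: "(F has_derivative fderiv F x) (at x)"
    by (rule has_frechet_derivative[OF Ck_on_2_differentiable(1)[OF F x]])
  have dYd: "(Yd has_derivative fderiv Yd y) (at y)"
    using Ck_on_has_derivative[of 0] Yd y by simp
  have dYc: "(Yc has_derivative fderiv Yc x) (at x)"
    using Ck_on_has_derivative[of 0] Yc x by simp
  define D2\<psi> where "D2\<psi> = fderiv (\<lambda>z. fderiv \<psi> z w) y"
  have dD\<psi>: "((\<lambda>z. fderiv \<psi> z w) has_derivative D2\<psi>) (at y)"
    unfolding D2\<psi>_def by (rule has_frechet_derivative[OF Ck_on_2_differentiable(2)[OF \<psi> y(1)]])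
  have "((\<lambda>z. fderiv \<psi> z (Yd z)) has_derivative
      (\<lambda>h. D2\<psi> h + fderiv \<psi> y (fderiv Yd y h))) (at y)"
    using has_derivative_frechet_apply[OF V(1) \<psi> y(1) dYd] by (simp add: D2\<psi>_def w_def)
  then have "((\<lambda>z. Yc (\<psi> z)) has_derivative
      (\<lambda>h. D2\<psi> h + fderiv \<psi> y (fderiv Yd y h))) (at y)"
    by (rule has_derivative_transform_within_open[OF _ V(1) y(1)]) (rule D\<psi>Yd)
  moreover have "((\<lambda>z. Yc (\<psi> z)) has_derivative (\<lambda>h. fderiv Yc x (fderiv \<psi> y h))) (at y)"
    using has_derivative_compose[OF d\<psi>, of Yc] dYc y(3) by simp
  ultimately have "(\<lambda>h. D2\<psi> h + fderiv \<psi> y (fderiv Yd y h)) =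
      (\<lambda>h. fderiv Yc x (fderiv \<psi> y h))"
    by (rule has_derivative_unique)
  from fun_cong[OF this, of w]
  have DYc: "fderiv Yc x e = D2\<psi> w + fderiv \<psi> y (fderiv Yd y w)"
    by (simp add: D\<psi>w)
  have D\<Phi>: "fderiv \<Phi> z u = fderiv F (\<psi> z) (fderiv \<psi> z u)" if "z \<in> V" for z u
  proof -
    have "\<psi> z \<in> chart_image c" using \<psi>V that by auto
    from has_derivative_compose[OF has_frechet_derivative[OF Ck_on_2_differentiable(1)[OF \<psi> that]]
        has_frechet_derivative[OF Ck_on_2_differentiable(1)[OF F this]]]
    show ?thesis unfolding \<Phi>_def[abs_def] by (metis frechet_derivative_at)
  qed
  have "((\<lambda>z. fderiv F (\<psi> z) (fderiv \<psi> z w)) has_derivative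
    (\<lambda>h. fderiv (\<lambda>x. fderiv F x e) x (fderiv \<psi> y h) +
      fderiv F x (D2\<psi> h))) (at y)"
    using has_derivative_frechet_apply_compose[OF c.open_image F V(1) y(1) \<psi>V(2) d\<psi> dD\<psi>]
    by (simp add: y(3) D\<psi>w)
  then have "((\<lambda>z. fderiv \<Phi> z w) has_derivative
    (\<lambda>h. fderiv (\<lambda>x. fderiv F x e) x (fderiv \<psi> y h) +
      fderiv F x (D2\<psi> h))) (at y)"
    by (rule has_derivative_transform_within_open[OF _ V(1) y(1)]) (rule D\<Phi>[symmetric])
  from fun_cong[OF frechet_derivative_at[OF this], of w]
  have D2\<Phi>: "fderiv (\<lambda>z. fderiv \<Phi> z w) y w =
      fderiv (\<lambda>x. fderiv F x e) x e + fderiv F x (D2\<psi> w)"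
    by (simp add: D\<psi>w)
  define N' where "N' = snd d ` (fst d \<inter> (N \<inter> fst c))"
  have N': "open N'" unfolding N'_def by (intro d.open_chart_image open_Int max c.open_dom)
  have yN': "y \<in> N'" using p c max by (auto simp: y_def N'_def)
  have max': "\<Phi> z \<le> \<Phi> y" if z: "z \<in> N'" "z \<in> L" for z
  proof -
    obtain q where q: "q \<in> fst d" "q \<in> fst c" "q \<in> N" "z = snd d q" using z by (auto simp: N'_def)
    then have "q \<in> M" using slice_iff[OF q(1)] z by simp
    then show ?thesis using max(3)[OF q(3)] q p c by (simp add: \<Phi>_def F_def \<psi>_def y_def)
  qed
  note lm = local_max_along_subspace[OF V(1) \<Phi> L _ y(1,2) N' yN' max']
  \<comment> \<open>\<open>Yd\<close> has values in \<open>L\<close> along the line through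
    \<open>y\<close> in direction \<open>w\<close>, and so has its derivative; the first-order
    condition for a maximum therefore applies to that derivative too.\<close>
  have DYdL: "fderiv Yd y w \<in> L"
  proof (rule vector_derivative_in_subspace[OF L])
    have "Yd differentiable (at (y + 0 *\<^sub>R w))" using dYd by (auto intro: differentiableI)
    from has_derivative_along_line[OF this]
    show "((\<lambda>t. Yd (y + t *\<^sub>R w)) has_vector_derivative fderiv Yd y w) (at 0)" by simp
    have "isCont (\<lambda>t. y + t *\<^sub>R w) 0" by (intro continuous_intros)
    then have "\<forall>\<^sub>F t in nhds 0. y + t *\<^sub>R w \<in> V"
      using y(1) V(1) unfolding continuous_at_open eventually_nhds
      by (metis add.right_neutral scaleR_zero_left)
    then show "\<forall>\<^sub>F t in nhds 0. Yd (y + t *\<^sub>R w) \<in> L"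
      by eventually_elim (rule YdL, assumption, intro subspace_add subspace_scale L y wL)
  qed
  have fd: "fun_deriv A f p = fderiv F x"
    by (simp add: fun_deriv_def F_def x_def c_def)
  show "fun_deriv A f p (Y p) = 0"
    using lm(1)[OF wL] D\<Phi>[OF y(1)] by (simp add: fd y(3) D\<psi>w e_def)
  have l: "linear (fderiv F x)" using dF by (rule has_derivative_linear)
  \<comment> \<open>The Christoffel terms of the Hessian and of the covariant derivative cancel.
    What remains is the second derivative of \<open>f\<close> along the field \<open>Y\<close>,
    which has the same form in slice coordinates.\<close>
  have "hessian A g f p e e + fun_deriv A f p (cov_deriv A g Y p e) =
    fderiv (\<lambda>x. fderiv F x e) x e + fderiv F x (fderiv Yc x e)"
    unfolding hessian_eq cov_deriv_eq fd c_def[symmetric] F_def[symmetric] x_def[symmetric] Yc_def[symmetric]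
      mc.hess_def mc.cov_def Ycx
    by (simp add: linear_add[OF l])
  also have "\<dots> = fderiv (\<lambda>z. fderiv \<Phi> z w) y w +
      fderiv \<Phi> y (fderiv Yd y w)"
    unfolding DYc D2\<Phi> D\<Phi>[OF y(1)] y(3) linear_add[OF l] by simp
  also have "\<dots> \<le> 0" using lm(1)[OF DYdL] lm(2)[OF wL] by simp
  finally show "hessian A g f p (Y p) (Y p) + fun_deriv A f p (cov_deriv A g Y p (Y p)) \<le> 0"
    by (simp add: e_def)
qed

end

section \<open>The submanifold case\<close>

context riemannian_atlas begin

lemma bilinear_hessian:
  assumes "C2_function A f"
  shows "bilinear (hessian A g f p)" "hessian A g f p u v = hessian A g f p v u"
proof -
  define d where "d = chart_at A p"
  have d: "d \<in> A" "p \<in> fst d" unfolding d_def by (rule chart_at)+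
  interpret d: chart_map d using d atlas_chart by unfold_locales auto
  interpret md: chart_metric "chart_image d" "mc d" using d by (intro chart_metric_chart)
  have "Ck_on 2 (chart_image d) (f \<circ> chart_inv d)" using assms d by (auto simp: C2_function_def)
  note md.bilinear_hess[OF this d.chart_in_image[OF d(2)]]
    md.hess_sym[OF this d.chart_in_image[OF d(2)], of u v]
  then show "bilinear (hessian A g f p)" "hessian A g f p u v = hessian A g f p v u"
    by (simp_all add: hessian_eq[abs_def] d_def)
qed

lemma submanifold_mh_subset:
  assumes M: "proper_submanifold A m M" and H: "\<And>p. p \<in> M \<Longrightarrow> gnorm g p (mean_curvature_vector A g M p) \<le> h"
  shows "mh_subset A g m h M"
  unfolding mh_subset_def
proof (intro conjI allI impI, goal_cases)
  case 1
  then show ?case using M by (simp add: proper_submanifold_def)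
next
  case (2 f p)
  then obtain N where f: "C2_function A f" and p: "p \<in> M"
    and N: "open N" "p \<in> N" "\<And>q. q \<in> N \<Longrightarrow> q \<in> M \<Longrightarrow> f q \<le> f p" by blast
  obtain d L where slice: "C2_chart A d" "p \<in> fst d" "subspace L" "dim L = m"
    "snd d ` (fst d \<inter> M) = chart_image d \<inter> L"
    using M p unfolding proper_submanifold_def by blast
  note pd = slice(2) and dim = slice(4)
  interpret slice_chart A g M d L using slice by unfold_locales auto
  interpret gp: inner_form "g p" by (rule inner_form_metric)
  define T where "T = tangent_space_at A M p"
  have T: "subspace T" "dim T = m"
    using tangent_space_subspace[OF pd p] dim by (auto simp: T_def)
  obtain e where e: "gp.orthonormal m e" "\<And>i. i < m \<Longrightarrow> e i \<in> T"
    "inj_on e {..<m}" "orthonormal_basis_of (g p) T = e ` {..<m}"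
    using gp.orthonormal_basis_of_family[OF T(1)] T(2) by auto
  define z where "z = chart_metric.grad (mc (chart_at A p)) (f \<circ> chart_inv (chart_at A p)) (pt p)"
  have fd: "fun_deriv A f p u = g p z u" for u unfolding z_def by (rule fun_deriv_eq_grad[OF f])
  note le = gradient_norm_le[OF fd]
  \<comment> \<open>Literally the choice made in \<open>second_fundamental_form\<close>, so that the
    sum below unfolds to the mean curvature vector.\<close>
  define Y where "Y v = (SOME Y. C1_vectorfield A Y \<and> (\<forall>q\<in>M. Y q \<in> tangent_space_at A M q) \<and> Y p = v)" for v
  have Y: "C1_vectorfield A (Y v)" "\<And>q. q \<in> M \<Longrightarrow> Y v q \<in> tangent_space_at A M q" "Y v p = v" if "v \<in> T" for v
  proof -
    have "\<exists>Y. C1_vectorfield A Y \<and> (\<forall>q\<in>M. Y q \<in> tangent_space_at A M q) \<and> Y p = v"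
      using ex_tangent_field[OF pd p, of v] that unfolding T_def by metis
    from someI_ex[OF this]
    show "C1_vectorfield A (Y v)" "\<And>q. q \<in> M \<Longrightarrow> Y v q \<in> tangent_space_at A M q" "Y v p = v"
      unfolding Y_def by blast+
  qed
  have key: "hessian A g f p v v + fun_deriv A f p (cov_deriv A g (Y v) p v) \<le> 0" "fun_deriv A f p v = 0" if "v \<in> T" for v
    using hessian_tangent_field[OF pd p f N Y(1,2)[OF that]] Y(3)[OF that] by auto
  \<comment> \<open>The derivative of \<open>f\<close> kills tangent vectors, so it does not see the
    tangential part of the covariant derivative.\<close>
  have normal: "fun_deriv A f p (normal_part (g p) T v) = fun_deriv A f p v" for v
  proof -
    have "g p z (\<Sum>b\<in>orthonormal_basis_of (g p) T. g p v b *\<^sub>R b) = 0"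
      unfolding gp.G_sum_right gp.G_simps
      using key(2)[unfolded fd] gp.orthonormal_basis_of_props(2)[OF T(1)] by (intro sum.neutral) auto
    then show ?thesis unfolding normal_part_def fd by (simp add: gp.G_simps)
  qed
  define HM where "HM = mean_curvature_vector A g M p"
  have "lowest_trace m (g p) (hessian A g f p) \<le> (\<Sum>i<m. hessian A g f p (e i) (e i))"
    by (rule gp.lowest_trace_le[OF bilinear_hessian[OF f] e(1)])
  also have "\<dots> \<le> (\<Sum>i<m. - fun_deriv A f p (cov_deriv A g (Y (e i)) p (e i)))"
    by (rule sum_mono) (use key(1)[OF e(2)] in force)
  also have "\<dots> = (\<Sum>i<m. - fun_deriv A f p (second_fundamental_form A g M p (e i) (e i)))"
    unfolding second_fundamental_form_def T_def[symmetric] normal Y_def ..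
  also have "\<dots> = - g p z HM"
    unfolding HM_def mean_curvature_vector_def T_def[symmetric] e(4) sum.reindex[OF e(3)] gp.G_sum_right fd
    by (simp add: sum_negf)
  also have "\<dots> \<le> sqrt (g p z z) * sqrt (g p HM HM)"
    using gp.cauchy_schwarz[of z HM] by linarith
  also have "\<dots> \<le> fun_deriv_norm A g f p * h"
    using le H[OF p] gp.G_nonneg by (intro mult_mono) (auto simp: gnorm_def HM_def intro: order_trans[OF _ le])
  finally show ?case by (simp add: mult.commute)
qed

end

section \<open>Limits of planes and of traces over planes\<close>

text \<open>Compactness yields limits of orthonormal frames along subsequences only. Projections and
  traces depend on the plane and not on the frame, so all these limits agree and the whole sequence
  converges.\<close>

lemma tendsto_subseqI:
  fixes X :: "nat \<Rightarrow> 'a::metric_space"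
  assumes "\<And>r. strict_mono r \<Longrightarrow> \<exists>s. strict_mono (s :: nat \<Rightarrow> nat) \<and> (\<lambda>n. X (r (s n))) \<longlonglongrightarrow> l"
  shows "X \<longlonglongrightarrow> l"
proof (rule ccontr)
  assume "\<not> X \<longlonglongrightarrow> l"
  then obtain e where e: "e > 0" "\<not> (\<forall>\<^sub>F n in sequentially. dist (X n) l < e)"
    unfolding tendsto_iff by blast
  have "\<exists>\<^sub>F n in sequentially. e \<le> dist (X n) l"
    using e(2) by (simp add: frequently_def not_le)
  then have "infinite {n. e \<le> dist (X n) l}"
    by (simp add: frequently_cofinite cofinite_eq_sequentially[symmetric])
  from infinite_enumerate[OF this] obtain r where
    r: "strict_mono (r :: nat \<Rightarrow> nat)" "\<And>n. e \<le> dist (X (r n)) l" by auto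
  from assms[OF r(1)] obtain s where "(\<lambda>n. X (r (s n))) \<longlonglongrightarrow> l" by blast
  from tendstoD[OF this e(1)] show False
    using r(2) by (simp add: not_less[symmetric])
qed

lemma bounded_family_subseq:
  fixes f :: "nat \<Rightarrow> nat \<Rightarrow> 'b::euclidean_space"
  assumes "\<And>n i. i < m \<Longrightarrow> norm (f n i) \<le> C"
  shows "\<exists>r l. strict_mono (r :: nat \<Rightarrow> nat) \<and> (\<forall>i<m. (\<lambda>n. f (r n) i) \<longlonglongrightarrow> l i)"
  using assms
proof (induction m)
  case 0
  then show ?case by (auto intro!: exI[of _ "\<lambda>n. n"] simp: strict_mono_def)
next
  case (Suc m)
  then obtain r l where r: "strict_mono (r :: nat \<Rightarrow> nat)" "\<And>i. i < m \<Longrightarrow> (\<lambda>n. f (r n) i) \<longlonglongrightarrow> l i"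
    using less_SucI by blast
  have "bounded (range (\<lambda>n. f (r n) m))"
    using Suc.prems[of m] by (auto intro!: boundedI[of _ C])
  then obtain l' s where s: "strict_mono (s :: nat \<Rightarrow> nat)" "((\<lambda>n. f (r n) m) \<circ> s) \<longlonglongrightarrow> l'"
    using bounded_imp_convergent_subsequence by blast
  have "(\<lambda>n. f ((r \<circ> s) n) i) \<longlonglongrightarrow> (if i = m then l' else l i)" if "i < Suc m" for i
    using that s LIMSEQ_subseq_LIMSEQ[OF r(2) s(1), of i] by (auto simp: o_def less_Suc_eq)
  moreover have "strict_mono (r \<circ> s)" using r s by (intro strict_mono_o)
  ultimately show ?case
    by (intro exI[of _ "r \<circ> s"] exI[of _ "\<lambda>i. if i = m then l' else l i"]) blast
qed

lemma tendsto_form: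
  fixes B :: "nat \<Rightarrow> 'b::euclidean_space \<Rightarrow> 'b \<Rightarrow> real"
  assumes "\<And>n. bilinear (B n)" "bilinear B'" "\<And>b b'. (\<lambda>n. B n b b') \<longlonglongrightarrow> B' b b'"
    "u \<longlonglongrightarrow> u'" "v \<longlonglongrightarrow> v'"
  shows "(\<lambda>n. B n (u n) (v n)) \<longlonglongrightarrow> B' u' v'"
proof -
  have "(\<lambda>n. \<Sum>b\<in>Basis. \<Sum>b'\<in>Basis. (u n \<bullet> b) * (v n \<bullet> b') * B n b b') \<longlonglongrightarrow>
      (\<Sum>b\<in>Basis. \<Sum>b'\<in>Basis. (u' \<bullet> b) * (v' \<bullet> b') * B' b b')"
    by (intro tendsto_intros assms)
  then show ?thesis
    unfolding bilinear_expand[OF assms(1), symmetric] bilinear_expand[OF assms(2), symmetric] .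
qed

context chart_metric begin

text \<open>Coercivity at \<open>x\<close> survives with half the constant while the coefficients of
  the metric have changed by less than \<open>c / 2\<close> in total. This bounds orthonormal frames
  at all nearby points uniformly.\<close>

lemma lower_bound_local:
  assumes x: "x \<in> U"
  shows "\<exists>c>0. \<forall>\<^sub>F y in nhds x. \<forall>u. c * norm u ^ 2 \<le> G y u u"
proof -
  interpret inner_form "G x" using x by (rule inner_form)
  obtain c where c: "c > 0" "\<And>u. c * norm u ^ 2 \<le> G x u u" using lower_bound by blast
  define k where "k y = (\<Sum>b\<in>Basis. \<Sum>b'\<in>Basis. \<bar>G y b b' - G x b b'\<bar>)" for y
  have "((\<lambda>y. G y b w) \<longlongrightarrow> G x b w) (at x)" for b w
    using G_continuous[of b w] x open_U by (simp add: continuous_on_eq_continuous_at continuous_at)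
  then have "((\<lambda>y. G y b w) \<longlongrightarrow> G x b w) (nhds x)" for b w
    by (rule tendsto_at_iff_tendsto_nhds[THEN iffD1])
  then have "((\<lambda>y. G y b w - G x b w) \<longlongrightarrow> G x b w - G x b w) (nhds x)" for b w
    by (rule tendsto_diff[OF _ tendsto_const])
  then have k0: "(k \<longlongrightarrow> 0) (nhds x)"
    unfolding k_def by (intro tendsto_null_sum tendsto_rabs_zero) simp
  have "\<forall>\<^sub>F y in nhds x. y \<in> U" using open_U x by (rule eventually_nhds_in_open)
  moreover have "\<forall>\<^sub>F y in nhds x. k y < c / 2"
    using c(1) by (intro order_tendstoD(2)[OF k0]) simp
  ultimately have "\<forall>\<^sub>F y in nhds x. \<forall>u. (c / 2) * norm u ^ 2 \<le> G y u u"
  proof eventually_elim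
    case (elim y)
    show ?case
    proof
      fix u
      have "\<bar>G x u u - G y u u\<bar> = \<bar>\<Sum>b\<in>Basis. \<Sum>b'\<in>Basis. (u \<bullet> b) * (u \<bullet> b') * (G x b b' - G y b b')\<bar>"
        unfolding bilinear_expand[OF bilinear_G[OF x], of u u] bilinear_expand[OF bilinear_G[OF elim(1)], of u u]
        by (simp add: right_diff_distrib sum_subtractf)
      also have "\<dots> \<le> (\<Sum>b\<in>Basis. \<Sum>b'\<in>Basis. norm u ^ 2 * \<bar>G y b b' - G x b b'\<bar>)"
      proof (intro order_trans[OF sum_abs] sum_mono)
        fix b b' :: 'b assume b: "b \<in> Basis" "b' \<in> Basis"
        have "\<bar>u \<bullet> b\<bar> * \<bar>u \<bullet> b'\<bar> \<le> norm u * norm u" using b by (intro mult_mono) (auto simp: Basis_le_norm)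
        then show "\<bar>(u \<bullet> b) * (u \<bullet> b') * (G x b b' - G y b b')\<bar> \<le> norm u ^ 2 * \<bar>G y b b' - G x b b'\<bar>"
          unfolding abs_mult abs_minus_commute[of "G x b b'"] power2_eq_square by (intro mult_right_mono) auto
      qed
      also have "\<dots> = norm u ^ 2 * k y" by (simp add: k_def sum_distrib_left)
      also have "\<dots> \<le> norm u ^ 2 * (c / 2)" using elim(2) by (intro mult_left_mono) auto
      finally show "(c / 2) * norm u ^ 2 \<le> G y u u" using c(2)[of u] unfolding abs_le_iff by (simp add: mult.commute[of c])
    qed
  qed
  then show ?thesis using c(1) by (intro exI[of _ "c / 2"]) simp
qed

lemma tendsto_on_U:
  assumes "continuous_on U f" "\<And>n. X n \<in> U" "x \<in> U" "X \<longlonglongrightarrow> x"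
  shows "(\<lambda>n. f (X n)) \<longlonglongrightarrow> f x"
  using continuous_on_tendsto_compose[OF assms(1,4,3)] assms(2) by simp

text \<open>Compactness of orthonormal frames over a convergent sequence of base points: local
  coercivity bounds the vectors, and the relations \<open>G e e' = 0\<close> or \<open>1\<close>
  pass to the limit.\<close>

lemma frame_limit:
  assumes X: "\<And>n. X n \<in> U" "x \<in> U" "X \<longlonglongrightarrow> x"
    and f: "\<And>n. inner_form.orthonormal (G (X n)) m (f n)"
  shows "\<exists>r l. strict_mono (r :: nat \<Rightarrow> nat) \<and> (\<forall>i<m. (\<lambda>n. f (r n) i) \<longlonglongrightarrow> l i) \<and>
    inner_form.orthonormal (G x) m l"
proof -
  have on: "G (X n) (f n i) (f n j) = (if i = j then 1 else 0)" if "i < m" "j < m" for n i j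
    using f[of n] that inner_form.orthonormal_def[OF inner_form[OF X(1)]] by blast
  obtain c where c: "c > 0" "\<forall>\<^sub>F y in nhds x. \<forall>u. c * norm u ^ 2 \<le> G y u u"
    using lower_bound_local[OF X(2)] by blast
  have "\<forall>\<^sub>F n in sequentially. \<forall>u. c * norm u ^ 2 \<le> G (X n) u u"
    using X(3) c(2) by (rule filterlim_iff[THEN iffD1, rule_format])
  then obtain N where N: "\<And>n u. n \<ge> N \<Longrightarrow> c * norm u ^ 2 \<le> G (X n) u u"
    unfolding eventually_sequentially by blast
  have "norm (f (n + N) i) \<le> sqrt (1 / c)" if "i < m" for n i
    using N[of "n + N" "f (n + N) i"] on[OF that that] c(1)
    by (intro real_le_rsqrt) (simp add: field_simps)
  from bounded_family_subseq[of m "\<lambda>n. f (n + N)", OF this]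
  obtain r l where r: "strict_mono (r :: nat \<Rightarrow> nat)" "\<And>i. i < m \<Longrightarrow> (\<lambda>n. f (r n + N) i) \<longlonglongrightarrow> l i" by blast
  \<comment> \<open>The uniform bound holds from index \<open>N\<close> on, so the subsequence was
    extracted from the shifted sequence.\<close>
  define s where "s n = r n + N" for n
  have s: "strict_mono s" using r(1) by (simp add: s_def strict_mono_def)
  have sl: "(\<lambda>n. f (s n) i) \<longlonglongrightarrow> l i" if "i < m" for i using r(2)[OF that] by (simp add: s_def)
  have Xs: "(\<lambda>n. X (s n)) \<longlonglongrightarrow> x" using LIMSEQ_subseq_LIMSEQ[OF X(3) s] by (simp add: o_def)
  have "G x (l i) (l j) = (if i = j then 1 else 0)" if "i < m" "j < m" for i j
  proof -
    have "(\<lambda>n. G (X (s n)) (f (s n) i) (f (s n) j)) \<longlonglongrightarrow> G x (l i) (l j)"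
      by (rule tendsto_form[OF bilinear_G[OF X(1)] bilinear_G[OF X(2)]
            tendsto_on_U[OF G_continuous X(1) X(2) Xs] sl[OF that(1)] sl[OF that(2)]])
    then show ?thesis unfolding on[OF that] LIMSEQ_const_iff by simp
  qed
  then have "inner_form.orthonormal (G x) m l"
    using inner_form.orthonormal_def[OF inner_form[OF X(2)]] by blast
  then show ?thesis using s sl by blast
qed

end

section \<open>Compactness of the Grassmannian and images of planes\<close>

interpretation eucl: inner_form "(\<bullet>) :: 'b::euclidean_space \<Rightarrow> 'b \<Rightarrow> real"
  by unfold_locales (auto simp: bilinear_def inner_commute inner_add_right inner_add_left intro!: linearI)

text \<open>Viewing the Euclidean product as a constant metric makes \<open>frame_limit\<close>
  available for Euclidean frames.\<close>

lemma eucl_chart_metric: "chart_metric UNIV (\<lambda>x. (\<bullet>) :: 'b::euclidean_space \<Rightarrow> 'b \<Rightarrow> real)"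
  by (rule chart_metric.intro) (auto intro: eucl.inner_form_axioms Ck_on_const simp del: Ck_on.simps)

text \<open>The form in which planes enter \<open>grassmann_topology\<close>. It is the orthogonal
  projection when \<open>S\<close> is a subspace, by \<open>proj_apply\<close>.\<close>

definition proj :: "'b::euclidean_space set \<Rightarrow> 'b \<Rightarrow>\<^sub>L 'b" where
  "proj S = Blinfun (closest_point S)"

lemma closest_point_orthonormal:
  assumes S: "subspace S" "dim S = m" and e: "eucl.orthonormal m e" "\<And>i. i < m \<Longrightarrow> e i \<in> S"
  shows "closest_point S u = (\<Sum>i<m. (u \<bullet> e i) *\<^sub>R e i)"
proof -
  define p where "p = (\<Sum>i<m. (u \<bullet> e i) *\<^sub>R e i)"
  have pS: "p \<in> S" unfolding p_def using S e by (intro subspace_sum subspace_scale) auto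
  have pe: "p \<bullet> e i = u \<bullet> e i" if "i < m" for i
    unfolding p_def by (rule eucl.orthonormal_coeff[OF e(1) that])
  have orth: "(u - p) \<bullet> v = 0" if "v \<in> S" for v
  proof -
    have "v = (\<Sum>i<m. (v \<bullet> e i) *\<^sub>R e i)"
      using eucl.orthonormal_expand[OF e(1)] eucl.orthonormal_span[OF e S] that by blast
    then have "(u - p) \<bullet> v = (u - p) \<bullet> (\<Sum>i<m. (v \<bullet> e i) *\<^sub>R e i)" by (rule arg_cong)
    also have "\<dots> = 0" by (simp add: inner_sum_right inner_diff_left pe)
    finally show ?thesis .
  qed
  have "p = closest_point S u"
  proof (rule closest_point_unique)
    show "convex S" "closed S" using S by (auto simp: subspace_imp_convex closed_subspace)
    show "p \<in> S" by (rule pS)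
    show "\<forall>z\<in>S. dist u p \<le> dist u z"
    proof
      fix z assume z: "z \<in> S"
      have "(norm (u - z))\<^sup>2 = (norm ((u - p) + (p - z)))\<^sup>2" by simp
      also have "\<dots> = (norm (u - p))\<^sup>2 + (norm (p - z))\<^sup>2"
        using orth[OF subspace_diff[OF S(1) pS z]]
        by (intro norm_add_Pythagorean) (simp add: orthogonal_def)
      finally have "(norm (u - p))\<^sup>2 \<le> (norm (u - z))\<^sup>2" by simp
      then show "dist u p \<le> dist u z"
        unfolding dist_norm by (rule power2_le_imp_le) simp
    qed
  qed
  then show ?thesis by (simp add: p_def)
qed

lemma proj_apply:
  assumes "subspace S" shows "blinfun_apply (proj S) = closest_point S"
proof -
  obtain e where e: "eucl.orthonormal (dim S) e" "\<And>i. i < dim S \<Longrightarrow> e i \<in> S"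
    using eucl.ex_orthonormal[OF assms refl] by blast
  have "closest_point S = (\<lambda>u. \<Sum>i<dim S. (u \<bullet> e i) *\<^sub>R e i)"
    using closest_point_orthonormal[OF assms refl e] by blast
  then have "bounded_linear (closest_point S)"
    by (simp add: bounded_linear_sum bounded_linear_scaleR_const bounded_linear_inner_left)
  then show ?thesis by (simp add: proj_def bounded_linear_Blinfun_apply)
qed

lemma proj_apply_eq_iff: "subspace S \<Longrightarrow> blinfun_apply (proj S) v = v \<longleftrightarrow> v \<in> S"
  using closest_point_refl[of S v] subspace_0[of S] by (auto simp: proj_apply closed_subspace)

lemma range_proj: "subspace S \<Longrightarrow> range (blinfun_apply (proj S)) = S"
  using closest_point_in_set[of S] subspace_0[of S] proj_apply_eq_iff[of S]
  by (auto simp: proj_apply closed_subspace) (metis rangeI)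

lemma tendsto_proj:
  assumes S: "\<And>n. subspace (S n)" "\<And>n. dim (S n) = m" "subspace S'" "dim S' = m"
    and f: "\<And>n. eucl.orthonormal m (f n)" "\<And>n i. i < m \<Longrightarrow> f n i \<in> S n"
    and l: "eucl.orthonormal m l" "\<And>i. i < m \<Longrightarrow> l i \<in> S'" "\<And>i. i < m \<Longrightarrow> (\<lambda>n. f n i) \<longlonglongrightarrow> l i"
  shows "(\<lambda>n. proj (S n)) \<longlonglongrightarrow> proj S'"
proof (rule tendsto_componentwise1)
  fix j :: 'a
  have "(\<lambda>n. \<Sum>i<m. (j \<bullet> f n i) *\<^sub>R f n i) \<longlonglongrightarrow> (\<Sum>i<m. (j \<bullet> l i) *\<^sub>R l i)"
    by (intro tendsto_intros l) auto
  then show "(\<lambda>n. blinfun_apply (proj (S n)) j) \<longlonglongrightarrow> blinfun_apply (proj S') j"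
    using closest_point_orthonormal[OF S(1,2) f] closest_point_orthonormal[OF S(3,4) l(1,2)]
    by (simp add: proj_apply S)
qed

text \<open>Membership in a subspace is a fixed-point equation for its projection, and such an
  equation passes to limits.\<close>

lemma proj_fixed_limit:
  assumes "\<And>n. subspace (S n)" "subspace S'" "(\<lambda>n. proj (S n)) \<longlonglongrightarrow> proj S'"
    "\<And>n. v n \<in> S n" "v \<longlonglongrightarrow> w"
  shows "w \<in> S'"
proof -
  have "(\<lambda>n. blinfun_apply (proj (S n)) (v n)) \<longlonglongrightarrow> blinfun_apply (proj S') w"
    by (intro blinfun.tendsto assms)
  moreover have "blinfun_apply (proj (S n)) (v n) = v n" for n
    using assms by (simp add: proj_apply_eq_iff)
  ultimately have "blinfun_apply (proj S') w = w" using assms(5) LIMSEQ_unique by simp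
  then show ?thesis using proj_apply_eq_iff[OF assms(2)] by simp
qed

text \<open>The Grassmannian of m-planes, embedded in the normed space of operators.\<close>

definition projections :: "nat \<Rightarrow> ('b::euclidean_space \<Rightarrow>\<^sub>L 'b) set" where
  "projections m = {proj S |S. subspace S \<and> dim S = m}"

text \<open>Choose an orthonormal frame in each plane. A subsequence of frames converges to a frame,
  whose span is again an m-plane, and projections are continuous functions of frames.\<close>

lemma compact_projections: "compact (projections m :: ('b::euclidean_space \<Rightarrow>\<^sub>L 'b) set)"
  unfolding compact_eq_seq_compact_metric seq_compact_def
proof (intro allI impI)
  fix P :: "nat \<Rightarrow> 'b \<Rightarrow>\<^sub>L 'b" assume "\<forall>n. P n \<in> projections m"
  then have "\<forall>n. \<exists>S. P n = proj S \<and> subspace S \<and> dim S = m" by (auto simp: projections_def)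
  then obtain S where S: "\<And>n. P n = proj (S n)" "\<And>n. subspace (S n)" "\<And>n. dim (S n) = m" by metis
  have "\<exists>e. eucl.orthonormal m e \<and> (\<forall>i<m. e i \<in> S n)" for n
    using eucl.ex_orthonormal[OF S(2,3)] by metis
  then obtain f where f: "\<And>n. eucl.orthonormal m (f n)" "\<And>n i. i < m \<Longrightarrow> f n i \<in> S n" by metis
  interpret chart_metric UNIV "\<lambda>x :: 'b. (\<bullet>) :: 'b \<Rightarrow> 'b \<Rightarrow> real" by (rule eucl_chart_metric)
  obtain r l where r: "strict_mono (r :: nat \<Rightarrow> nat)" "\<And>i. i < m \<Longrightarrow> (\<lambda>n. f (r n) i) \<longlonglongrightarrow> l i"
    "eucl.orthonormal m l"
    using frame_limit[of "\<lambda>_. 0" 0 m f] f by auto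
  define S' where "S' = span (l ` {..<m})"
  have S': "subspace S'" "dim S' = m" "\<And>i. i < m \<Longrightarrow> l i \<in> S'"
    using dim_span_eq_card_independent[OF eucl.orthonormal_independent[OF r(3)]]
      card_image[OF eucl.orthonormal_inj_on[OF r(3)]] by (auto simp: S'_def span_base)
  have "(\<lambda>n. proj (S (r n))) \<longlonglongrightarrow> proj S'"
    by (rule tendsto_proj[OF S(2,3) S'(1,2) f r(3) S'(3) r(2)])
  then have "(P \<circ> r) \<longlonglongrightarrow> proj S'" by (simp add: o_def S(1))
  moreover have "proj S' \<in> projections m" using S' by (auto simp: projections_def)
  ultimately show "\<exists>l\<in>projections m. \<exists>r. strict_mono r \<and> (P \<circ> r) \<longlonglongrightarrow> l" using r(1) by blast
qed

lemma tendsto_proj_image: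
  fixes T :: "nat \<Rightarrow> 'a::euclidean_space \<Rightarrow> 'b::euclidean_space"
  assumes S: "\<And>n. subspace (S n)" "\<And>n. dim (S n) = m" "subspace S'" "dim S' = m"
    and P: "(\<lambda>n. proj (S n)) \<longlonglongrightarrow> proj S'"
    and T: "\<And>n. linear (T n)" "\<And>n v. R n (T n v) = v" "\<And>n v. T n (R n v) = v" "\<And>n. linear (R n)"
      "linear T'" "\<And>v. R' (T' v) = v" "\<And>v. T' (R' v) = v" "linear R'"
      "\<And>v. (\<lambda>n. R n v) \<longlonglongrightarrow> R' v"
  shows "(\<lambda>n. proj (T n ` S n)) \<longlonglongrightarrow> proj (T' ` S')"
proof (rule tendsto_subseqI)
  fix r :: "nat \<Rightarrow> nat" assume r: "strict_mono r"
  have inj: "inj_on (T n) B" "inj_on T' B" for n B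
    by (rule inj_on_inverseI, rule T(2) T(6))+
  have sT: "subspace (T n ` S n)" "dim (T n ` S n) = m" for n
    using dim_image_eq[OF T(1) inj(1)] S(2) by (simp_all add: linear_subspace_image T(1) S(1))
  have sT': "subspace (T' ` S')" "dim (T' ` S') = m"
    using dim_image_eq[OF T(5) inj(2)] S(4) by (simp_all add: linear_subspace_image T(5) S(3))
  have "\<exists>e. eucl.orthonormal m e \<and> (\<forall>i<m. e i \<in> T (r n) ` S (r n))" for n
    using eucl.ex_orthonormal[OF sT] by metis
  then obtain f where f: "\<And>n. eucl.orthonormal m (f n)" "\<And>n i. i < m \<Longrightarrow> f n i \<in> T (r n) ` S (r n)" by metis
  interpret chart_metric UNIV "\<lambda>x :: 'b. (\<bullet>) :: 'b \<Rightarrow> 'b \<Rightarrow> real" by (rule eucl_chart_metric)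
  obtain s l where s: "strict_mono (s :: nat \<Rightarrow> nat)" "\<And>i. i < m \<Longrightarrow> (\<lambda>n. f (s n) i) \<longlonglongrightarrow> l i"
    "eucl.orthonormal m l"
    using frame_limit[of "\<lambda>_. 0" 0 m f] f by auto
  have rs: "strict_mono (r \<circ> s)" using r s(1) by (rule strict_mono_o)
  have Prs: "(\<lambda>n. proj (S (r (s n)))) \<longlonglongrightarrow> proj S'"
    using LIMSEQ_subseq_LIMSEQ[OF P rs] by (simp add: o_def)
  have l: "l i \<in> T' ` S'" if i: "i < m" for i
  proof -
    have "(\<lambda>n. \<Sum>b\<in>Basis. (f (s n) i \<bullet> b) *\<^sub>R R (r (s n)) b) \<longlonglongrightarrow> (\<Sum>b\<in>Basis. (l i \<bullet> b) *\<^sub>R R' b)"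
      using LIMSEQ_subseq_LIMSEQ[OF T(9) rs] by (intro tendsto_intros s(2)[OF i]) (simp add: o_def)
    then have "(\<lambda>n. R (r (s n)) (f (s n) i)) \<longlonglongrightarrow> R' (l i)"
      by (simp only: linear_expand_Basis[OF T(4), symmetric] linear_expand_Basis[OF T(8), symmetric])
    moreover have "R (r (s n)) (f (s n) i) \<in> S (r (s n))" for n
      using f(2)[OF i, of "s n"] T(2) by auto
    ultimately have "R' (l i) \<in> S'"
      by (intro proj_fixed_limit[OF S(1) S(3) Prs, of "\<lambda>n. R (r (s n)) (f (s n) i)"])
    then show ?thesis using T(7) by (metis imageI)
  qed
  have "(\<lambda>n. proj (T (r (s n)) ` S (r (s n)))) \<longlonglongrightarrow> proj (T' ` S')"
    by (rule tendsto_proj[OF sT sT' f(1) f(2) s(3) l s(2)])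
  then show "\<exists>s. strict_mono s \<and> (\<lambda>n. proj (T (r (s n)) ` S (r (s n)))) \<longlonglongrightarrow> proj (T' ` S')"
    using s(1) by blast
qed

section \<open>Traces over varying planes\<close>

context chart_metric begin

definition trace :: "'b \<Rightarrow> 'b set \<Rightarrow> ('b \<Rightarrow> 'b \<Rightarrow> real) \<Rightarrow> real" where
  "trace x S B = inner_form.trace_on (G x) S B"

lemma trace_eq:
  assumes "x \<in> U" "subspace S" "dim S = n" "inner_form.orthonormal (G x) n e" "\<And>i. i < n \<Longrightarrow> e i \<in> S" "bilinear B"
  shows "trace x S B = (\<Sum>i<n. B (e i) (e i))"
  unfolding trace_def by (rule inner_form.trace_on_eq[OF inner_form[OF assms(1)] assms(2-6)])

lemma ex_frame:
  assumes "x \<in> U" "subspace S" "dim S = n"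
  shows "\<exists>e. inner_form.orthonormal (G x) n e \<and> (\<forall>i<n. e i \<in> S)"
  using inner_form.ex_orthonormal[OF inner_form[OF assms(1)] assms(2,3)] by metis

text \<open>Frames in the planes \<open>S n\<close> converge only along subsequences, but each limit
  is an orthonormal frame of \<open>S'\<close>, and all frames of \<open>S'\<close> give the same
  trace.\<close>

lemma tendsto_trace:
  assumes X: "\<And>n. X n \<in> U" "x \<in> U" "X \<longlonglongrightarrow> x"
    and S: "\<And>n. subspace (S n)" "\<And>n. dim (S n) = m" "subspace S'" "dim S' = m"
    and P: "(\<lambda>n. proj (S n)) \<longlonglongrightarrow> proj S'"
    and B: "\<And>x. x \<in> U \<Longrightarrow> bilinear (B x)" "\<And>u v. continuous_on U (\<lambda>x. B x u v)"
  shows "(\<lambda>n. trace (X n) (S n) (B (X n))) \<longlonglongrightarrow> trace x S' (B x)"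
proof (rule tendsto_subseqI)
  fix r :: "nat \<Rightarrow> nat" assume r: "strict_mono r"
  have "\<forall>n. \<exists>e. inner_form.orthonormal (G (X (r n))) m e \<and> (\<forall>i<m. e i \<in> S (r n))"
    using ex_frame[OF X(1) S(1,2)] by blast
  then obtain f where f: "\<And>n. inner_form.orthonormal (G (X (r n))) m (f n)" "\<And>n i. i < m \<Longrightarrow> f n i \<in> S (r n)"
    by metis
  have Xr: "(\<lambda>n. X (r n)) \<longlonglongrightarrow> x" using LIMSEQ_subseq_LIMSEQ[OF X(3) r] by (simp add: o_def)
  obtain s l where s: "strict_mono (s :: nat \<Rightarrow> nat)" "\<And>i. i < m \<Longrightarrow> (\<lambda>n. f (s n) i) \<longlonglongrightarrow> l i"
    "inner_form.orthonormal (G x) m l"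
    using frame_limit[OF X(1,2) Xr f(1)] by blast
  have rs: "strict_mono (r \<circ> s)" using r s(1) by (rule strict_mono_o)
  have Prs: "(\<lambda>n. proj (S (r (s n)))) \<longlonglongrightarrow> proj S'" and Xrs: "(\<lambda>n. X (r (s n))) \<longlonglongrightarrow> x"
    using LIMSEQ_subseq_LIMSEQ[OF P rs] LIMSEQ_subseq_LIMSEQ[OF X(3) rs] by (simp_all add: o_def)
  have l: "l i \<in> S'" if i: "i < m" for i
    by (rule proj_fixed_limit[OF S(1) S(3) Prs f(2)[OF i] s(2)[OF i]])
  have "(\<lambda>n. \<Sum>i<m. B (X (r (s n))) (f (s n) i) (f (s n) i)) \<longlonglongrightarrow> (\<Sum>i<m. B x (l i) (l i))"
    by (intro tendsto_sum tendsto_form[OF B(1)[OF X(1)] B(1)[OF X(2)]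
          tendsto_on_U[OF B(2) X(1) X(2) Xrs]] s(2)) auto
  moreover have "trace (X (r (s n))) (S (r (s n))) (B (X (r (s n)))) = (\<Sum>i<m. B (X (r (s n))) (f (s n) i) (f (s n) i))" for n
    by (rule trace_eq[OF X(1) S(1,2) f B(1)[OF X(1)]])
  moreover have "trace x S' (B x) = (\<Sum>i<m. B x (l i) (l i))"
    by (rule trace_eq[OF X(2) S(3,4) s(3) l B(1)[OF X(2)]])
  ultimately have "(\<lambda>n. trace (X (r (s n))) (S (r (s n))) (B (X (r (s n))))) \<longlonglongrightarrow> trace x S' (B x)" by simp
  then show "\<exists>s. strict_mono s \<and> (\<lambda>n. trace (X (r (s n))) (S (r (s n))) (B (X (r (s n))))) \<longlonglongrightarrow> trace x S' (B x)"
    using s(1) by blast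
qed

text \<open>A plane is encoded by its projection and recovered as the range. The domain thus lies in
  a metric space, where continuity can be tested on sequences.\<close>

lemma continuous_trace:
  assumes B: "\<And>x. x \<in> U \<Longrightarrow> bilinear (B x)" "\<And>u v. continuous_on U (\<lambda>x. B x u v)"
  shows "continuous_on (U \<times> projections m) (\<lambda>(x, P). trace x (range (blinfun_apply P)) (B x))"
  unfolding continuous_on_sequentially
proof (intro allI ballI impI, elim conjE)
  fix z and zs :: "nat \<Rightarrow> 'b \<times> ('b \<Rightarrow>\<^sub>L 'b)"
  assume z: "z \<in> U \<times> projections m" and zs: "\<forall>n. zs n \<in> U \<times> projections m" "zs \<longlonglongrightarrow> z"
  define X where "X n = fst (zs n)" for n
  define x where "x = fst z"
  have "\<forall>n. \<exists>S. snd (zs n) = proj S \<and> subspace S \<and> dim S = m"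
    using zs(1) by (force simp: projections_def mem_Times_iff)
  then obtain S where S: "\<And>n. snd (zs n) = proj (S n)" "\<And>n. subspace (S n)" "\<And>n. dim (S n) = m" by metis
  obtain S' where S': "snd z = proj S'" "subspace S'" "dim S' = m"
    using z by (force simp: projections_def mem_Times_iff)
  have "(\<lambda>n. trace (X n) (S n) (B (X n))) \<longlonglongrightarrow> trace x S' (B x)"
  proof (rule tendsto_trace[OF _ _ _ S(2,3) S'(2,3) _ B])
    show "X n \<in> U" for n using zs(1) by (auto simp: X_def mem_Times_iff)
    show "x \<in> U" using z by (auto simp: x_def)
    show "X \<longlonglongrightarrow> x" unfolding X_def[abs_def] x_def by (rule tendsto_fst[OF zs(2)])
    show "(\<lambda>n. proj (S n)) \<longlonglongrightarrow> proj S'"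
      using tendsto_snd[OF zs(2)] by (simp add: S(1) S'(1))
  qed
  then show "((\<lambda>(x, P). trace x (range (blinfun_apply P)) (B x)) \<circ> zs) \<longlonglongrightarrow>
      (\<lambda>(x, P). trace x (range (blinfun_apply P)) (B x)) z"
    by (simp add: o_def split_beta S(1) S'(1) range_proj S(2) S'(2) X_def x_def)
qed

text \<open>Orthonormal frames at points near \<open>x\<close> accumulate at orthonormal frames at \<open>x\<close>.\<close>

lemma trace_lower_bound_local:
  assumes x: "x \<in> U" and B: "\<And>x. x \<in> U \<Longrightarrow> bilinear (B x)" "\<And>u v. continuous_on U (\<lambda>x. B x u v)"
    and a: "continuous_on U a"
    and gt: "\<And>e. inner_form.orthonormal (G x) m e \<Longrightarrow> a x < (\<Sum>i<m. B x (e i) (e i))"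
  shows "\<exists>\<rho>>0. \<exists>\<eta>>0. \<forall>y\<in>ball x \<rho> \<inter> U. \<forall>S. subspace S \<and> dim S = m \<longrightarrow> a y + \<eta> \<le> trace y S (B y)"
proof (rule ccontr)
  assume neg: "\<not> ?thesis"
  \<comment> \<open>Radius and margin shrink together, so in the limit the violated inequality loses
    its margin and contradicts strictness at \<open>x\<close>.\<close>
  have "\<exists>y S. y \<in> ball x (1 / Suc n) \<inter> U \<and> subspace S \<and> dim S = m \<and> trace y S (B y) < a y + 1 / Suc n" for n
  proof -
    have "(1 :: real) / Suc n > 0" by simp
    then show ?thesis using neg by (meson not_le)
  qed
  then obtain X S where X: "\<And>n. X n \<in> ball x (1 / Suc n) \<inter> U"
    and S: "\<And>n. subspace (S n)" "\<And>n. dim (S n) = m"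
    and lt: "\<And>n. trace (X n) (S n) (B (X n)) < a (X n) + 1 / Suc n" by metis
  have XU: "X n \<in> U" for n using X by blast
  have lim0: "(\<lambda>n. 1 / real (Suc n)) \<longlonglongrightarrow> 0" using LIMSEQ_inverse_real_of_nat by (simp add: inverse_eq_divide)
  have Xx: "X \<longlonglongrightarrow> x"
    unfolding tendsto_dist_iff[of X]
  proof (rule tendsto_sandwich[OF _ _ tendsto_const lim0])
    show "\<forall>\<^sub>F n in sequentially. dist (X n) x \<le> 1 / real (Suc n)"
      using X by (intro always_eventually allI) (simp add: dist_commute less_imp_le)
  qed simp
  have "\<forall>n. \<exists>e. inner_form.orthonormal (G (X n)) m e \<and> (\<forall>i<m. e i \<in> S n)"
    using ex_frame[OF XU S] by blast
  then obtain f where f: "\<And>n. inner_form.orthonormal (G (X n)) m (f n)" "\<And>n i. i < m \<Longrightarrow> f n i \<in> S n"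
    by metis
  obtain s l where s: "strict_mono (s :: nat \<Rightarrow> nat)" "\<And>i. i < m \<Longrightarrow> (\<lambda>n. f (s n) i) \<longlonglongrightarrow> l i"
    "inner_form.orthonormal (G x) m l"
    using frame_limit[OF XU x Xx f(1)] by blast
  have Xs: "(\<lambda>n. X (s n)) \<longlonglongrightarrow> x" and lims: "(\<lambda>n. 1 / real (Suc (s n))) \<longlonglongrightarrow> 0"
    using LIMSEQ_subseq_LIMSEQ[OF Xx s(1)] LIMSEQ_subseq_LIMSEQ[OF lim0 s(1)] by (simp_all add: o_def)
  have "(\<lambda>n. \<Sum>i<m. B (X (s n)) (f (s n) i) (f (s n) i)) \<longlonglongrightarrow> (\<Sum>i<m. B x (l i) (l i))"
    by (intro tendsto_sum tendsto_form[OF B(1)[OF XU] B(1)[OF x]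
          tendsto_on_U[OF B(2) XU x Xs]] s(2)) auto
  moreover have "(\<lambda>n. a (X (s n)) + 1 / real (Suc (s n))) \<longlonglongrightarrow> a x + 0"
    by (intro tendsto_add lims tendsto_on_U[OF a XU x Xs])
  moreover have "(\<Sum>i<m. B (X (s n)) (f (s n) i) (f (s n) i)) \<le> a (X (s n)) + 1 / real (Suc (s n))" for n
    using lt[of "s n"] trace_eq[OF XU S f B(1)[OF XU], of "s n"] by simp
  ultimately have "(\<Sum>i<m. B x (l i) (l i)) \<le> a x + 0"
    by (intro LIMSEQ_le) auto
  then show False using gt[OF s(3)] by simp
qed

end

section \<open>The bundle of planes\<close>

context riemannian_atlas begin

abbreviation plane_bundle :: "nat \<Rightarrow> ('a \<times> 'b set) set" where
  "plane_bundle m \<equiv> {(p, S). subspace S \<and> dim S = m}"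

definition bundle_chart :: "('a, 'b) chart \<Rightarrow> 'a \<times> 'b set \<Rightarrow> 'b \<times> ('b \<Rightarrow>\<^sub>L 'b)" where
  "bundle_chart c = (\<lambda>(p, S). (snd c p, proj (to_chart A c p ` S)))"

lemma openin_bundle_chart:
  assumes "c \<in> A" "open W"
  shows "openin (grassmann_topology A m) {(p, S). p \<in> fst c \<and> subspace S \<and> dim S = m \<and> bundle_chart c (p, S) \<in> W}"
  unfolding grassmann_topology_def bundle_chart_def proj_def prod.case
  by (rule topology_generated_by_Basis) (use assms in blast)

lemma topspace_grassmann: "topspace (grassmann_topology A m) = plane_bundle m"
proof
  show "topspace (grassmann_topology A m) \<subseteq> plane_bundle m"
    unfolding grassmann_topology_def topology_generated_by_topspace by auto
  show "plane_bundle m \<subseteq> topspace (grassmann_topology A m)"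
  proof
    fix z assume z: "z \<in> plane_bundle m"
    obtain p S where [simp]: "z = (p, S)" by fastforce
    have "openin (grassmann_topology A m) {(q, S). q \<in> fst (chart_at A p) \<and> subspace S \<and> dim S = m \<and> bundle_chart (chart_at A p) (q, S) \<in> UNIV}"
      by (rule openin_bundle_chart[OF chart_at(1) open_UNIV])
    from openin_subset[OF this] show "z \<in> topspace (grassmann_topology A m)"
      using z chart_at(2) by auto
  qed
qed

text \<open>In other words, the projection of the bundle to its base is continuous. One generating
  set per chart is needed, since \<open>B\<close> need not lie in the domain of a single
  chart.\<close>

lemma openin_fiber:
  assumes B: "open B"
  shows "openin (grassmann_topology A m) {(p, S). p \<in> B \<and> subspace S \<and> dim S = m}"
proof -
  have "openin (grassmann_topology A m) {(p, S). p \<in> fst c \<and> subspace S \<and> dim S = m \<and>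
      bundle_chart c (p, S) \<in> (snd c ` (fst c \<inter> B)) \<times> UNIV}" (is "openin _ (?F c)") if c: "c \<in> A" for c
  proof (rule openin_bundle_chart[OF c])
    interpret c: chart_map c using c atlas_chart by unfold_locales auto
    show "open ((snd c ` (fst c \<inter> B)) \<times> (UNIV :: ('b \<Rightarrow>\<^sub>L 'b) set))"
      by (intro open_Times c.open_chart_image B open_UNIV)
  qed
  then have "openin (grassmann_topology A m) (\<Union>c\<in>A. ?F c)" by (intro openin_Union) auto
  moreover have "(\<Union>c\<in>A. ?F c) = {(p, S). p \<in> B \<and> subspace S \<and> dim S = m}"
  proof (intro subset_antisym subsetI)
    fix z assume "z \<in> (\<Union>c\<in>A. ?F c)"
    then obtain c p S where c: "c \<in> A" "z = (p, S)" "p \<in> fst c" "subspace S" "dim S = m"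
      "snd c p \<in> snd c ` (fst c \<inter> B)" by (auto simp: bundle_chart_def)
    interpret c: chart_map c using c atlas_chart by unfold_locales auto
    have "p \<in> B" using c(3,6) c.mem_image_iff[of "snd c p" B] by simp
    then show "z \<in> {(p, S). p \<in> B \<and> subspace S \<and> dim S = m}" using c by simp
  next
    fix z :: "'a \<times> 'b set" assume "z \<in> {(p, S). p \<in> B \<and> subspace S \<and> dim S = m}"
    then obtain p S where z: "z = (p, S)" "p \<in> B" "subspace S" "dim S = m" by auto
    have "pt p \<in> snd (chart_at A p) ` (fst (chart_at A p) \<inter> B)" using chart_at(2)[of p] z(2) by blast
    then have "z \<in> ?F (chart_at A p)"
      unfolding z(1) mem_Collect_eq prod.case bundle_chart_def mem_Times_iff fst_conv
      by (intro conjI chart_at z UNIV_I)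
    then show "z \<in> (\<Union>c\<in>A. ?F c)" by (rule UN_I[OF chart_at(1)])
  qed
  ultimately show ?thesis by simp
qed

lemma to_chart_image:
  assumes "c \<in> A" "p \<in> fst c" "subspace S" "dim S = m"
  shows "subspace (to_chart A c p ` S)" "dim (to_chart A c p ` S) = m"
proof -
  have "inj (to_chart A c p)" by (rule inj_on_inverseI[where g = "from_chart A c p"]) (simp add: assms)
  then show "subspace (to_chart A c p ` S)" "dim (to_chart A c p ` S) = m"
    using linear_to_chart[OF assms(1,2)] assms(3,4) dim_image_eq[of "to_chart A c p" S]
    by (auto simp: linear_subspace_image intro: inj_on_subset)
qed

lemma from_chart_image:
  assumes "c \<in> A" "p \<in> fst c" "subspace S" "dim S = m"
  shows "subspace (from_chart A c p ` S)" "dim (from_chart A c p ` S) = m"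
proof -
  have "inj (from_chart A c p)" by (rule inj_on_inverseI[where g = "to_chart A c p"]) (simp add: assms)
  then show "subspace (from_chart A c p ` S)" "dim (from_chart A c p ` S) = m"
    using linear_from_chart[OF assms(1,2)] assms(3,4) dim_image_eq[of "from_chart A c p" S]
    by (auto simp: linear_subspace_image intro: inj_on_subset)
qed

text \<open>The change of bundle coordinates moves a plane by the transition derivative at its base
  point. The inverse of that map is the derivative of the opposite coordinate change, hence
  continuous in the point, as \<open>tendsto_proj_image\<close> requires.\<close>

lemma continuous_bundle_transition:
  assumes c: "c \<in> A" and d: "d \<in> A"
  defines "W \<equiv> snd c ` (fst c \<inter> fst d)"
  shows "continuous_on (W \<times> projections m)
    (\<lambda>(x, P). (snd d (chart_inv c x), proj (transition_deriv c d x ` range (blinfun_apply P))))"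
  unfolding continuous_on_sequentially
proof (intro allI ballI impI, elim conjE)
  interpret c: chart_map c using c atlas_chart by unfold_locales auto
  interpret d: chart_map d using d atlas_chart by unfold_locales auto
  have comp: "C2_compatible c d" by (rule atlas_compatible[OF c d])
  fix z and zs :: "nat \<Rightarrow> 'b \<times> ('b \<Rightarrow>\<^sub>L 'b)"
  assume z: "z \<in> W \<times> projections m" and zs: "\<forall>n. zs n \<in> W \<times> projections m" "zs \<longlonglongrightarrow> z"
  define X where "X n = fst (zs n)" for n
  define x where "x = fst z"
  define \<phi> where "\<phi> = snd d \<circ> chart_inv c"
  have XW: "X n \<in> W" "x \<in> W" for n using z zs(1) by (auto simp: X_def x_def mem_Times_iff)
  have Xx: "X \<longlonglongrightarrow> x" unfolding X_def[abs_def] x_def by (rule tendsto_fst[OF zs(2)])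
  have W: "open W" unfolding W_def by (rule c.open_chart_image[OF d.open_dom])
  have \<phi>W: "\<phi> y \<in> snd d ` (fst c \<inter> fst d)" if "y \<in> W" for y using that by (auto simp: \<phi>_def W_def)
  have 1: "Ck_on 2 W \<phi>" using Ck_on_transition[OF comp] by (simp add: \<phi>_def W_def)
  have 2: "Ck_on 2 (snd d ` (fst c \<inter> fst d)) (snd c \<circ> chart_inv d)"
    using Ck_on_transition[OF C2_compatible_sym[OF comp]] by (simp add: Int_commute)
  have \<phi>X: "(\<lambda>n. \<phi> (X n)) \<longlonglongrightarrow> \<phi> x"
    using continuous_on_tendsto_compose[OF Ck_on_imp_continuous_on[OF 1] Xx XW(2)] XW(1) by simp
  have cont: "continuous_on (snd d ` (fst c \<inter> fst d)) (\<lambda>y. transition_deriv d c y v)" for v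
    unfolding transition_deriv_def
    using 2 by (intro Ck_on_imp_continuous_on[of 1] Ck_on_frechet_derivative) (simp add: numeral_2_eq_2)
  have lim: "(\<lambda>n. transition_deriv d c (\<phi> (X n)) v) \<longlonglongrightarrow> transition_deriv d c (\<phi> x) v" for v
    using continuous_on_tendsto_compose[OF cont \<phi>X \<phi>W[OF XW(2)]] \<phi>W[OF XW(1)] by simp
  have facts: "linear (transition_deriv c d y)" "linear (transition_deriv d c (\<phi> y))"
    "transition_deriv d c (\<phi> y) (transition_deriv c d y v) = v"
    "transition_deriv c d y (transition_deriv d c (\<phi> y) v) = v" if "y \<in> W" for y v
  proof -
    obtain q where q: "q \<in> fst c" "q \<in> fst d" "y = snd c q" using \<open>y \<in> W\<close> by (auto simp: W_def)
    have "\<phi> y = snd d q" using q by (simp add: \<phi>_def)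
    then show "linear (transition_deriv c d y)" "linear (transition_deriv d c (\<phi> y))"
      "transition_deriv d c (\<phi> y) (transition_deriv c d y v) = v"
      "transition_deriv c d y (transition_deriv d c (\<phi> y) v) = v"
      using linear_transition_deriv[OF comp q(1,2)] transition_deriv_inverse[OF comp q(1,2)]
        linear_transition_deriv[OF C2_compatible_sym[OF comp] q(2,1)]
        transition_deriv_inverse[OF C2_compatible_sym[OF comp] q(2,1)] q(3) by simp_all
  qed
  have "\<forall>n. \<exists>S. snd (zs n) = proj S \<and> subspace S \<and> dim S = m"
    using zs(1) by (force simp: projections_def mem_Times_iff)
  then obtain S where S: "\<And>n. snd (zs n) = proj (S n)" "\<And>n. subspace (S n)" "\<And>n. dim (S n) = m" by metis
  obtain S' where S': "snd z = proj S'" "subspace S'" "dim S' = m"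
    using z by (force simp: projections_def mem_Times_iff)
  have "(\<lambda>n. proj (S n)) \<longlonglongrightarrow> proj S'" using tendsto_snd[OF zs(2)] by (simp add: S(1) S'(1))
  from tendsto_proj_image[OF S(2,3) S'(2,3) this, of "\<lambda>n. transition_deriv c d (X n)" "\<lambda>n. transition_deriv d c (\<phi> (X n))"
      "transition_deriv c d x" "transition_deriv d c (\<phi> x)"]
  have "(\<lambda>n. proj (transition_deriv c d (X n) ` S n)) \<longlonglongrightarrow> proj (transition_deriv c d x ` S')"
    using facts XW lim by blast
  with \<phi>X have "(\<lambda>n. (\<phi> (X n), proj (transition_deriv c d (X n) ` S n))) \<longlonglongrightarrow> (\<phi> x, proj (transition_deriv c d x ` S'))"
    by (rule tendsto_Pair)
  then show "((\<lambda>(x, P). (snd d (chart_inv c x), proj (transition_deriv c d x ` range (blinfun_apply P)))) \<circ> zs) \<longlonglongrightarrow>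
      (\<lambda>(x, P). (snd d (chart_inv c x), proj (transition_deriv c d x ` range (blinfun_apply P)))) z"
    by (simp add: o_def split_beta S(1) S'(1) range_proj S(2) S'(2) X_def x_def \<phi>_def)
qed

text \<open>The set is the image of \<open>K\<close> times the Grassmannian under inverse bundle
  coordinates, and both factors are compact. Continuity has to be checked on generators of the
  topology coming from arbitrary charts \<open>d\<close>, which is where the bundle transitions
  enter.\<close>

lemma compactin_fiber:
  assumes c: "c \<in> A" and K: "compact K" "K \<subseteq> chart_image c"
  shows "compactin (grassmann_topology A m) {(p, S). p \<in> chart_inv c ` K \<and> subspace S \<and> dim S = m}"
proof -
  interpret c: chart_map c using c atlas_chart by unfold_locales auto
  define R where "R = K \<times> (projections m :: ('b \<Rightarrow>\<^sub>L 'b) set)"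
  define \<Psi> where "\<Psi> = (\<lambda>(x, P). (chart_inv c x, from_chart A c (chart_inv c x) ` range (blinfun_apply P :: 'b \<Rightarrow> 'b)))"
  have \<Psi>R: "fst (\<Psi> z) \<in> fst c \<and> subspace (snd (\<Psi> z)) \<and> dim (snd (\<Psi> z)) = m" if z: "z \<in> R" for z
  proof -
    obtain x S where S: "z = (x, proj S)" "x \<in> K" "subspace S" "dim S = m"
      using z by (auto simp: R_def projections_def)
    have "chart_inv c x \<in> fst c" using S K by auto
    from this from_chart_image[OF c this S(3,4)] show ?thesis
      using S by (simp add: \<Psi>_def range_proj)
  qed
  have "continuous_map (top_of_set R) (grassmann_topology A m) \<Psi>"
    unfolding grassmann_topology_def
  proof (rule continuous_on_generated_topo)
    fix Q assume "Q \<in> {{(p, S). p \<in> fst c \<and> subspace S \<and> dim S = m \<and>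
         (snd c p, Blinfun (closest_point (to_chart A c p ` S))) \<in> W} |c W. c \<in> A \<and> open W}"
    then obtain d W where d: "d \<in> A" "open W"
      and Q: "Q = {(p, S). p \<in> fst d \<and> subspace S \<and> dim S = m \<and> bundle_chart d (p, S) \<in> W}"
      by (auto simp: bundle_chart_def proj_def)
    interpret d: chart_map d using d atlas_chart by unfold_locales auto
    define D where "D = snd c ` (fst c \<inter> fst d)"
    define f where "f = (\<lambda>(x, P). (snd d (chart_inv c x), proj (transition_deriv c d x ` range (blinfun_apply P :: 'b \<Rightarrow> 'b))))"
    have D: "open D" unfolding D_def by (rule c.open_chart_image[OF d.open_dom])
    \<comment> \<open>Read in the bundle chart of \<open>d\<close>, the map \<open>\<Psi>\<close> is
      the transition \<open>f\<close>, but only over the overlap \<open>D\<close>; intersecting with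
      \<open>D \<times> UNIV\<close> expresses that the base point lies in the domain of
      \<open>d\<close>.\<close>
    have eq: "\<Psi> -` Q \<inter> R = (R \<inter> D \<times> UNIV) \<inter> f -` W"
    proof (rule set_eqI)
      fix z
      show "z \<in> \<Psi> -` Q \<inter> R \<longleftrightarrow> z \<in> (R \<inter> D \<times> UNIV) \<inter> f -` W"
      proof (cases "z \<in> R")
        case True
        obtain x P where z: "z = (x, P)" by fastforce
        have x: "x \<in> chart_image c" using True K by (auto simp: R_def z)
        define p where "p = chart_inv c x"
        have p: "p \<in> fst c" "x = snd c p" using x by (auto simp: p_def)
        have xD: "x \<in> D \<longleftrightarrow> p \<in> fst d" unfolding D_def p_def using c.mem_image_iff x by simp
        have im: "to_chart A d p (from_chart A c p v) = transition_deriv c d x v" if "p \<in> fst d" for v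
          using transition_to_chart[OF c d(1) p(1) that, of "from_chart A c p v"] p c by simp
        have "bundle_chart d (\<Psi> z) = f z" if "p \<in> fst d"
          unfolding z \<Psi>_def f_def bundle_chart_def prod.case p_def[symmetric] image_image im[OF that] ..
        moreover have "\<Psi> z \<in> Q \<longleftrightarrow> p \<in> fst d \<and> bundle_chart d (\<Psi> z) \<in> W"
          using \<Psi>R[OF True] by (auto simp: Q \<Psi>_def z p_def)
        ultimately show ?thesis using True xD by (auto simp: z)
      qed simp
    qed
    have "continuous_on (R \<inter> D \<times> UNIV) f"
      unfolding f_def D_def
      by (rule continuous_on_subset[OF continuous_bundle_transition[OF c d(1)]]) (auto simp: R_def)
    then have "openin (top_of_set (R \<inter> D \<times> UNIV)) ((R \<inter> D \<times> UNIV) \<inter> f -` W)"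
      using d(2) by (rule continuous_openin_preimage_gen)
    moreover have "openin (top_of_set R) (R \<inter> D \<times> UNIV)"
      using D by (intro openin_open_Int open_Times) auto
    ultimately have "openin (top_of_set R) ((R \<inter> D \<times> UNIV) \<inter> f -` W)" by (rule openin_trans)
    then show "openin (top_of_set R) (\<Psi> -` Q \<inter> topspace (top_of_set R))" using eq by simp
  next
    have "\<Psi> ` R \<subseteq> topspace (grassmann_topology A m)"
      unfolding topspace_grassmann using \<Psi>R by (auto simp: split_beta) (metis snd_conv)+
    then show "\<Psi> ` topspace (top_of_set R) \<subseteq> \<Union> {{(p, S). p \<in> fst c \<and> subspace S \<and> dim S = m \<and>
         (snd c p, Blinfun (closest_point (to_chart A c p ` S))) \<in> W} |c W. c \<in> A \<and> open W}"
      unfolding grassmann_topology_def topology_generated_by_topspace by simp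
  qed
  moreover have "compactin (top_of_set R) R"
    using compact_Times[OF K(1) compact_projections] by (simp add: R_def compactin_subtopology)
  ultimately have "compactin (grassmann_topology A m) (\<Psi> ` R)" by (rule image_compactin[rotated])
  moreover have "\<Psi> ` R = {(p, S). p \<in> chart_inv c ` K \<and> subspace S \<and> dim S = m}"
  proof (intro subset_antisym subsetI)
    fix w assume "w \<in> \<Psi> ` R"
    then obtain z where z: "z \<in> R" "w = \<Psi> z" by blast
    have "fst w \<in> chart_inv c ` K" using z by (auto simp: R_def \<Psi>_def)
    then show "w \<in> {(p, S). p \<in> chart_inv c ` K \<and> subspace S \<and> dim S = m}" using \<Psi>R[OF z(1)] z(2) by (simp add: split_beta mem_Times_iff)
  next
    fix w :: "'a \<times> 'b set" assume "w \<in> {(p, S). p \<in> chart_inv c ` K \<and> subspace S \<and> dim S = m}"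
    then obtain x S where w: "w = (chart_inv c x, S)" "x \<in> K" "subspace S" "dim S = m" by auto
    have dom: "chart_inv c x \<in> fst c" using w K by auto
    let ?S = "to_chart A c (chart_inv c x) ` S"
    note S = to_chart_image[OF c dom w(3,4)]
    have "from_chart A c (chart_inv c x) ` ?S = S" using c dom by (simp add: image_image)
    then have "w = \<Psi> (x, proj ?S)"
      by (simp only: \<Psi>_def w(1) prod.case range_proj[OF S(1)])
    moreover have "(x, proj ?S) \<in> R" using S w by (auto simp: R_def projections_def)
    ultimately show "w \<in> \<Psi> ` R" by blast
  qed
  ultimately show ?thesis by simp
qed

text \<open>The map \<open>to_chart\<close> is an isometry from \<open>g p\<close> to the metric in
  the chart, so it carries orthonormal frames of \<open>S\<close> to orthonormal frames of the image
  plane. Basis independence of the trace removes the choice of frame.\<close>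

lemma plane_divergence_in_chart:
  assumes c: "c \<in> A" "p \<in> fst c" and X: "C1_vectorfield A X" and S: "subspace S" "dim S = m"
  shows "plane_divergence A g X p S =
    chart_metric.trace (mc c) (snd c p) (to_chart A c p ` S)
      (\<lambda>u v. mc c (snd c p) (covc c (field_in_chart A c X) (snd c p) u) v)"
proof -
  interpret c: chart_map c using c atlas_chart by unfold_locales auto
  interpret mc: chart_metric "chart_image c" "mc c" using c by (intro chart_metric_chart)
  interpret gp: inner_form "g p" by (rule inner_form_metric)
  define x where "x = snd c p"
  have x: "x \<in> chart_image c" using c by (simp add: x_def)
  define Y where "Y = field_in_chart A c X"
  have Y: "Ck_on 1 (chart_image c) Y" using X c by (simp add: C1_vectorfield_def Y_def del: Ck_on.simps One_nat_def)
  then have dY: "Y differentiable (at x)" using x by simp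
  define B where "B = (\<lambda>u v. mc c x (covc c Y x u) v)"
  have B: "bilinear B"
    using mc.linear_cov[OF x dY] mc.bilinear_G[OF x]
    unfolding bilinear_def B_def by (auto intro: linear_compose[unfolded o_def])
  define B' where "B' = (\<lambda>u v. g p (cov_deriv A g X p u) v)"
  have BB': "B' u v = B (to_chart A c p u) (to_chart A c p v)" for u v
    unfolding B_def B'_def Y_def x_def cov_deriv_in_chart[OF c X] metric_to_chart[OF c] ..
  note lt = linear_to_chart[OF c]
  have B': "bilinear B'"
    using B unfolding bilinear_def BB' by (auto intro: linear_compose[OF lt, unfolded o_def])
  obtain e where e: "gp.orthonormal m e" "\<And>i. i < m \<Longrightarrow> e i \<in> S"
    using gp.ex_orthonormal[OF S] by blast
  define f where "f i = to_chart A c p (e i)" for i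
  have on: "inner_form.orthonormal (mc c x) m f"
    unfolding inner_form.orthonormal_def[OF mc.inner_form[OF x]]
    unfolding f_def x_def metric_to_chart[OF c] using e(1) by (simp add: gp.orthonormal_def)
  have "mc.trace x (to_chart A c p ` S) B = (\<Sum>i<m. B (f i) (f i))"
    by (rule mc.trace_eq[OF x to_chart_image[OF c S] on _ B]) (simp add: f_def e(2))
  also have "\<dots> = gp.trace_on S B'"
    using gp.trace_on_eq[OF S e B'] by (simp add: BB' f_def)
  also have "\<dots> = plane_divergence A g X p S"
    by (simp add: gp.trace_on_def plane_divergence_def B'_def)
  finally show ?thesis by (simp add: B_def x_def Y_def)
qed

end

section \<open>Varifolds\<close>

lemma (in chart_metric) cov_cong:
  assumes "x \<in> U" "Y differentiable (at x)" "\<And>y. y \<in> U \<Longrightarrow> Y y = Z y"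
  shows "cov Y x = cov Z x"
  using frechet_derivative_transform_within_open[OF assms(2) open_U assms(1,3)] assms(1,3)
  by (simp add: cov_def[abs_def])

locale varifold_on = riemannian_atlas A g
  for A :: "('a::{t2_space, second_countable_topology}, 'b::euclidean_space) chart set" and g +
  fixes m :: nat and V :: "('a \<times> 'b set) measure"
  assumes varifold: "varifold A m V"
begin

lemma space_V: "space V = plane_bundle m"
  using varifold by (simp add: varifold_def topspace_grassmann)

lemma openin_sets_V: "openin (grassmann_topology A m) Q \<Longrightarrow> Q \<in> sets V"
  using varifold by (auto simp: varifold_def)

lemma fst_vimage: "fst -` B \<inter> space V = {(p, S). p \<in> B \<and> subspace S \<and> dim S = m}"
  by (auto simp: space_V)

lemma measurable_fst_V: "fst \<in> measurable V borel"
proof (rule borel_measurableI)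
  fix B :: "'a set" assume "open B"
  then show "fst -` B \<inter> space V \<in> sets V"
    unfolding fst_vimage by (intro openin_sets_V openin_fiber)
qed

lemma emeasure_weight: "B \<in> sets borel \<Longrightarrow> emeasure (weight V) B = emeasure V (fst -` B \<inter> space V)"
  unfolding weight_def by (rule emeasure_distr[OF measurable_fst_V])

lemma sets_weight [simp]: "sets (weight V) = sets borel" and space_weight [simp]: "space (weight V) = UNIV"
  by (simp_all add: weight_def)

lemma emeasure_compact_finite:
  assumes "c \<in> A" "compact K" "K \<subseteq> chart_image c"
  shows "emeasure V (fst -` (chart_inv c ` K) \<inter> space V) < \<infinity>"
  unfolding fst_vimage using compactin_fiber[OF assms] varifold by (simp add: varifold_def)

lemma closed_support: "closed (varifold_support V)"
proof -
  have "- varifold_support V = \<Union>{U. open U \<and> emeasure (weight V) U = 0}"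
    by (auto simp: varifold_support_def)
  then show ?thesis unfolding closed_def by auto
qed

text \<open>By second countability the complement of the support is covered by countably many basis
  sets of measure zero.\<close>

lemma AE_support: "AE p in weight V. p \<in> varifold_support V"
proof -
  obtain \<B> :: "'a set set" where \<B>: "countable \<B>" "topological_basis \<B>"
    using ex_countable_basis by blast
  define N where "N = \<Union>{B\<in>\<B>. emeasure (weight V) B = 0}"
  have "N \<in> null_sets (weight V)"
    unfolding N_def
  proof (intro null_sets_UN'[where N = "\<lambda>B. B", simplified])
    show "countable {B \<in> \<B>. emeasure (weight V) B = 0}" using \<B>(1) by simp
    show "B \<in> null_sets (weight V)" if "B \<in> {B \<in> \<B>. emeasure (weight V) B = 0}" for B
      using that topological_basis_open[OF \<B>(2)] by (auto simp: null_sets_def)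
  qed
  moreover have "p \<in> N" if p: "p \<notin> varifold_support V" for p
  proof -
    obtain U where U: "open U" "p \<in> U" "emeasure (weight V) U = 0"
      using p by (auto simp: varifold_support_def)
    obtain B where B: "B \<in> \<B>" "p \<in> B" "B \<subseteq> U" using topological_basisE[OF \<B>(2) U(1,2)] .
    have "emeasure (weight V) B = 0" using emeasure_mono[of B U "weight V"] B U by simp
    then show ?thesis using B by (auto simp: N_def)
  qed
  ultimately show ?thesis by (intro AE_I'[of N]) auto
qed

lemma measurable_bundle_chart:
  assumes c: "c \<in> A"
  shows "bundle_chart c \<in> measurable (restrict_space V (fst -` fst c \<inter> space V))
    (restrict_space borel (chart_image c \<times> projections m))"
proof (rule measurable_restrict_space2)
  interpret c: chart_map c using c atlas_chart by unfold_locales auto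
  show "bundle_chart c \<in> space (restrict_space V (fst -` fst c \<inter> space V)) \<rightarrow> chart_image c \<times> projections m"
  proof
    fix z assume "z \<in> space (restrict_space V (fst -` fst c \<inter> space V))"
    then obtain p S where z: "z = (p, S)" "p \<in> fst c" "subspace S" "dim S = m"
      by (auto simp: space_restrict_space fst_vimage)
    show "bundle_chart c z \<in> chart_image c \<times> projections m"
      using z to_chart_image[OF c z(2,3,4)] by (auto simp: bundle_chart_def projections_def)
  qed
  show "bundle_chart c \<in> borel_measurable (restrict_space V (fst -` fst c \<inter> space V))"
  proof (rule borel_measurableI)
    fix W :: "('b \<times> ('b \<Rightarrow>\<^sub>L 'b)) set" assume W: "open W"
    have "bundle_chart c -` W \<inter> (fst -` fst c \<inter> space V) =
        {(p, S). p \<in> fst c \<and> subspace S \<and> dim S = m \<and> bundle_chart c (p, S) \<in> W}"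
      unfolding fst_vimage by auto
    also have "\<dots> \<in> sets V" by (intro openin_sets_V openin_bundle_chart c W)
    finally have 1: "bundle_chart c -` W \<inter> (fst -` fst c \<inter> space V) \<in> sets V" .
    have 2: "fst -` fst c \<inter> space V \<in> sets V"
      by (rule measurable_sets[OF measurable_fst_V]) (use c.open_dom in auto)
    have 3: "space (restrict_space V (fst -` fst c \<inter> space V)) = fst -` fst c \<inter> space V"
      by (simp add: space_restrict_space)
    show "bundle_chart c -` W \<inter> space (restrict_space V (fst -` fst c \<inter> space V))
        \<in> sets (restrict_space V (fst -` fst c \<inter> space V))"
      unfolding 3 using 1 2 by (subst sets_restrict_space_iff) auto
  qed
qed

text \<open>In bundle coordinates the divergence is a continuous function of point and plane, hence
  measurable, and bounded over the compact set \<open>K \<times> projections m\<close>. It vanishes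
  off the part of the bundle over the image of \<open>K\<close>, which has finite mass.
  Integrability must be known before \<open>first_variation\<close> can be estimated, since a
  non-integrable function has integral 0 by convention.\<close>

lemma integrable_plane_divergence:
  assumes c: "c \<in> A" and K: "compact K" "K \<subseteq> chart_image c"
    and X: "C1_vectorfield A X" "\<And>p. p \<notin> chart_inv c ` K \<Longrightarrow> X p = 0"
  shows "integrable V (\<lambda>(p, S). plane_divergence A g X p S)"
proof -
  interpret c: chart_map c using c atlas_chart by unfold_locales auto
  interpret mc: chart_metric "chart_image c" "mc c" using c by (intro chart_metric_chart)
  define Y where "Y = field_in_chart A c X"
  have Y: "Ck_on 1 (chart_image c) Y" using X(1) c by (simp add: C1_vectorfield_def Y_def del: Ck_on.simps One_nat_def)
  define B where "B x = (\<lambda>u v. mc c x (covc c Y x u) v)" for x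
  define D where "D = (\<lambda>(x, P :: 'b \<Rightarrow>\<^sub>L 'b). mc.trace x (range (blinfun_apply P)) (B x))"
  have B: "bilinear (B x)" if x: "x \<in> chart_image c" for x
    using mc.linear_cov[OF x, of Y] mc.bilinear_G[OF x] Ck_on_differentiable[of 0 "chart_image c" Y x] Y x
    unfolding bilinear_def B_def by (auto intro: linear_compose[unfolded o_def])
  have Bc: "continuous_on (chart_image c) (\<lambda>x. B x u v)" for u v
    unfolding B_def
    by (rule mc.continuous_on_form[OF subset_refl mc.G_continuous mc.bilinear_G mc.continuous_cov[OF Y] continuous_on_const])
  have D: "continuous_on (chart_image c \<times> projections m) D"
    unfolding D_def by (rule mc.continuous_trace[OF B Bc])
  define \<delta> where "\<delta> = (\<lambda>z :: 'a \<times> 'b set. plane_divergence A g X (fst z) (snd z))"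
  define K' where "K' = chart_inv c ` K"
  define \<Omega> where "\<Omega> = fst -` fst c \<inter> space V"
  have K'c: "compact K'" unfolding K'_def by (rule compact_chart_inv_image[OF c K])
  then have K': "closed K'" "K' \<in> sets borel" by (simp_all add: compact_imp_closed borel_closed)
  have K'sub: "K' \<subseteq> fst c" using K by (auto simp: K'_def)
  have \<Omega>: "\<Omega> \<in> sets V" unfolding \<Omega>_def fst_vimage by (intro openin_sets_V openin_fiber c.open_dom)
  have \<delta>0: "\<delta> z = 0" if "fst z \<notin> K'" for z
  proof -
    interpret gp: inner_form "g (fst z)" by (rule inner_form_metric)
    have "cov_deriv A g X (fst z) u = 0" for u
      by (rule cov_deriv_local_zero[of "- K'"]) (use K' that X(2) in \<open>auto simp: K'_def[symmetric]\<close>)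
    then show ?thesis by (simp add: \<delta>_def plane_divergence_def gp.G_simps)
  qed
  have \<delta>D: "\<delta> z = D (bundle_chart c z)" if z\<Omega>: "z \<in> \<Omega>" for z
  proof -
    obtain p S where z: "z = (p, S)" "p \<in> fst c" "subspace S" "dim S = m"
      using z\<Omega> by (auto simp: \<Omega>_def fst_vimage)
    show ?thesis
      using plane_divergence_in_chart[OF c z(2) X(1) z(3,4)] to_chart_image[OF c z(2-4)]
      by (simp add: z(1) \<delta>_def D_def bundle_chart_def range_proj B_def Y_def)
  qed
  have "bundle_chart c \<in> measurable (restrict_space V \<Omega>) (restrict_space borel (chart_image c \<times> projections m))"
    unfolding \<Omega>_def by (rule measurable_bundle_chart[OF c])
  from measurable_compose[OF this borel_measurable_continuous_on_restrict[OF D]]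
  have "(\<lambda>z. D (bundle_chart c z)) \<in> borel_measurable (restrict_space V \<Omega>)" .
  then have "(\<lambda>z. D (bundle_chart c z) * indicator \<Omega> z) \<in> borel_measurable V"
    using \<Omega> by (subst (asm) borel_measurable_restrict_space_iff) (auto simp: sets.Int_space_eq2 mult.commute)
  moreover have "D (bundle_chart c z) * indicator \<Omega> z = \<delta> z" if "z \<in> space V" for z
    using \<delta>D[of z] \<delta>0[of z] K'sub that by (cases "z \<in> \<Omega>") (auto simp: \<Omega>_def)
  ultimately have meas: "\<delta> \<in> borel_measurable V"
    by (subst measurable_cong[where g = "\<lambda>z. D (bundle_chart c z) * indicator \<Omega> z"]) auto
  have "compact (D ` (K \<times> projections m))"
    using K compact_projections by (intro compact_continuous_image[OF continuous_on_subset[OF D]] compact_Times) auto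
  then obtain C where C: "\<And>w. w \<in> K \<times> projections m \<Longrightarrow> \<bar>D w\<bar> \<le> C"
    using compact_imp_bounded[of "D ` (K \<times> projections m)"] by (auto simp: bounded_iff)
  have "integrable V (\<lambda>z. C * indicator (fst -` K' \<inter> space V) z)"
  proof (intro integrable_mult_right integrable_real_indicator)
    show "fst -` K' \<inter> space V \<in> sets V" by (rule measurable_sets[OF measurable_fst_V K'(2)])
    show "emeasure V (fst -` K' \<inter> space V) < \<infinity>" unfolding K'_def by (rule emeasure_compact_finite[OF c K])
  qed
  then have "integrable V \<delta>"
  proof (rule Bochner_Integration.integrable_bound[OF _ meas])
    show "AE z in V. norm (\<delta> z) \<le> norm (C * indicator (fst -` K' \<inter> space V) z)"
    proof (rule AE_I2)
      fix z assume z: "z \<in> space V"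
      show "norm (\<delta> z) \<le> norm (C * indicator (fst -` K' \<inter> space V) z)"
      proof (cases "fst z \<in> K'")
        case True
        then have z\<Omega>: "z \<in> \<Omega>" using z K'sub by (auto simp: \<Omega>_def)
        obtain p S where pS: "z = (p, S)" "p \<in> fst c" "subspace S" "dim S = m"
          using z\<Omega> by (auto simp: \<Omega>_def fst_vimage)
        have "snd c p \<in> K" using True K pS by (auto simp: K'_def)
        then have "bundle_chart c z \<in> K \<times> projections m"
          using to_chart_image[OF c pS(2-4)] by (auto simp: pS(1) bundle_chart_def projections_def)
        from C[OF this] \<delta>D[OF z\<Omega>] True z show ?thesis by (simp add: indicator_def)
      qed (simp add: \<delta>0)
    qed
  qed
  then show ?thesis by (simp add: \<delta>_def case_prod_unfold)
qed

lemma integrable_weight: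
  assumes c: "c \<in> A" and K: "compact K" "K \<subseteq> chart_image c"
    and f: "continuous_on (chart_image c) f" "\<And>x. x \<in> chart_image c \<Longrightarrow> x \<notin> K \<Longrightarrow> f x = 0"
  shows "integrable (weight V) (\<lambda>p. indicator (fst c) p * (f (snd c p) :: real))"
proof -
  interpret c: chart_map c using c atlas_chart by unfold_locales auto
  define K' where "K' = chart_inv c ` K"
  have K'c: "compact K'" unfolding K'_def by (rule compact_chart_inv_image[OF c K])
  then have K': "K' \<in> sets borel" by (simp add: compact_imp_closed borel_closed)
  have cont: "continuous_on (fst c) (\<lambda>p. f (snd c p))"
    by (rule continuous_on_compose2[OF f(1) c.continuous_chart]) auto
  have "(\<lambda>p. indicator (fst c) p *\<^sub>R f (snd c p)) \<in> borel_measurable borel"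
    by (rule borel_measurable_continuous_on_indicator[OF _ cont]) (use c.open_dom in auto)
  then have meas: "(\<lambda>p. indicator (fst c) p * f (snd c p)) \<in> borel_measurable (weight V)"
    by (simp add: measurable_def)
  obtain C where C: "\<And>x. x \<in> K \<Longrightarrow> \<bar>f x\<bar> \<le> C"
    using compact_imp_bounded[OF compact_continuous_image[OF continuous_on_subset[OF f(1) K(2)] K(1)]]
    by (auto simp: bounded_iff)
  have "integrable (weight V) (\<lambda>p. C * indicator K' p)"
  proof (intro integrable_mult_right integrable_real_indicator)
    show "emeasure (weight V) K' < \<infinity>"
      using emeasure_compact_finite[OF c K] emeasure_weight[OF K'] by (simp add: K'_def)
  qed (use K' in simp)
  then show ?thesis
  proof (rule Bochner_Integration.integrable_bound[OF _ meas])
    show "AE p in weight V. norm (indicator (fst c) p * f (snd c p)) \<le> norm (C * indicator K' p)"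
    proof (rule AE_I2)
      fix p
      show "norm (indicator (fst c) p * f (snd c p)) \<le> norm (C * indicator K' p)"
      proof (cases "p \<in> fst c \<and> snd c p \<in> K")
        case True
        then have "p \<in> K'" unfolding K'_def by (metis c.chart_inv_chart imageI)
        then show ?thesis using True C[of "snd c p"] by simp
      next
        case False
        then show ?thesis using f(2) by (auto simp: indicator_def)
      qed
    qed
  qed
qed

end

text \<open>The fourth power of the distance vanishes at \<open>x0\<close> together with its first
  and second derivatives, so subtracting it preserves gradient and Hessian there. A square would
  change the Hessian.\<close>

lemma quartic_derivs:
  fixes x0 :: "'b::euclidean_space"
  defines "q \<equiv> \<lambda>x. ((x - x0) \<bullet> (x - x0)) * ((x - x0) \<bullet> (x - x0))"
  shows "Ck_on 2 UNIV q" "fderiv q x0 = (\<lambda>u. 0)"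
    "fderiv (\<lambda>x. fderiv q x u) x0 = (\<lambda>v. 0)"
proof -
  have "Ck_on 2 UNIV (\<lambda>x :: 'b. x + (- x0))"
    by (rule Ck_on_add[OF open_UNIV Ck_on_ident[OF open_UNIV] Ck_on_const])
  from Ck_on_inner[OF open_UNIV this this] have "Ck_on 2 UNIV (\<lambda>x. (x - x0) \<bullet> (x - x0))" by simp
  from Ck_on_mult[OF open_UNIV this this] show "Ck_on 2 UNIV q" unfolding q_def .
  have "(q has_derivative (\<lambda>u. 4 * ((x - x0) \<bullet> (x - x0)) * ((x - x0) \<bullet> u))) (at x)" for x
    unfolding q_def by (auto intro!: derivative_eq_intros simp: inner_commute algebra_simps)
  from frechet_derivative_at[OF this]
  have d: "fderiv q x = (\<lambda>u. 4 * ((x - x0) \<bullet> (x - x0)) * ((x - x0) \<bullet> u))" for x by metis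
  show "fderiv q x0 = (\<lambda>u. 0)" by (simp add: d)
  have "((\<lambda>x. 4 * ((x - x0) \<bullet> (x - x0)) * ((x - x0) \<bullet> u)) has_derivative (\<lambda>v. 0)) (at x0)"
    by (auto intro!: derivative_eq_intros)
  from frechet_derivative_at[OF this]
  show "fderiv (\<lambda>x. fderiv q x u) x0 = (\<lambda>v. 0)" by (simp add: d)
qed

text \<open>The test field is \<open>\<psi> \<nabla>F\<close>. On the support of the varifold the derivative of \<open>\<psi>\<close> is a
  nonnegative multiple of that of \<open>F\<close>, so it contributes a nonnegative term to the divergence.\<close>

lemma (in chart_metric) trace_weighted_gradient:
  assumes F: "Ck_on 2 U F" and \<psi>: "\<psi> differentiable (at x)" and x: "x \<in> U"
    and D\<psi>: "\<And>u. fderiv \<psi> x u = \<kappa> * fderiv F x u" "\<kappa> \<ge> 0"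
    and S: "subspace S" "dim S = m"
  shows "\<psi> x * trace x S (hess F x) \<le> trace x S (\<lambda>u v. G x (cov (\<lambda>y. \<psi> y *\<^sub>R grad F y) x u) v)"
proof -
  define B where "B = (\<lambda>u v. G x (cov (\<lambda>y. \<psi> y *\<^sub>R grad F y) x u) v)"
  interpret inner_form "G x" using x by (rule inner_form)
  have dg: "grad F differentiable (at x)"
    using grad_C1[OF F] x by (simp add: Ck_on_differentiable)
  have dY: "(\<lambda>y. \<psi> y *\<^sub>R grad F y) differentiable (at x)"
    by (rule differentiable_scaleR[OF \<psi> dg])
  have Buv: "B u v = \<kappa> * fderiv F x u * fderiv F x v + \<psi> x * hess F x u v" for u v
    unfolding B_def cov_scaleR[OF x \<psi> dg] G_simps D\<psi> G_cov_grad[OF F x]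
      G_grad[OF x Ck_on_2_differentiable(1)[OF F x]] by simp
  have B: "bilinear B"
    using linear_cov[OF x dY] bilinear_G[OF x]
    unfolding bilinear_def B_def by (auto intro: linear_compose[unfolded o_def])
  obtain e where e: "orthonormal m e" "\<And>i. i < m \<Longrightarrow> e i \<in> S"
    using ex_orthonormal[OF S] by blast
  have "\<psi> x * trace x S (hess F x) = (\<Sum>i<m. \<psi> x * hess F x (e i) (e i))"
    using trace_eq[OF x S e bilinear_hess[OF F x]] by (simp add: sum_distrib_left)
  also have "\<dots> \<le> (\<Sum>i<m. B (e i) (e i))"
    unfolding Buv using D\<psi>(2) by (intro sum_mono) (simp add: mult.assoc)
  also have "\<dots> = trace x S B" using trace_eq[OF x S e B] by simp
  finally show ?thesis by (simp add: B_def)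
qed

section \<open>The varifold case\<close>

context riemannian_atlas begin

lemma gradient_continuous_norm:
  assumes "c \<in> A" "Ck_on 2 (chart_image c) F"
  defines "z \<equiv> chart_metric.grad (mc c) F"
  shows "continuous_on (chart_image c) (\<lambda>x. sqrt (mc c x (z x) (z x)))"
proof -
  interpret mc: chart_metric "chart_image c" "mc c" using assms by (intro chart_metric_chart)
  have "continuous_on (chart_image c) z"
    unfolding z_def by (rule Ck_on_imp_continuous_on[OF mc.grad_C1[OF assms(2)]])
  then show ?thesis
    by (intro continuous_intros mc.continuous_on_form[OF subset_refl mc.G_continuous mc.bilinear_G])
qed

text \<open>The cutoff \<open>\<psi>\<close>, and the margin \<open>\<eta>\<close> by which the \<open>m\<close>-trace of the Hessian exceeds
  \<open>h \<bar>\<nabla>F\<bar>\<close> where \<open>\<psi>\<close> is supported, contradict the first variation formula.\<close>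

lemma first_variation_contradiction:
  assumes V: "varifold A m V" and H: "generalized_mean_curvature A g V H" "AE p in weight V. gnorm g p (H p) \<le> h"
    and h: "h \<ge> 0" and c: "c \<in> A" and K: "compact K" "K \<subseteq> chart_image c"
    and F: "Ck_on 2 (chart_image c) F" and \<psi>: "Ck_on 1 (chart_image c) \<psi>" "\<And>x. \<psi> x \<ge> 0"
      "\<And>x. x \<in> chart_image c \<Longrightarrow> x \<notin> K \<Longrightarrow> \<psi> x = 0"
    and D\<psi>: "\<And>p. p \<in> varifold_support V \<Longrightarrow> p \<in> fst c \<Longrightarrow>
      \<exists>\<kappa>\<ge>0. \<forall>u. fderiv \<psi> (snd c p) u = \<kappa> * fderiv F (snd c p) u"
    and \<eta>: "\<eta> > 0" "\<And>x S. x \<in> K \<Longrightarrow> subspace S \<Longrightarrow> dim S = m \<Longrightarrow>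
      h * sqrt (mc c x (chart_metric.grad (mc c) F x) (chart_metric.grad (mc c) F x)) + \<eta> \<le>
      chart_metric.trace (mc c) x S (chart_metric.hess (mc c) F x)"
    and p: "p \<in> varifold_support V" "p \<in> fst c"
  shows "\<psi> (snd c p) = 0"
proof (rule ccontr)
  assume "\<psi> (snd c p) \<noteq> 0"
  then have \<psi>p: "\<psi> (snd c p) > 0" using \<psi>(2)[of "snd c p"] by simp
  interpret varifold_on A g m V using V by unfold_locales
  interpret c: chart_map c using c atlas_chart by unfold_locales auto
  interpret mc: chart_metric "chart_image c" "mc c" using c by (intro chart_metric_chart)
  define z where "z = mc.grad F"
  define n where "n x = sqrt (mc c x (z x) (z x))" for x
  define Y where "Y x = \<psi> x *\<^sub>R z x" for x
  define X where "X = extend_field c Y"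
  have Y: "Ck_on 1 (chart_image c) Y"
    unfolding Y_def[abs_def] z_def by (rule Ck_on_scaleR[OF c.open_image \<psi>(1) mc.grad_C1[OF F]])
  have Y0: "Y x = 0" if "x \<in> chart_image c" "x \<notin> K" for x using \<psi>(3)[OF that] by (simp add: Y_def)
  have X: "C1_vectorfield A X" unfolding X_def by (rule extend_field_C1[OF c K Y Y0])
  have X0: "X q = 0" if "q \<notin> chart_inv c ` K" for q
    unfolding X_def using extend_field_zero[OF c _ that, of Y] Y0 by blast
  have Xtest: "X \<in> test_fields A UNIV" unfolding X_def by (rule extend_field_test_field[OF c K Y Y0])
  have nc: "continuous_on (chart_image c) n"
    unfolding n_def[abs_def] z_def by (rule gradient_continuous_norm[OF c F])
  have \<psi>c: "continuous_on (chart_image c) \<psi>" by (rule Ck_on_imp_continuous_on[OF \<psi>(1)])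
  have gX: "sqrt (g q (X q) (X q)) = indicator (fst c) q * (\<psi> (snd c q) * n (snd c q))" for q
  proof (cases "q \<in> fst c")
    case True
    interpret Gq: inner_form "mc c (snd c q)" using True by (intro mc.inner_form) simp
    have "g q (X q) (X q) = mc c (snd c q) (Y (snd c q)) (Y (snd c q))"
      using True by (simp add: X_def extend_field_def metric_in_chart_eq[OF c])
    also have "sqrt \<dots> = \<psi> (snd c q) * n (snd c q)"
      using \<psi>(2)[of "snd c q"] by (simp add: Y_def Gq.G_simps n_def real_sqrt_mult)
    finally show ?thesis using True by simp
  next
    case False
    interpret gq: inner_form "g q" by (rule inner_form_metric)
    show ?thesis using False by (simp add: X_def extend_field_def gq.G_simps)
  qed
  \<comment> \<open>By \<open>gX\<close> this is \<open>h\<close> times the length of the test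
    field, the largest value that the curvature term can take; \<open>R2\<close> carries the
    margin.\<close>
  define R1 where "R1 q = indicator (fst c) q * (h * \<psi> (snd c q) * n (snd c q))" for q
  define R2 where "R2 q = indicator (fst c) q * \<psi> (snd c q)" for q
  have R1: "integrable (weight V) R1"
    unfolding R1_def by (intro integrable_weight[OF c K] continuous_intros nc \<psi>c) (simp add: \<psi>(3))
  have R2: "integrable (weight V) R2"
    unfolding R2_def by (intro integrable_weight[OF c K] \<psi>c \<psi>(3))
  define \<delta> where "\<delta> = (\<lambda>z :: 'a \<times> 'b set. plane_divergence A g X (fst z) (snd z))"
  have \<delta>: "integrable V \<delta>"
    using integrable_plane_divergence[OF c K X X0] by (simp add: \<delta>_def case_prod_unfold)
  have fv: "first_variation A g V X = (\<integral>z. \<delta> z \<partial>V)"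
    by (simp add: first_variation_def \<delta>_def case_prod_unfold)
  \<comment> \<open>Claimed only over the support, because only there is the derivative of
    \<open>\<psi>\<close> known to be a nonnegative multiple of that of \<open>F\<close>. Almost
    every plane sits over a point of the support.\<close>
  have lower: "R1 (fst w) + \<eta> * R2 (fst w) \<le> \<delta> w" if w: "w \<in> space V" "fst w \<in> varifold_support V" for w
  proof -
    obtain q S where wq: "w = (q, S)" "subspace S" "dim S = m" using w(1) by (auto simp: space_V)
    show ?thesis
    proof (cases "q \<in> fst c")
      case True
      define x where "x = snd c q"
      have x: "x \<in> chart_image c" using True by (simp add: x_def)
      define T where "T = to_chart A c q ` S"
      have T: "subspace T" "dim T = m" unfolding T_def by (rule to_chart_image[OF c True wq(2,3)])+
      have fY: "field_in_chart A c X y = Y y" if "y \<in> chart_image c" for y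
        unfolding X_def by (rule extend_field_in_chart[OF c that])
      have dY: "Y differentiable (at x)" and d\<psi>: "\<psi> differentiable (at x)"
        using Y \<psi>(1) x by (simp_all add: Ck_on_differentiable)
      obtain \<kappa> where \<kappa>: "\<kappa> \<ge> 0" "\<And>u. fderiv \<psi> x u = \<kappa> * fderiv F x u"
        using D\<psi>[of q] w(2) wq(1) True by (auto simp: x_def)
      have "R1 q + \<eta> * R2 q = \<psi> x * (h * n x + \<eta>)"
        using True by (simp add: R1_def R2_def x_def algebra_simps)
      also have "\<dots> \<le> \<psi> x * mc.trace x T (mc.hess F x)"
      proof (cases "x \<in> K")
        case True
        then show ?thesis using \<eta>(2)[OF True T] \<psi>(2) by (intro mult_left_mono) (auto simp: n_def z_def)
      qed (simp add: \<psi>(3)[OF x])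
      also have "\<dots> \<le> mc.trace x T (\<lambda>u v. mc c x (covc c Y x u) v)"
        unfolding Y_def[abs_def] z_def by (rule mc.trace_weighted_gradient[OF F d\<psi> x \<kappa>(2,1) T])
      also have "covc c Y x = covc c (field_in_chart A c X) x"
        by (rule mc.cov_cong[OF x dY fY[symmetric]])
      also have "mc.trace x T (\<lambda>u v. mc c x (covc c (field_in_chart A c X) x u) v) = \<delta> w"
        using plane_divergence_in_chart[OF c True X wq(2,3)] by (simp add: \<delta>_def wq(1) x_def T_def)
      finally show ?thesis by (simp add: wq(1))
    next
      case False
      interpret gq: inner_form "g q" by (rule inner_form_metric)
      have "closed (chart_inv c ` K)" by (intro compact_imp_closed compact_chart_inv_image c K)
      moreover have "q \<notin> chart_inv c ` K" using False K by auto
      ultimately have "cov_deriv A g X q u = 0" for u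
        by (intro cov_deriv_local_zero[of "- (chart_inv c ` K)"]) (auto simp: X0)
      then show ?thesis using False
        by (simp add: \<delta>_def wq(1) plane_divergence_def gq.G_simps R1_def R2_def)
    qed
  qed
  have "AE w in V. fst w \<in> varifold_support V"
    using AE_support unfolding weight_def by (rule AE_distrD[OF measurable_fst_V])
  then have AE_lower: "AE w in V. R1 (fst w) + \<eta> * R2 (fst w) \<le> \<delta> w"
    by (rule AE_mp) (intro AE_I2 impI lower)
  have R: "integrable (weight V) (\<lambda>q. R1 q + \<eta> * R2 q)" using R1 R2 by simp
  then have RV: "integrable V (\<lambda>w. R1 (fst w) + \<eta> * R2 (fst w))"
    unfolding weight_def by (rule integrable_distr[OF measurable_fst_V])
  have Rm: "(\<lambda>q. R1 q + \<eta> * R2 q) \<in> borel_measurable borel"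
    using borel_measurable_integrable[OF R] by (simp add: measurable_def)
  have "(\<integral>q. R1 q \<partial>weight V) + \<eta> * (\<integral>q. R2 q \<partial>weight V) = (\<integral>q. R1 q + \<eta> * R2 q \<partial>weight V)"
    using R1 R2 by simp
  also have "\<dots> = (\<integral>w. R1 (fst w) + \<eta> * R2 (fst w) \<partial>V)"
    unfolding weight_def by (rule integral_distr[OF measurable_fst_V Rm])
  also have "\<dots> \<le> first_variation A g V X"
    unfolding fv by (rule integral_mono_AE[OF RV \<delta> AE_lower])
  also have "\<dots> = - (\<integral>q. g q (H q) (X q) \<partial>weight V)"
    using H(1) Xtest by (simp add: generalized_mean_curvature_def)
  also have "\<dots> \<le> (\<integral>q. R1 q \<partial>weight V)"
  proof (cases "integrable (weight V) (\<lambda>q. g q (H q) (X q))")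
    case True
    have "(\<integral>q. - g q (H q) (X q) \<partial>weight V) \<le> (\<integral>q. R1 q \<partial>weight V)"
    proof (rule integral_mono_AE[OF _ R1])
      show "AE q in weight V. - g q (H q) (X q) \<le> R1 q"
        using H(2)
      proof eventually_elim
        case (elim q)
        interpret gq: inner_form "g q" by (rule inner_form_metric)
        have "- g q (H q) (X q) \<le> sqrt (g q (H q) (H q)) * sqrt (g q (X q) (X q))"
          using gq.cauchy_schwarz[of "H q" "X q"] by linarith
        also have "\<dots> \<le> h * sqrt (g q (X q) (X q))"
          using elim gq.G_nonneg by (intro mult_right_mono) (auto simp: gnorm_def)
        also have "\<dots> = R1 q" by (simp add: gX R1_def mult_ac)
        finally show ?case .
      qed
    qed (use True in simp)
    then show ?thesis by simp
  next
    \<comment> \<open>The integral of a non-integrable function is 0, so the claim reduces to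
      nonnegativity of \<open>R1\<close>.\<close>
    case False
    have "0 \<le> R1 q" for q
    proof -
      have "0 \<le> sqrt (g q (X q) (X q))" using inner_form.G_nonneg[OF inner_form_metric] by simp
      then have "0 \<le> h * sqrt (g q (X q) (X q))" using h by simp
      also have "\<dots> = R1 q" by (simp add: gX R1_def mult_ac)
      finally show ?thesis .
    qed
    then show ?thesis using False by (simp add: not_integrable_integral_eq)
  qed
  finally have "\<eta> * (\<integral>q. R2 q \<partial>weight V) \<le> 0" by simp
  then have "(\<integral>q. R2 q \<partial>weight V) \<le> 0" using \<eta>(1) by (simp add: mult_le_0_iff)
  moreover have R2_nonneg: "0 \<le> R2 q" for q using \<psi>(2) by (simp add: R2_def)
  ultimately have "(\<integral>q. R2 q \<partial>weight V) = 0"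
    by (intro antisym integral_nonneg_AE) auto
  then have AE0: "AE q in weight V. R2 q = 0"
    using integral_nonneg_eq_0_iff_AE[OF R2] R2_nonneg by simp
  \<comment> \<open>The integral of the margin has been forced to 0, so this open neighbourhood of
    \<open>p\<close> is a null set, which is impossible at a point of the support.\<close>
  define Q where "Q = {q \<in> fst c. \<psi> (snd c q) > 0}"
  have "continuous_on (fst c) (\<lambda>q. \<psi> (snd c q))"
    by (rule continuous_on_compose2[OF \<psi>c c.continuous_chart]) auto
  then have "open (fst c \<inter> (\<lambda>q. \<psi> (snd c q)) -` {0<..})"
    by (rule continuous_open_preimage[OF _ c.open_dom open_greaterThan])
  moreover have "Q = fst c \<inter> (\<lambda>q. \<psi> (snd c q)) -` {0<..}" by (auto simp: Q_def)
  ultimately have Q: "open Q" by simp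
  have "AE q in weight V. q \<notin> Q"
    using AE0 by eventually_elim (auto simp: R2_def Q_def)
  then have "emeasure (weight V) Q = 0"
    using Q by (subst (asm) AE_iff_measurable[OF _ refl]) auto
  moreover have "p \<in> Q" using p(2) \<psi>p by (simp add: Q_def)
  ultimately show False using p(1) Q by (auto simp: varifold_support_def)
qed

lemma varifold_mh_subset:
  assumes V: "varifold A m V" and H: "generalized_mean_curvature A g V H" "AE p in weight V. gnorm g p (H p) \<le> h"
  shows "mh_subset A g m h (varifold_support V)"
  unfolding mh_subset_def
proof (intro conjI allI impI, goal_cases)
  interpret varifold_on A g m V using V by unfold_locales
  {
    case 1
    show ?case by (rule closed_support)
  next
    case (2 f p)
    then obtain N where f: "C2_function A f" and p: "p \<in> varifold_support V"
      and N: "open N" "p \<in> N" "\<And>q. q \<in> N \<Longrightarrow> q \<in> varifold_support V \<Longrightarrow> f q \<le> f p" by blast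
    show ?case
    proof (rule ccontr)
      assume "\<not> ?case"
      then have gt: "h * fun_deriv_norm A g f p < lowest_trace m (g p) (hessian A g f p)" by simp
      \<comment> \<open>A negative bound on a norm could hold almost everywhere only for the zero
        measure, whose support is empty.\<close>
      have h: "h \<ge> 0"
      proof (rule ccontr)
        assume "\<not> h \<ge> 0"
        have "0 \<le> gnorm g q (H q)" for q
          using inner_form.G_nonneg[OF inner_form_metric] by (simp add: gnorm_def)
        then have "AE q in weight V. False"
          using H(2) \<open>\<not> h \<ge> 0\<close> by (auto elim!: eventually_mono intro: order_trans)
        then have "emeasure (weight V) UNIV = 0"
          by (subst (asm) AE_iff_measurable[where N = UNIV]) auto
        then show False using p by (auto simp: varifold_support_def)
      qed
      define c where "c = chart_at A p"
      have c: "c \<in> A" "p \<in> fst c" unfolding c_def by (rule chart_at)+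
      interpret c: chart_map c using c atlas_chart by unfold_locales auto
      interpret mc: chart_metric "chart_image c" "mc c" using c by (intro chart_metric_chart)
      interpret gp: inner_form "g p" by (rule inner_form_metric)
      define x0 where "x0 = snd c p"
      have x0: "x0 \<in> chart_image c" using c by (simp add: x0_def)
      have mcx0: "mc c x0 = g p" unfolding x0_def c_def by (rule metric_chart_at)
      define f0 where "f0 = f \<circ> chart_inv c"
      have f0: "Ck_on 2 (chart_image c) f0" using f c by (simp add: f0_def C2_function_def)
      define q4 where "q4 x = ((x - x0) \<bullet> (x - x0)) * ((x - x0) \<bullet> (x - x0))" for x
      note q4 = quartic_derivs[of x0, folded q4_def]
      define F where "F x = f0 x + (- 1) * q4 x" for x
      have q4U: "Ck_on 2 (chart_image c) (\<lambda>x. (- 1) * q4 x)"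
        by (rule Ck_on_mult[OF c.open_image Ck_on_const Ck_on_subset[OF q4(1)]]) simp
      have F: "Ck_on 2 (chart_image c) F"
        unfolding F_def[abs_def] by (rule Ck_on_add[OF c.open_image f0 q4U])
      have DF: "fderiv F x u = fderiv f0 x u + (- 1) * fderiv q4 x u"
        if "x \<in> chart_image c" for x u
      proof -
        have "(F has_derivative (\<lambda>u. fderiv f0 x u + (- 1) * fderiv q4 x u)) (at x)"
          unfolding F_def[abs_def]
          by (intro has_derivative_add has_derivative_mult_right has_frechet_derivative
              Ck_on_2_differentiable(1)[OF f0 that] Ck_on_2_differentiable(1)[OF q4(1) UNIV_I])
        from fun_cong[OF frechet_derivative_at[OF this], of u] show ?thesis by simp
      qed
      have DFx0: "fderiv F x0 = fderiv f0 x0"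
        by (rule ext) (simp add: DF[OF x0] q4(2))
      have D2F: "fderiv (\<lambda>x. fderiv F x u) x0 v =
          fderiv (\<lambda>x. fderiv f0 x u) x0 v" for u v
      proof -
        have "((\<lambda>x. fderiv f0 x u + (- 1) * fderiv q4 x u) has_derivative
          (\<lambda>v. fderiv (\<lambda>x. fderiv f0 x u) x0 v +
            (- 1) * fderiv (\<lambda>x. fderiv q4 x u) x0 v)) (at x0)"
          by (intro has_derivative_add has_derivative_mult_right has_frechet_derivative
              Ck_on_2_differentiable(2)[OF f0 x0] Ck_on_2_differentiable(2)[OF q4(1) UNIV_I])
        then have "((\<lambda>x. fderiv F x u) has_derivative
          (\<lambda>v. fderiv (\<lambda>x. fderiv f0 x u) x0 v +
            (- 1) * fderiv (\<lambda>x. fderiv q4 x u) x0 v)) (at x0)"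
          by (rule has_derivative_transform_within_open[OF _ c.open_image x0]) (rule DF[symmetric])
        from fun_cong[OF frechet_derivative_at[OF this], of v] show ?thesis by (simp add: q4(3))
      qed
      have hessF: "mc.hess F x0 = hessian A g f p"
        unfolding hessian_eq[abs_def] c_def[symmetric] x0_def[symmetric] f0_def[symmetric] mc.hess_def[abs_def]
        by (simp add: D2F DFx0)
      define z where "z = mc.grad F"
      have zx0: "z x0 = mc.grad f0 x0" unfolding z_def mc.grad_def DFx0 ..
      have "sqrt (g p (z x0) (z x0)) \<le> fun_deriv_norm A g f p"
      proof (rule gradient_norm_le)
        show "fun_deriv A f p u = g p (z x0) u" for u
          unfolding zx0 unfolding x0_def f0_def c_def by (rule fun_deriv_eq_grad[OF f])
      qed
      \<comment> \<open>Ky Fan's principle turns the assumed strict inequality for the lowest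
        eigenvalues into one for every orthonormal frame at \<open>x0\<close>, hence for every
        m-plane.\<close>
      then have gt': "h * sqrt (mc c x0 (z x0) (z x0)) < (\<Sum>i<m. mc.hess F x0 (e i) (e i))"
        if "inner_form.orthonormal (mc c x0) m e" for e
        using mult_left_mono[OF _ h, of "sqrt (g p (z x0) (z x0))" "fun_deriv_norm A g f p"] gt
          gp.lowest_trace_le[OF bilinear_hessian[OF f, of p], of m e] that
        unfolding mcx0 hessF by linarith
      have hz: "continuous_on (chart_image c) (\<lambda>x. h * sqrt (mc c x (z x) (z x)))"
        unfolding z_def by (intro continuous_on_mult continuous_on_const gradient_continuous_norm c F)
      obtain \<rho> \<eta> where \<rho>: "\<rho> > 0" and \<eta>: "\<eta> > 0" "\<And>y S. y \<in> ball x0 \<rho> \<Longrightarrow> y \<in> chart_image c \<Longrightarrow> subspace S \<Longrightarrow> dim S = m \<Longrightarrow>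
          h * sqrt (mc c y (z y) (z y)) + \<eta> \<le> mc.trace y S (mc.hess F y)"
        using mc.trace_lower_bound_local[OF x0 mc.bilinear_hess[OF F] mc.continuous_hess[OF F] hz gt'] by auto
      define W where "W = snd c ` (fst c \<inter> N) \<inter> ball x0 \<rho>"
      have "open W" unfolding W_def by (intro open_Int c.open_chart_image N open_ball)
      moreover have "x0 \<in> W" using c N \<rho> by (auto simp: W_def x0_def)
      ultimately obtain r0 where r0: "r0 > 0" "cball x0 r0 \<subseteq> W" using open_contains_cball by blast
      \<comment> \<open>The bump equals 1 up to radius \<open>r\<close> and vanishes from
        \<open>2 * r\<close> on; halving keeps the larger ball inside \<open>W\<close>, where both
        the local maximum and the margin are available.\<close>
      define r where "r = r0 / 2"
      have r: "r > 0" using r0 by (simp add: r_def)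
      define K where "K = cball x0 (2 * r)"
      have KW: "K \<subseteq> W" using r0 by (simp add: K_def r_def)
      have K: "compact K" "K \<subseteq> chart_image c" using KW c.image_subset by (auto simp: K_def W_def)
      obtain \<beta> :: "'b \<Rightarrow> real" where \<beta>: "Ck_on 1 UNIV \<beta>" "\<And>x. \<beta> x \<ge> 0"
        "\<And>x. norm (x - x0) \<le> r \<Longrightarrow> \<beta> x = 1" "\<And>x. norm (x - x0) \<ge> 2 * r \<Longrightarrow> \<beta> x = 0"
        using ex_bump[OF r, of x0] by metis
      \<comment> \<open>The shift is the value of the quartic at distance \<open>r\<close>. On the
        support within \<open>K\<close> and at distance at least \<open>r\<close> it makes
        \<open>t\<close> nonpositive, while \<open>t\<close> equals \<open>r ^ 4\<close> at
        \<open>x0\<close>.\<close>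
      define t where "t x = F x + (- F x0 + r ^ 4)" for x
      define \<psi> where "\<psi> x = \<beta> x * pos_sq (t x)" for x
      have t1: "Ck_on 1 (chart_image c) t"
        unfolding t_def[abs_def] by (rule Ck_on_add[OF c.open_image Ck_on_antimono[OF F] Ck_on_const]) simp
      have ps1: "Ck_on 1 (chart_image c) (\<lambda>x. pos_sq (t x))"
        by (rule Ck_on_compose[OF c.open_image _ Ck_on_pos_sq t1]) simp
      have \<psi>1: "Ck_on 1 (chart_image c) \<psi>"
        unfolding \<psi>_def[abs_def] by (rule Ck_on_mult[OF c.open_image Ck_on_subset[OF \<beta>(1)] ps1]) simp
      have \<beta>0: "\<beta> x = 0" if "x \<notin> K" for x
        using that \<beta>(4)[of x] by (simp add: K_def dist_norm norm_minus_commute)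
      have D\<psi>: "\<exists>\<kappa>\<ge>0. \<forall>u. fderiv \<psi> (snd c q) u = \<kappa> * fderiv F (snd c q) u"
        if q: "q \<in> varifold_support V" "q \<in> fst c" for q
      proof -
        define x where "x = snd c q"
        have x: "x \<in> chart_image c" using q by (simp add: x_def)
        have dt: "(t has_derivative fderiv F x) (at x)"
        proof -
          have "(t has_derivative (\<lambda>u. fderiv F x u + 0)) (at x)"
            unfolding t_def[abs_def]
            by (intro has_derivative_add has_derivative_const has_frechet_derivative Ck_on_2_differentiable(1)[OF F x])
          then show ?thesis by simp
        qed
        have d\<beta>: "(\<beta> has_derivative fderiv \<beta> x) (at x)"
          using Ck_on_has_derivative[of 0 UNIV \<beta> x] \<beta>(1) by simp
        have "(\<psi> has_derivative (\<lambda>u. \<beta> x * (2 * max 0 (t x) * fderiv F x u) +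
            fderiv \<beta> x u * pos_sq (t x))) (at x)"
          unfolding \<psi>_def[abs_def]
          by (rule has_derivative_mult[OF d\<beta> has_derivative_compose[OF dt has_derivative_pos_sq]])
        note D = fun_cong[OF frechet_derivative_at[OF this]]
        \<comment> \<open>The bump is locally constant inside the ball of radius \<open>r\<close>
          and outside \<open>K\<close>. In the remaining annulus the other factor vanishes, because
          \<open>f\<close> is at most \<open>f p\<close> on the support and the quartic is at least
          \<open>r ^ 4\<close>.\<close>
        have D\<beta>: "fderiv \<beta> x u * pos_sq (t x) = 0" for u
        proof -
          have const: "fderiv \<beta> x u = 0"
            if "open B" "x \<in> B" "\<And>y. y \<in> B \<Longrightarrow> \<beta> y = k" for B k
          proof -
            have "((\<lambda>_. k) has_derivative (\<lambda>_. 0)) (at x)" by simp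
            then have "(\<beta> has_derivative (\<lambda>_. 0)) (at x)"
              by (rule has_derivative_transform_within_open[OF _ that(1,2)]) (simp add: that(3))
            from fun_cong[OF frechet_derivative_at[OF this], of u] show ?thesis by simp
          qed
          consider "norm (x - x0) < r" | "x \<notin> K" | "r \<le> norm (x - x0)" "x \<in> K" by linarith
          then show ?thesis
          proof cases
            case 1
            then have "fderiv \<beta> x u = 0"
              by (intro const[of "ball x0 r" 1]) (auto intro!: \<beta>(3) simp: dist_norm norm_minus_commute)
            then show ?thesis by simp
          next
            case 2
            then have "fderiv \<beta> x u = 0"
              by (intro const[of "- K" 0]) (auto simp: \<beta>0 K_def open_Compl)
            then show ?thesis by simp
          next
            case 3
            have "chart_inv c x \<in> N" using 3(2) KW x c.mem_image_iff[of x N] by (auto simp: W_def)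
            then have "f q \<le> f p" using N(3) q by (simp add: x_def)
            then have "f0 x \<le> f0 x0" using q c by (simp add: f0_def x_def x0_def)
            moreover have "r ^ 4 \<le> q4 x"
            proof -
              have "r ^ 4 \<le> norm (x - x0) ^ 4" using 3(1) r by (intro power_mono) auto
              also have "\<dots> = (norm (x - x0))\<^sup>2 * (norm (x - x0))\<^sup>2" by (simp flip: power_add)
              finally show ?thesis by (simp add: q4_def power2_norm_eq_inner)
            qed
            moreover have "q4 x0 = 0" by (simp add: q4_def)
            ultimately have "t x \<le> 0" by (simp add: t_def F_def)
            then show ?thesis by (simp add: pos_sq_zero)
          qed
        qed
        have "fderiv \<psi> x u = (\<beta> x * (2 * max 0 (t x))) * fderiv F x u" for u
          using D[of u] D\<beta>[of u] by (simp add: mult.assoc)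
        moreover have "\<beta> x * (2 * max 0 (t x)) \<ge> 0" using \<beta>(2) by simp
        ultimately show ?thesis unfolding x_def[symmetric] by blast
      qed
      have "\<psi> (snd c p) = 0"
      proof (rule first_variation_contradiction[OF V H h c(1) K F \<psi>1 _ _ D\<psi> \<eta>(1) _ p c(2)])
        show "\<psi> x \<ge> 0" for x by (simp add: \<psi>_def \<beta>(2) pos_sq_nonneg)
        show "\<psi> x = 0" if "x \<notin> K" for x by (simp add: \<psi>_def \<beta>0[OF that])
        show "h * sqrt (mc c x (mc.grad F x) (mc.grad F x)) + \<eta> \<le> mc.trace x S (mc.hess F x)"
          if "x \<in> K" "subspace S" "dim S = m" for x S
        proof -
          have "x \<in> ball x0 \<rho>" "x \<in> chart_image c" using that(1) KW K(2) by (auto simp: W_def)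
          from \<eta>(2)[OF this that(2,3)] show ?thesis by (simp add: z_def)
        qed
      qed auto
      moreover have "\<psi> x0 > 0"
        using r \<beta>(3)[of x0] by (simp add: \<psi>_def t_def pos_sq_pos)
      ultimately show False by (simp add: x0_def)
    qed
  }
qed

end

theorem corollary2p8:
  fixes A :: "('a::{t2_space, second_countable_topology}, 'b::euclidean_space) chart set"
    and g :: "'a \<Rightarrow> 'b \<Rightarrow> 'b \<Rightarrow> real"
    and m :: nat and h :: real
  assumes "smooth_atlas A" and "C1_metric A g"
  shows "(\<forall>M. proper_submanifold A m M \<and>
            (\<forall>p\<in>M. gnorm g p (mean_curvature_vector A g M p) \<le> h) \<longrightarrow>
            mh_subset A g m h M) \<and>
         (\<forall>V H. varifold A m V \<and> locally_bounded_first_variation A g V \<and>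
            no_generalized_boundary A g V \<and> generalized_mean_curvature A g V H \<and>
            (AE p in weight V. gnorm g p (H p) \<le> h) \<longrightarrow>
            mh_subset A g m h (varifold_support V))"
proof -
  interpret riemannian_atlas A g using assms by unfold_locales
  show ?thesis using submanifold_mh_subset varifold_mh_subset by blast
qed

end
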